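(* Let $T$ be a finite set, let $\mu$ be a probability measure on $E^T$ with regular conditional distributions $\mu_i(dx_i|x)$, $i\in T$, and let $C=(c_{ij})_{i,j\in T}$ be its $d$-Dobrushin interdependence matrix. Assume that $\|C\|_1:=\sup_{j}\sum_{i}c_{ij}<1$. Then for any probability measure $\nu$ on $E^T$, $$W_{1,d_{l_1}}(\mu,\nu)\le\frac{1}{1-\|C\|_1}\sum_{j\in T}\mathbb{E}^\nu\, W_{1,d}(\mu_j,\nu_j),$$ where $\nu_j=\nu_j(\cdot|x)$ is the regular conditional distribution of $x_j$ knowing $x_{T\setminus\{j\}}$ under $\nu$, and $d_{l_1}(x,y):=\sum_{i\in T}d(x_i,y_i)$.
   Context: $(E,\mathcal{B},d)$ is either a complete separable metric space with its Borel $\sigma$-field $\mathcal{B}$, or a measurable space $(E,\mathcal{B})$ with the trivial metric $d(x,y)=\mathbb{1}_{x\ne y}$, assumed $\mathcal{B}\times\mathcal{B}$-measurable. $E^T$ carries the product $\sigma$-field. For each $i\in T$, $\mu_i(dx_i|x)$ is a given regular conditional distribution under $\mu$ of $x_i$ knowing $x_{T\setminus\{i\}}$ (a probability kernel, defined for every $x\in E^T$ and depending on $x$ only through $x_{T\setminus\{i\}}$). In $\mathbb{E}^\nu W_{1,d}(\mu_j,\nu_j)$ one integrates $x\mapsto W_{1,d}(\mu_j(\cdot|x),\nu_j(\cdot|x))$ against $\nu$. For a metric $\rho$, $W_{1,\rho}(\nu_1,\nu_2)=\inf_\pi\iint\rho(x,y)\,\pi(dx,dy)$, infimum over couplings $\pi$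 of $\nu_1,\nu_2$. The $d$-Dobrushin interdependence coefficients are $$c_{ij}:=\sup\left\{\frac{W_{1,d}(\mu_i(\cdot|x),\mu_i(\cdot|y))}{d(x_j,y_j)}:\ x,y\in E^T,\ x=y\text{ off }j,\ x_j\neq y_j\right\},\quad i,j\in T$$ (so $c_{ii}=0$). *)

theory Defs
  imports "HOL-Probability.Probability"
begin

definition borel_polish_metric :: "'a measure \<Rightarrow> ('a \<Rightarrow> 'a \<Rightarrow> real) \<Rightarrow> bool" where
  "borel_polish_metric E d \<longleftrightarrow>
     Metric_space (space E) d \<and> Metric_space.mcomplete (space E) d \<and>
     separable_space (Metric_space.mtopology (space E) d) \<and>
     sets E = sigma_sets (space E) {U. openin (Metric_space.mtopology (space E) d) U}"

definition measurable_trivial_metric :: "'a measure \<Rightarrow> ('a \<Rightarrow> 'a \<Rightarrow> real) \<Rightarrow> bool" where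
  "measurable_trivial_metric E d \<longleftrightarrow>
     (\<forall>x\<in>space E. \<forall>y\<in>space E. d x y = (if x = y then 0 else 1)) \<and>
     (\<lambda>(x, y). d x y) \<in> borel_measurable (E \<Otimes>\<^sub>M E)"

definition couplings :: "'a measure \<Rightarrow> 'b measure \<Rightarrow> ('a \<times> 'b) measure set" where
  "couplings M N =
     {\<pi>. sets \<pi> = sets (M \<Otimes>\<^sub>M N) \<and> distr \<pi> M fst = M \<and> distr \<pi> N snd = N}"

text \<open>No moment condition is imposed, so the distance may be infinite.\<close>

definition wasserstein1 :: "('a \<Rightarrow> 'a \<Rightarrow> real) \<Rightarrow> 'a measure \<Rightarrow> 'a measure \<Rightarrow> ennreal" where
  "wasserstein1 \<rho> M N =
     (INF \<pi>\<in>couplings M N. \<integral>\<^sup>+ z. ennreal (\<rho> (fst z) (snd z)) \<partial>\<pi>)"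

definition l1_metric :: "'i set \<Rightarrow> ('a \<Rightarrow> 'a \<Rightarrow> real) \<Rightarrow> ('i \<Rightarrow> 'a) \<Rightarrow> ('i \<Rightarrow> 'a) \<Rightarrow> real" where
  "l1_metric T d x y = (\<Sum>i\<in>T. d (x i) (y i))"

text \<open>The \<open>\<sigma>\<close>-field on the product space generated by all coordinates in \<open>T\<close> except \<open>i\<close>.\<close>

definition off_site_algebra :: "'i set \<Rightarrow> 'a measure \<Rightarrow> 'i \<Rightarrow> ('i \<Rightarrow> 'a) measure" where
  "off_site_algebra T E i =
     vimage_algebra (space (\<Pi>\<^sub>M j\<in>T. E)) (\<lambda>x. restrict x (T - {i})) (\<Pi>\<^sub>M j\<in>T - {i}. E)"

definition is_site_cond_distr ::
  "'i set \<Rightarrow> 'a measure \<Rightarrow> ('i \<Rightarrow> 'a) measure \<Rightarrow> 'i \<Rightarrow> (('i \<Rightarrow> 'a) \<Rightarrow> 'a measure) \<Rightarrow> bool" where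
  "is_site_cond_distr T E \<mu> i \<kappa> \<longleftrightarrow>
     \<kappa> \<in> (\<Pi>\<^sub>M j\<in>T. E) \<rightarrow>\<^sub>M prob_algebra E \<and>
     (\<forall>x\<in>space (\<Pi>\<^sub>M j\<in>T. E). \<forall>y\<in>space (\<Pi>\<^sub>M j\<in>T. E).
        (\<forall>j\<in>T - {i}. x j = y j) \<longrightarrow> \<kappa> x = \<kappa> y) \<and>
     (\<forall>A\<in>sets E. AE x in \<mu>.
        measure (\<kappa> x) A =
        real_cond_exp \<mu> (off_site_algebra T E i) (\<lambda>z. indicator A (z i)) x)"

definition dobrushin_coeff ::
  "'i set \<Rightarrow> 'a measure \<Rightarrow> ('a \<Rightarrow> 'a \<Rightarrow> real) \<Rightarrow> ('i \<Rightarrow> ('i \<Rightarrow> 'a) \<Rightarrow> 'a measure) \<Rightarrow> 'i \<Rightarrow> 'i \<Rightarrow> ennreal"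
where
  "dobrushin_coeff T E d \<kappa> i j =
     (SUP (x, y) \<in> {(x, y). x \<in> space (\<Pi>\<^sub>M k\<in>T. E) \<and> y \<in> space (\<Pi>\<^sub>M k\<in>T. E) \<and>
                           (\<forall>k\<in>T - {j}. x k = y k) \<and> x j \<noteq> y j}.
        wasserstein1 d (\<kappa> i x) (\<kappa> i y) / ennreal (d (x j) (y j)))"

definition dobrushin_norm1 ::
  "'i set \<Rightarrow> 'a measure \<Rightarrow> ('a \<Rightarrow> 'a \<Rightarrow> real) \<Rightarrow> ('i \<Rightarrow> ('i \<Rightarrow> 'a) \<Rightarrow> 'a measure) \<Rightarrow> ennreal"
where
  "dobrushin_norm1 T E d \<kappa> = (SUP j\<in>T. \<Sum>i\<in>T. dobrushin_coeff T E d \<kappa> i j)"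

end

theory Submission
  imports Defs
begin

text \<open>Single-site resampling with the kernels of \<open>\<mu>\<close> preserves \<open>\<mu>\<close>, while replacing the kernel of
  \<open>\<nu>\<close> by that of \<open>\<mu>\<close> at site \<open>j\<close> costs at most \<open>\<integral> W(\<mu>\<^sub>j, \<nu>\<^sub>j) d\<nu>\<close>, and the column sums of the
  Dobrushin matrix control how resampling spreads discrepancies.

  For a separable metric the argument is run on the dual side: averaging a bounded 1-Lipschitz function
  over a uniformly chosen resampled site multiplies its Lipschitz constant by \<open>1 - (1 - \<parallel>C\<parallel>) / |T|\<close>, so
  the iterates converge to a constant and the errors form a geometric series. This needs no moment
  condition and no measurable choice of couplings; everything is put into a Kantorovich duality for
  bounded Lipschitz functions, obtained by discretising the space, solving finite transport problems and
  passing to the limit in the countable matrices.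

  For the trivial metric on an arbitrary measurable space duality is not available, but the cost is
  bounded. There a nearly optimal coupling of \<open>\<mu>\<close> and \<open>\<nu>\<close> is updated at one site by the maximal coupling
  of the two kernels; near-optimality gives \<open>e\<^sub>i \<le> \<Sum>\<^sub>j c\<^sub>i\<^sub>j e\<^sub>j + \<integral> W(\<mu>\<^sub>i, \<nu>\<^sub>i) d\<nu> + \<epsilon>\<close> for the
  disagreement probabilities \<open>e\<^sub>i\<close>, and summing over \<open>i\<close> yields the claim.\<close>

section \<open>Kantorovich duality on separable spaces\<close>

text \<open>Two obstacles shape the argument. The integrand
  \<open>wasserstein1 d (\<mu>c j x) (\<nu>c j x)\<close> is not known to be measurable in
  \<open>x\<close>, so its \<open>nn_integral\<close> is only a supremum over simple functions below
  it, which is monotone but not additive in general. Every estimate therefore first produces a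
  measurable function lying pointwise below the integrand and integrates afterwards. The second
  obstacle is infinite cost: near-optimality cannot be exploited by subtracting infinite quantities.
  With bounded test functions all integrals are finite, and in the trivial metric the cost is at
  most the number of sites. The column sums are the right quantity because a discrepancy at one site
  \<open>j\<close> reaches each site \<open>i\<close> with weight \<open>c i j\<close>, and
  \<open>l1_metric\<close> adds the results over \<open>i\<close>. On the dual side the same sum
  measures how strongly the resampled functions together depend on coordinate \<open>j\<close>. The
  number n of sites disappears from the final constant: one averaged step costs only 1/n of the
  right-hand sum, while the series of contraction factors sums to n / (1 - r).\<close>

lemma compact_PiE_UNIV:
  fixes S :: "'k \<Rightarrow> 'b::topological_space set"
  assumes "\<And>z. compact (S z)"
  shows "compact (PiE UNIV S)"
  using assms compactin_PiE[of "\<lambda>_. euclidean" "UNIV :: 'k set" S]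
  by (simp add: euclidean_product_topology)

text \<open>First-order condition at a boundary minimum: a quadratic that vanishes at 0 and is
  nonnegative just to the right of it cannot have a negative slope there. It is applied along
  segments starting at a minimiser.\<close>

lemma nonneg_linear_term:
  fixes D Q :: real
  assumes "\<And>t. 0 < t \<Longrightarrow> t \<le> 1 \<Longrightarrow> 0 \<le> 2 * t * D + t\<^sup>2 * Q"
  shows "0 \<le> D"
proof (rule ccontr)
  assume "\<not> 0 \<le> D"
  \<comment> \<open>For this \<open>t\<close> the quadratic term is at most half as large as the
    linear one, so the sum keeps the sign of \<open>D\<close>.\<close>
  define t where "t = min 1 (- D / (\<bar>Q\<bar> + 1))"
  have t: "0 < t" "t \<le> 1" using \<open>\<not> 0 \<le> D\<close> by (auto simp: t_def divide_simps)
  have "t * (\<bar>Q\<bar> + 1) \<le> - D"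
    using \<open>\<not> 0 \<le> D\<close> by (simp add: t_def min_def divide_simps split: if_splits)
  moreover have "t * Q \<le> t * (\<bar>Q\<bar> + 1)" using t by (intro mult_left_mono) auto
  ultimately have "2 * D + t * Q < 0" using \<open>\<not> 0 \<le> D\<close> by linarith
  then have "t * (2 * D + t * Q) < 0" using t by (simp add: mult_pos_neg)
  with assms[OF t] show False by (simp add: algebra_simps power2_eq_square)
qed

text \<open>Minimise the squared violation of the marginal and cost constraints over probability matrices;
  if the minimum were positive, the first-order condition at the minimiser would be a dual certificate
  against the hypothesis.\<close>

lemma finite_kantorovich:
  fixes c :: "'k \<Rightarrow> 'k \<Rightarrow> real" and m n :: "'k \<Rightarrow> real"
  assumes fin: "finite I"
    and m: "\<And>k. k \<in> I \<Longrightarrow> 0 \<le> m k" "(\<Sum>k\<in>I. m k) = 1"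
    and n: "\<And>k. k \<in> I \<Longrightarrow> 0 \<le> n k" "(\<Sum>k\<in>I. n k) = 1"
    and c0: "\<And>k. k \<in> I \<Longrightarrow> c k k = 0"
    and ctri: "\<And>j k l. j \<in> I \<Longrightarrow> k \<in> I \<Longrightarrow> l \<in> I \<Longrightarrow> c j l \<le> c j k + c k l"
    and dual: "\<And>g. (\<And>k l. k \<in> I \<Longrightarrow> l \<in> I \<Longrightarrow> g k - g l \<le> c k l) \<Longrightarrow>
                 (\<Sum>k\<in>I. g k * (m k - n k)) \<le> A"
  obtains p :: "'k \<times> 'k \<Rightarrow> real" where
    "\<And>z. 0 \<le> p z" "\<And>z. z \<notin> I \<times> I \<Longrightarrow> p z = 0"
    "\<And>k. k \<in> I \<Longrightarrow> (\<Sum>l\<in>I. p (k, l)) = m k"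
    "\<And>l. l \<in> I \<Longrightarrow> (\<Sum>k\<in>I. p (k, l)) = n l"
    "(\<Sum>z\<in>I \<times> I. p z * c (fst z) (snd z)) \<le> A"
proof -
  define row where "row = (\<lambda>(p :: 'k \<times> 'k \<Rightarrow> real) k. \<Sum>l\<in>I. p (k, l))"
  define col where "col = (\<lambda>(p :: 'k \<times> 'k \<Rightarrow> real) l. \<Sum>k\<in>I. p (k, l))"
  define cost where "cost = (\<lambda>p :: 'k \<times> 'k \<Rightarrow> real. \<Sum>z\<in>I \<times> I. p z * c (fst z) (snd z))"
  \<comment> \<open>Entries outside \<open>I \<times> I\<close> are frozen at 0, so the matrices
    form a closed subset of a product of compact sets over all index pairs.\<close>
  define X where "X = PiE UNIV (\<lambda>z. if z \<in> I \<times> I then {0..1} else {0 :: real}) \<inter>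
    {p. (\<Sum>z\<in>I \<times> I. p z) = 1}"
  define \<Phi> where "\<Phi> = (\<lambda>p. (\<Sum>k\<in>I. (m k - row p k)\<^sup>2) + (\<Sum>l\<in>I. (n l - col p l)\<^sup>2) +
    (max 0 (cost p - A))\<^sup>2)"
  have cont: "continuous_on UNIV (\<lambda>p :: 'k \<times> 'k \<Rightarrow> real. p z)" for z
    by simp
  have "compact X"
    unfolding X_def
    by (intro compact_Int_closed compact_PiE_UNIV closed_Collect_eq continuous_intros cont) auto
  have inX: "p \<in> X" if "\<And>z. 0 \<le> p z" "\<And>z. z \<notin> I \<times> I \<Longrightarrow> p z = 0" "(\<Sum>z\<in>I \<times> I. p z) = 1" for p
  proof -
    have "p z \<le> 1" if z: "z \<in> I \<times> I" for z
      using member_le_sum[OF z, of p] that fin \<open>\<And>z. 0 \<le> p z\<close> \<open>(\<Sum>z\<in>I \<times> I. p z) = 1\<close> by auto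
    then show ?thesis using that by (auto simp: X_def)
  qed
  have Xnn: "0 \<le> p z" "z \<notin> I \<times> I \<Longrightarrow> p z = 0" "(\<Sum>z\<in>I \<times> I. p z) = 1" if "p \<in> X" for p z
  proof -
    have "p z \<in> (if z \<in> I \<times> I then {0..1} else {0})" using that unfolding X_def by (simp only: Int_iff PiE_iff) blast
    then show "0 \<le> p z" "z \<notin> I \<times> I \<Longrightarrow> p z = 0" by (auto split: if_splits)
  qed (use that in \<open>simp add: X_def\<close>)
  have "(\<lambda>z. if z \<in> I \<times> I then m (fst z) * n (snd z) else 0) \<in> X"
  proof (rule inX)
    have "(\<Sum>z\<in>I \<times> I. if z \<in> I \<times> I then m (fst z) * n (snd z) else 0) = (\<Sum>z\<in>I \<times> I. m (fst z) * n (snd z))"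
      by (rule sum.cong) auto
    also have "\<dots> = (\<Sum>k\<in>I. m k) * (\<Sum>k\<in>I. n k)"
      by (simp add: sum_product sum.cartesian_product case_prod_beta)
    finally show "(\<Sum>z\<in>I \<times> I. if z \<in> I \<times> I then m (fst z) * n (snd z) else 0) = 1"
      using m n by simp
  qed (use m n in auto)
  then have "X \<noteq> {}" by auto
  have "continuous_on X \<Phi>"
    unfolding \<Phi>_def row_def col_def cost_def
    by (rule continuous_on_subset[of UNIV]) (auto intro!: continuous_intros cont)
  from continuous_attains_inf[OF \<open>compact X\<close> \<open>X \<noteq> {}\<close> this] obtain p where
    p: "p \<in> X" and pmin: "\<And>q. q \<in> X \<Longrightarrow> \<Phi> p \<le> \<Phi> q" by auto
  define u where "u = (\<lambda>k. m k - row p k)"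
  define v where "v = (\<lambda>k. n k - col p k)"
  define w where "w = max 0 (cost p - A)"
  \<comment> \<open>\<open>S\<close> is the average of \<open>w * c k l - u k - v l\<close> under
    \<open>p\<close>. It is half the derivative of \<open>\<Phi>\<close> paired with
    \<open>p\<close> itself, which is subtracted when moving from \<open>p\<close> towards the unit
    mass at one pair.\<close>
  define S where "S = w * cost p - (\<Sum>k\<in>I. u k * row p k) - (\<Sum>k\<in>I. v k * col p k)"
  have first_order: "u k + v l + S \<le> w * c k l" if kl: "k \<in> I" "l \<in> I" for k l
  proof -
    define q where "q = (\<lambda>z. if z = (k, l) then 1 else 0 :: real)"
    have rowq: "row q i = (if i = k then 1 else 0)" if "i \<in> I" for i
      using kl fin that by (auto simp: row_def q_def)
    have colq: "col q i = (if i = l then 1 else 0)" if "i \<in> I" for i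
      using kl fin that by (auto simp: col_def q_def)
    have costq: "cost q = c k l"
    proof -
      have "cost q = (\<Sum>z\<in>I \<times> I. if z = (k, l) then c k l else 0)"
        unfolding cost_def q_def by (intro sum.cong) auto
      then show ?thesis using kl fin by simp
    qed
    define D where "D = - (\<Sum>i\<in>I. u i * (row q i - row p i)) - (\<Sum>i\<in>I. v i * (col q i - col p i))
      + w * (cost q - cost p)"
    define Q where "Q = (\<Sum>i\<in>I. (row q i - row p i)\<^sup>2) + (\<Sum>i\<in>I. (col q i - col p i)\<^sup>2)
      + (cost q - cost p)\<^sup>2"
    have "0 \<le> D"
    proof (rule nonneg_linear_term[where Q = Q])
      fix t :: real assume t: "0 < t" "t \<le> 1"
      define r where "r = (\<lambda>z. (1 - t) * p z + t * q z)"
      have "r \<in> X"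
      proof (rule inX)
        show "0 \<le> r z" for z using t Xnn[OF p] by (auto simp: r_def q_def)
        show "r z = 0" if "z \<notin> I \<times> I" for z
          using that Xnn[OF p] kl by (auto simp: r_def q_def)
        have "(\<Sum>z\<in>I \<times> I. q z) = 1" using kl fin by (simp add: q_def)
        then show "(\<Sum>z\<in>I \<times> I. r z) = 1"
          using Xnn[OF p] by (simp add: r_def sum.distrib flip: sum_distrib_left)
      qed
      have rr: "row r i = row p i + t * (row q i - row p i)" for i
        by (simp add: row_def r_def sum.distrib algebra_simps sum_subtractf sum_distrib_left)
      have cr: "col r i = col p i + t * (col q i - col p i)" for i
        by (simp add: col_def r_def sum.distrib algebra_simps sum_subtractf sum_distrib_left)
      have co: "cost r = cost p + t * (cost q - cost p)"
        by (simp add: cost_def r_def sum.distrib algebra_simps sum_subtractf sum_distrib_left)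
      \<comment> \<open>The positive part is replaced by an affine function that dominates it in
        absolute value and agrees with it at \<open>t = 0\<close>; the upper bound for
        \<open>\<Phi> r\<close> is then an exact quadratic in \<open>t\<close>.\<close>
      have "\<bar>max 0 (cost r - A)\<bar> \<le> \<bar>w + t * (cost q - cost p)\<bar>"
        unfolding co w_def by (auto simp: max_def abs_if)
      then have *: "(max 0 (cost r - A))\<^sup>2 \<le> (w + t * (cost q - cost p))\<^sup>2"
        by (simp only: abs_le_square_iff)
      have "(\<Sum>k\<in>I. u k ^ 2) + (\<Sum>k\<in>I. v k ^ 2) + w\<^sup>2 \<le> \<Phi> r"
        using pmin[OF \<open>r \<in> X\<close>] by (simp add: \<Phi>_def u_def v_def w_def)
      also have "\<dots> \<le> (\<Sum>k\<in>I. (u k - t * (row q k - row p k))\<^sup>2) + (\<Sum>k\<in>I. (v k - t * (col q k - col p k))\<^sup>2)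
          + (w + t * (cost q - cost p))\<^sup>2"
        unfolding \<Phi>_def rr cr u_def v_def using * by (simp add: algebra_simps)
      also have "\<dots> = (\<Sum>k\<in>I. u k ^ 2) + (\<Sum>k\<in>I. v k ^ 2) + w\<^sup>2 + (2 * t * D + t\<^sup>2 * Q)"
        unfolding D_def Q_def
        by (simp add: power2_eq_square sum.distrib sum_subtractf sum_distrib_left algebra_simps)
      finally show "0 \<le> 2 * t * D + t\<^sup>2 * Q" by simp
    qed
    moreover have "(\<Sum>i\<in>I. u i * row q i) = u k"
      using kl fin by (simp add: rowq if_distrib cong: sum.cong if_cong)
    moreover have "(\<Sum>i\<in>I. v i * col q i) = v l"
      using kl fin by (simp add: colq if_distrib cong: sum.cong if_cong)
    ultimately show ?thesis
      by (simp add: D_def S_def costq algebra_simps sum_subtractf)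
  qed
  \<comment> \<open>Pairing the potentials with the prescribed marginals instead of those of
    \<open>p\<close> produces squares, because \<open>u\<close> and \<open>v\<close> are the
    marginal defects themselves.\<close>
  have cert: "(\<Sum>k\<in>I. u k * m k) + (\<Sum>k\<in>I. v k * n k) + S =
      (\<Sum>k\<in>I. u k ^ 2) + (\<Sum>k\<in>I. v k ^ 2) + w * cost p"
    by (simp add: S_def u_def v_def power2_eq_square algebra_simps sum_subtractf sum.distrib sum_distrib_left)
  have "I \<noteq> {}" using m by auto
  have "w = 0"
  proof (rule ccontr)
    assume "w \<noteq> 0"
    then have w: "0 < w" "w = cost p - A" by (auto simp: w_def)
    \<comment> \<open>For \<open>w > 0\<close> the first-order condition, divided by
      \<open>w\<close>, says that \<open>(f, h)\<close> is feasible for the two-function dual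
      problem.\<close>
    define f where "f = (\<lambda>k. (u k + S) / w)"
    define h where "h = (\<lambda>k. v k / w)"
    \<comment> \<open>The c-transform of \<open>h\<close> merges the two potentials into one:
      \<open>f \<le> g\<close> by feasibility, \<open>h \<le> - g\<close> because the cost vanishes
      on the diagonal, and the triangle inequality makes \<open>g\<close> admissible in
      \<open>dual\<close>.\<close>
    define g where "g = (\<lambda>k. Min ((\<lambda>l. c k l - h l) ` I))"
    have fh: "f k + h l \<le> c k l" if "k \<in> I" "l \<in> I" for k l
      using first_order[OF that] w(1) by (simp add: f_def h_def field_simps)
    have gle: "g k \<le> c k l - h l" if "l \<in> I" for k l
      unfolding g_def using fin that by (intro Min_le) auto
    have "f k \<le> g k" if "k \<in> I" for k
      unfolding g_def using fin \<open>I \<noteq> {}\<close> fh[OF that] by (subst Min_ge_iff) (auto simp: algebra_simps)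
    moreover have "h k \<le> - g k" if "k \<in> I" for k
      using gle[OF that, of k] c0[OF that] by simp
    ultimately have "(\<Sum>k\<in>I. f k * m k) + (\<Sum>k\<in>I. h k * n k) \<le> (\<Sum>k\<in>I. g k * m k) + (\<Sum>k\<in>I. (- g k) * n k)"
      using m n by (intro add_mono sum_mono mult_right_mono) auto
    also have "\<dots> = (\<Sum>k\<in>I. g k * (m k - n k))"
      by (simp add: algebra_simps sum_subtractf sum_negf)
    also have "\<dots> \<le> A"
    proof (rule dual)
      fix k l assume kl: "k \<in> I" "l \<in> I"
      have "g l \<in> (\<lambda>j. c l j - h j) ` I"
        unfolding g_def using fin \<open>I \<noteq> {}\<close> by (intro Min_in) auto
      then obtain j where "j \<in> I" "g l = c l j - h j" by auto
      with gle[of j k] ctri[of k l j] kl show "g k - g l \<le> c k l" by auto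
    qed
    finally have "w * ((\<Sum>k\<in>I. f k * m k) + (\<Sum>k\<in>I. h k * n k)) \<le> w * A"
      using w by simp
    moreover have "w * (\<Sum>k\<in>I. f k * m k) = (\<Sum>k\<in>I. u k * m k) + S"
    proof -
      have "w * (\<Sum>k\<in>I. f k * m k) = (\<Sum>k\<in>I. u k * m k + S * m k)"
        unfolding f_def sum_distrib_left using w(1) by (intro sum.cong) (auto simp: distrib_right)
      then show ?thesis using m by (simp add: sum.distrib flip: sum_distrib_left)
    qed
    moreover have "w * (\<Sum>k\<in>I. h k * n k) = (\<Sum>k\<in>I. v k * n k)"
      using w(1) by (simp add: h_def sum_distrib_left)
    ultimately have "(\<Sum>k\<in>I. u k ^ 2) + (\<Sum>k\<in>I. v k ^ 2) + w * cost p \<le> w * A"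
      using cert by (simp add: algebra_simps)
    moreover have "0 \<le> (\<Sum>k\<in>I. u k ^ 2) + (\<Sum>k\<in>I. v k ^ 2)"
      by (intro add_nonneg_nonneg sum_nonneg) auto
    ultimately have "w * (cost p - A) \<le> 0" by (simp add: algebra_simps)
    then show False using w by (simp add: mult_le_0_iff)
  qed
  \<comment> \<open>With \<open>w = 0\<close> the first-order condition reads
    \<open>u k + v l + S \<le> 0\<close>. Its average under the product of \<open>m\<close> and
    \<open>n\<close> is the left side of \<open>cert\<close>, which forces all marginal defects to
    vanish.\<close>
  have "(\<Sum>k\<in>I. u k * m k) + (\<Sum>k\<in>I. v k * n k) + S \<le> 0"
  proof -
    have "(\<Sum>k\<in>I. \<Sum>l\<in>I. (m k * n l) * (u k + v l + S)) \<le> 0"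
      using first_order \<open>w = 0\<close> m n by (intro sum_nonpos mult_nonneg_nonpos) auto
    also have "(\<Sum>k\<in>I. \<Sum>l\<in>I. (m k * n l) * (u k + v l + S)) =
        (\<Sum>k\<in>I. m k * (u k + S) * (\<Sum>l\<in>I. n l) + m k * (\<Sum>l\<in>I. n l * v l))"
      by (intro sum.cong refl) (simp add: sum_distrib_left algebra_simps flip: sum.distrib)
    also have "\<dots> = (\<Sum>k\<in>I. u k * m k) + S * (\<Sum>k\<in>I. m k) + (\<Sum>k\<in>I. m k) * (\<Sum>l\<in>I. n l * v l)"
      using m n by (simp add: sum.distrib distrib_left mult.commute[of "u _"] flip: sum_distrib_right)
    finally show ?thesis using m n by (simp add: mult.commute)
  qed
  with cert \<open>w = 0\<close> have "(\<Sum>k\<in>I. u k ^ 2) + (\<Sum>k\<in>I. v k ^ 2) \<le> 0" by simp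
  moreover have "0 \<le> (\<Sum>k\<in>I. u k ^ 2)" "0 \<le> (\<Sum>k\<in>I. v k ^ 2)" by (auto intro: sum_nonneg)
  ultimately have "(\<Sum>k\<in>I. u k ^ 2) = 0" "(\<Sum>k\<in>I. v k ^ 2) = 0" by linarith+
  then have uv: "u k = 0" "v k = 0" if "k \<in> I" for k
    using fin that by (simp_all add: sum_nonneg_eq_0_iff)
  show ?thesis
  proof (rule that[of p])
    show "0 \<le> p z" "z \<notin> I \<times> I \<Longrightarrow> p z = 0" for z using Xnn[OF p] by auto
    show "(\<Sum>l\<in>I. p (k, l)) = m k" if "k \<in> I" for k using uv[OF that] by (simp add: u_def row_def)
    show "(\<Sum>k\<in>I. p (k, l)) = n l" if "l \<in> I" for l using uv[OF that] by (simp add: v_def col_def)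
    show "(\<Sum>z\<in>I \<times> I. p z * c (fst z) (snd z)) \<le> A"
      using \<open>w = 0\<close> by (simp add: w_def cost_def)
  qed
qed

section \<open>Transport between countable distributions by truncation and compactness\<close>

definition tail_mass :: "(nat \<Rightarrow> real) \<Rightarrow> nat \<Rightarrow> real" where
  "tail_mass m K = 1 - (\<Sum>k<K. m k)"

text \<open>On the indices up to \<open>K\<close> this is the law of \<open>min k K\<close> when
  \<open>k\<close> has weights \<open>m\<close>: the last cell absorbs the whole tail, so the total
  mass stays 1.\<close>

definition collapse_tail :: "(nat \<Rightarrow> real) \<Rightarrow> nat \<Rightarrow> nat \<Rightarrow> real" where
  "collapse_tail m K k = (if k < K then m k else tail_mass m K)"

lemma sum_collapse_tail: "(\<Sum>k\<le>K. collapse_tail m K k) = 1"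
  by (simp add: collapse_tail_def tail_mass_def flip: lessThan_Suc_atMost)

lemma tail_mass_nonneg:
  assumes "\<And>k. 0 \<le> m k" "m sums 1"
  shows "0 \<le> tail_mass m K"
  using sum_le_suminf[of m "{..<K}"] assms by (auto simp: tail_mass_def sums_iff)

lemma tail_mass_tendsto_0:
  assumes "m sums 1"
  shows "tail_mass m \<longlonglongrightarrow> 0"
  using tendsto_diff[OF tendsto_const assms[unfolded sums_def], of 1]
  by (simp add: tail_mass_def[abs_def])

lemma collapse_tail_nonneg:
  assumes "\<And>k. 0 \<le> m k" "m sums 1"
  shows "0 \<le> collapse_tail m K k"
  using assms tail_mass_nonneg[OF assms] by (simp add: collapse_tail_def)

text \<open>Uniform tightness: the mass from \<open>J\<close> onwards does not depend on where the
  tail was collapsed.\<close>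

lemma sum_collapse_tail_atLeast:
  assumes "J \<le> K"
  shows "(\<Sum>k\<in>{J..K}. collapse_tail m K k) = tail_mass m J"
proof -
  have "{..K} = {..<J} \<union> {J..K}" using assms by auto
  then have "(\<Sum>k\<le>K. collapse_tail m K k) = (\<Sum>k<J. collapse_tail m K k) + (\<Sum>k\<in>{J..K}. collapse_tail m K k)"
    by (simp add: sum.union_disjoint ivl_disj_int)
  moreover have "(\<Sum>k<J. collapse_tail m K k) = (\<Sum>k<J. m k)"
    using assms by (intro sum.cong) (auto simp: collapse_tail_def)
  ultimately show ?thesis by (simp add: sum_collapse_tail tail_mass_def)
qed

text \<open>A termwise limit of nonnegative sequences may lose mass at infinity. The bound
  \<open>\<tau> J\<close>, uniform in \<open>L\<close>, prevents this: every partial sum of the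
  limit lies between \<open>a - \<tau> J\<close> and \<open>a\<close>.\<close>

lemma sums_limit_of_truncations:
  fixes P :: "nat \<Rightarrow> nat \<Rightarrow> real"
  assumes nonneg: "\<And>L l. 0 \<le> P L l"
    and lim: "\<And>l. (\<lambda>L. P L l) \<longlonglongrightarrow> q l"
    and total: "eventually (\<lambda>L. (\<Sum>l\<le>K L. P L l) = a) sequentially"
    and K: "filterlim K at_top sequentially"
    and tails: "\<And>J L. J \<le> K L \<Longrightarrow> (\<Sum>l\<in>{J..K L}. P L l) \<le> \<tau> J"
    and \<tau>: "\<tau> \<longlonglongrightarrow> 0"
  shows "q sums a"
proof -
  have "a - \<tau> J \<le> (\<Sum>l<J. q l) \<and> (\<Sum>l<J. q l) \<le> a" for J
  proof -
    have lim': "(\<lambda>L. \<Sum>l<J. P L l) \<longlonglongrightarrow> (\<Sum>l<J. q l)"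
      by (intro tendsto_sum lim)
    have ev: "eventually (\<lambda>L. a - \<tau> J \<le> (\<Sum>l<J. P L l) \<and> (\<Sum>l<J. P L l) \<le> a) sequentially"
      using total filterlim_at_top[THEN iffD1, OF K, rule_format, of J]
    proof eventually_elim
      case (elim L)
      have "{..K L} = {..<J} \<union> {J..K L}" using elim by auto
      then have "(\<Sum>l\<le>K L. P L l) = (\<Sum>l<J. P L l) + (\<Sum>l\<in>{J..K L}. P L l)"
        by (simp add: sum.union_disjoint ivl_disj_int)
      moreover have "0 \<le> (\<Sum>l\<in>{J..K L}. P L l)" by (intro sum_nonneg nonneg)
      ultimately show ?case using elim tails[of J L] by linarith
    qed
    show ?thesis
      using tendsto_lowerbound[OF lim'] tendsto_upperbound[OF lim'] ev
      by (auto simp: eventually_conj_iff)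
  qed
  then have "\<forall>\<^sub>F J in sequentially. a - \<tau> J \<le> (\<Sum>l<J. q l)" "\<forall>\<^sub>F J in sequentially. (\<Sum>l<J. q l) \<le> a"
    by auto
  then show ?thesis unfolding sums_def
    using tendsto_sandwich[of "\<lambda>J. a - \<tau> J" "\<lambda>J. \<Sum>l<J. q l" sequentially "\<lambda>_. a" a]
      tendsto_diff[OF tendsto_const \<tau>, of a] by simp
qed

text \<open>Each finite problem lumps a tail into one cell and caps the cost at \<open>L\<close>,
  which costs at most \<open>L\<close> times the lumped mass on the dual side. Letting the cap grow
  more slowly than the tails shrink removes both changes in the limit. The cost is bounded on finite
  squares only, since there it passes to a termwise limit.\<close>

lemma countable_kantorovich:
  fixes c :: "nat \<Rightarrow> nat \<Rightarrow> real" and m n :: "nat \<Rightarrow> real"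
  assumes m: "\<And>k. 0 \<le> m k" "m sums 1" and n: "\<And>k. 0 \<le> n k" "n sums 1"
    and cnn: "\<And>k l. 0 \<le> c k l" and c0: "\<And>k. c k k = 0"
    and ctri: "\<And>j k l. c j l \<le> c j k + c k l"
    and dual: "\<And>K L g. 0 < L \<Longrightarrow> (\<And>k l. k \<le> K \<Longrightarrow> l \<le> K \<Longrightarrow> g k - g l \<le> min (c k l) L) \<Longrightarrow>
      (\<Sum>k\<le>K. g k * (collapse_tail m K k - collapse_tail n K k)) \<le> A + L * (tail_mass m K + tail_mass n K)"
  obtains p :: "nat \<times> nat \<Rightarrow> real" where
    "\<And>z. 0 \<le> p z"
    "\<And>k. (\<lambda>l. p (k, l)) sums m k"
    "\<And>l. (\<lambda>k. p (k, l)) sums n l"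
    "\<And>J. (\<Sum>z\<in>{..<J} \<times> {..<J}. p z * c (fst z) (snd z)) \<le> A"
proof -
  \<comment> \<open>The truncation index is chosen after the cap, large enough that even the cap
    multiplied by the tail masses is negligible.\<close>
  have "\<exists>K\<ge>L. (1 + real L) * (tail_mass m K + tail_mass n K) \<le> 1 / (1 + real L)" for L
  proof -
    have "(\<lambda>K. (1 + real L) * (tail_mass m K + tail_mass n K)) \<longlonglongrightarrow> (1 + real L) * (0 + 0)"
      by (intro tendsto_intros tail_mass_tendsto_0 m n)
    then have "eventually (\<lambda>K. (1 + real L) * (tail_mass m K + tail_mass n K) < 1 / (1 + real L)) sequentially"
      by (rule order_tendstoD(2)) simp
    with eventually_ge_at_top[of L]
    have "eventually (\<lambda>K. L \<le> K \<and> (1 + real L) * (tail_mass m K + tail_mass n K) < 1 / (1 + real L)) sequentially"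
      by eventually_elim auto
    then show ?thesis by (auto simp: eventually_sequentially less_imp_le)
  qed
  then obtain K where K: "\<And>L. L \<le> K L"
    "\<And>L. (1 + real L) * (tail_mass m (K L) + tail_mass n (K L)) \<le> 1 / (1 + real L)" by metis
  have Ktop: "filterlim K at_top sequentially"
    by (rule filterlim_at_top_mono[OF filterlim_ident]) (auto simp: K)
  define cL where "cL = (\<lambda>L k l. min (c k l) (1 + real L))"
  have "\<exists>p. (\<forall>z. 0 \<le> p z) \<and> (\<forall>z. z \<notin> {..K L} \<times> {..K L} \<longrightarrow> p z = 0) \<and>
    (\<forall>k\<in>{..K L}. (\<Sum>l\<le>K L. p (k, l)) = collapse_tail m (K L) k) \<and>
    (\<forall>l\<in>{..K L}. (\<Sum>k\<le>K L. p (k, l)) = collapse_tail n (K L) l) \<and>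
    (\<Sum>z\<in>{..K L} \<times> {..K L}. p z * cL L (fst z) (snd z)) \<le> A + 1 / (1 + real L)" for L
  proof (rule finite_kantorovich[of "{..K L}" "collapse_tail m (K L)" "collapse_tail n (K L)" "cL L" "A + 1 / (1 + real L)"])
    show "cL L j l \<le> cL L j k + cL L k l" for j k l
      using ctri[of j l k] cnn[of j k] cnn[of k l] by (auto simp: cL_def)
    show "(\<Sum>k\<le>K L. g k * (collapse_tail m (K L) k - collapse_tail n (K L) k)) \<le> A + 1 / (1 + real L)"
      if "\<And>k l. k \<in> {..K L} \<Longrightarrow> l \<in> {..K L} \<Longrightarrow> g k - g l \<le> cL L k l" for g
      using dual[of "1 + real L" "K L" g] that K(2)[of L] by (auto simp: cL_def)
  next
    fix p :: "nat \<times> nat \<Rightarrow> real"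
    assume "\<And>z. 0 \<le> p z" "\<And>z. z \<notin> {..K L} \<times> {..K L} \<Longrightarrow> p z = 0"
      "\<And>k. k \<in> {..K L} \<Longrightarrow> (\<Sum>l\<le>K L. p (k, l)) = collapse_tail m (K L) k"
      "\<And>l. l \<in> {..K L} \<Longrightarrow> (\<Sum>k\<le>K L. p (k, l)) = collapse_tail n (K L) l"
      "(\<Sum>z\<in>{..K L} \<times> {..K L}. p z * cL L (fst z) (snd z)) \<le> A + 1 / (1 + real L)"
    then show ?thesis by blast
  qed (auto simp: sum_collapse_tail collapse_tail_nonneg m n c0 cL_def)
  then have "\<exists>P. \<forall>L. (\<forall>z. 0 \<le> P L z) \<and> (\<forall>z. z \<notin> {..K L} \<times> {..K L} \<longrightarrow> P L z = 0) \<and>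
    (\<forall>k\<in>{..K L}. (\<Sum>l\<le>K L. P L (k, l)) = collapse_tail m (K L) k) \<and>
    (\<forall>l\<in>{..K L}. (\<Sum>k\<le>K L. P L (k, l)) = collapse_tail n (K L) l) \<and>
    (\<Sum>z\<in>{..K L} \<times> {..K L}. P L z * cL L (fst z) (snd z)) \<le> A + 1 / (1 + real L)"
    by (intro choice) blast
  then obtain P where P: "\<And>L z. 0 \<le> P L z" "\<And>L z. z \<notin> {..K L} \<times> {..K L} \<Longrightarrow> P L z = 0"
    "\<And>L k. k \<le> K L \<Longrightarrow> (\<Sum>l\<le>K L. P L (k, l)) = collapse_tail m (K L) k"
    "\<And>L l. l \<le> K L \<Longrightarrow> (\<Sum>k\<le>K L. P L (k, l)) = collapse_tail n (K L) l"
    "\<And>L. (\<Sum>z\<in>{..K L} \<times> {..K L}. P L z * cL L (fst z) (snd z)) \<le> A + 1 / (1 + real L)"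
    by (elim exE) (simp only: atMost_iff Ball_def; blast)
  have ct1: "collapse_tail m N k \<le> 1" if "k \<le> N" for N k
    using member_le_sum[of k "{..N}" "collapse_tail m N"] that sum_collapse_tail[of m N]
      collapse_tail_nonneg[OF m] by auto
  have P1: "P L z \<le> 1" for L z
  proof (cases "z \<in> {..K L} \<times> {..K L}")
    case True
    then obtain k l where z: "z = (k, l)" "k \<le> K L" "l \<le> K L" by auto
    have "P L (k, l) \<le> (\<Sum>l\<le>K L. P L (k, l))"
      using z by (intro member_le_sum) (auto simp: P)
    then show ?thesis using P(3)[of k L] ct1[of k "K L"] z by auto
  qed (simp add: P)
  \<comment> \<open>There are only countably many entries, so compactness of the cube yields a
    subsequence converging in every entry.\<close>
  have "compact (PiE UNIV (\<lambda>z :: nat \<times> nat. {0..1 :: real}))"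
    by (intro compact_PiE_UNIV) auto
  then have "seq_compact (PiE UNIV (\<lambda>z :: nat \<times> nat. {0..1 :: real}))"
    by (rule compact_imp_seq_compact)
  moreover have "\<forall>L. P L \<in> PiE UNIV (\<lambda>z. {0..1})" using P P1 by auto
  ultimately obtain p r where p: "p \<in> PiE UNIV (\<lambda>z. {0..1})" and r: "strict_mono (r :: nat \<Rightarrow> nat)"
    and lim: "(P \<circ> r) \<longlonglongrightarrow> p"
    unfolding seq_compact_def by metis
  have limz: "(\<lambda>L. P (r L) z) \<longlonglongrightarrow> p z" for z
    using continuous_on_tendsto_compose[where s = UNIV and f = "\<lambda>p. p z", OF _ lim]
    by (simp add: o_def)
  have Kr: "filterlim (\<lambda>L. K (r L)) at_top sequentially"
    using filterlim_compose[OF Ktop filterlim_subseq[OF r]] .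
  show ?thesis
  proof (rule that[of p])
    show "0 \<le> p z" for z using PiE_mem[OF p, of z] by simp
    show "(\<lambda>l. p (k, l)) sums m k" for k
    proof (rule sums_limit_of_truncations[OF _ limz _ Kr])
      show "eventually (\<lambda>L. (\<Sum>l\<le>K (r L). P (r L) (k, l)) = m k) sequentially"
        using filterlim_at_top[THEN iffD1, OF Kr, rule_format, of "Suc k"]
        by eventually_elim (auto simp: P collapse_tail_def)
      \<comment> \<open>The tail of a single row is part of the total mass of the columns from
        \<open>J\<close> on, so the other marginal supplies the uniform tail bound.\<close>
      show "(\<Sum>l\<in>{J..K (r L)}. P (r L) (k, l)) \<le> tail_mass n J" if "J \<le> K (r L)" for J L
      proof (cases "k \<le> K (r L)")
        case True
        have "(\<Sum>l\<in>{J..K (r L)}. P (r L) (k, l)) \<le> (\<Sum>l\<in>{J..K (r L)}. \<Sum>k\<le>K (r L). P (r L) (k, l))"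
          by (intro sum_mono member_le_sum) (auto simp: P True)
        also have "\<dots> = (\<Sum>l\<in>{J..K (r L)}. collapse_tail n (K (r L)) l)"
          by (intro sum.cong) (auto simp: P)
        finally show ?thesis using sum_collapse_tail_atLeast[OF that, of n] by simp
      next
        case False
        then show ?thesis using tail_mass_nonneg[OF n] by (simp add: P)
      qed
    qed (auto simp: P tail_mass_tendsto_0 n)
    show "(\<lambda>k. p (k, l)) sums n l" for l
    proof (rule sums_limit_of_truncations[OF _ limz _ Kr])
      show "eventually (\<lambda>L. (\<Sum>k\<le>K (r L). P (r L) (k, l)) = n l) sequentially"
        using filterlim_at_top[THEN iffD1, OF Kr, rule_format, of "Suc l"]
        by eventually_elim (auto simp: P collapse_tail_def)
      show "(\<Sum>k\<in>{J..K (r L)}. P (r L) (k, l)) \<le> tail_mass m J" if "J \<le> K (r L)" for J L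
      proof (cases "l \<le> K (r L)")
        case True
        have "(\<Sum>k\<in>{J..K (r L)}. P (r L) (k, l)) \<le> (\<Sum>k\<in>{J..K (r L)}. \<Sum>l\<le>K (r L). P (r L) (k, l))"
          by (intro sum_mono member_le_sum) (auto simp: P True)
        also have "\<dots> = (\<Sum>k\<in>{J..K (r L)}. collapse_tail m (K (r L)) k)"
          by (intro sum.cong) (auto simp: P)
        finally show ?thesis using sum_collapse_tail_atLeast[OF that, of m] by simp
      next
        case False
        then show ?thesis using tail_mass_nonneg[OF m] by (simp add: P)
      qed
    qed (auto simp: P tail_mass_tendsto_0 m)
    show "(\<Sum>z\<in>{..<J} \<times> {..<J}. p z * c (fst z) (snd z)) \<le> A" for J
    proof (rule tendsto_le[OF sequentially_bot])
      show "(\<lambda>L. \<Sum>z\<in>{..<J} \<times> {..<J}. P (r L) z * c (fst z) (snd z)) \<longlonglongrightarrow>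
          (\<Sum>z\<in>{..<J} \<times> {..<J}. p z * c (fst z) (snd z))"
        by (intro tendsto_intros limz)
      have "(\<lambda>L. 1 / (1 + real L)) \<longlonglongrightarrow> 0"
        using LIMSEQ_inverse_real_of_nat by (simp add: inverse_eq_divide)
      then have "(\<lambda>L. 1 / (1 + real (r L))) \<longlonglongrightarrow> 0"
        using LIMSEQ_subseq_LIMSEQ[OF _ r] by (auto simp: o_def)
      then show "(\<lambda>L. A + 1 / (1 + real (r L))) \<longlonglongrightarrow> A"
        using tendsto_add[OF tendsto_const, of _ 0 sequentially A] by simp
      \<comment> \<open>\<open>B\<close> dominates the cost on the square under consideration. Once
        the cap exceeds it, capped and original cost agree there.\<close>
      define B where "B = (\<Sum>z\<in>{..<J} \<times> {..<J}. c (fst z) (snd z))"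
      have B: "c k l \<le> B" if "k < J" "l < J" for k l
        using member_le_sum[of "(k, l)" "{..<J} \<times> {..<J}" "\<lambda>z. c (fst z) (snd z)"] that cnn
        by (auto simp: B_def)
      have "eventually (\<lambda>L. B \<le> real (r L)) sequentially"
        using filterlim_compose[OF filterlim_real_sequentially filterlim_subseq[OF r]]
        by (simp add: filterlim_at_top)
      with filterlim_at_top[THEN iffD1, OF Kr, rule_format, of J]
      show "\<forall>\<^sub>F L in sequentially. (\<Sum>z\<in>{..<J} \<times> {..<J}. P (r L) z * c (fst z) (snd z)) \<le> A + 1 / (1 + real (r L))"
      proof eventually_elim
        case (elim L)
        have "(\<Sum>z\<in>{..<J} \<times> {..<J}. P (r L) z * c (fst z) (snd z)) =
            (\<Sum>z\<in>{..<J} \<times> {..<J}. P (r L) z * cL (r L) (fst z) (snd z))"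
        proof (intro sum.cong refl arg_cong2[where f = "(*)"])
          fix z assume "z \<in> {..<J} \<times> {..<J}"
          then have "c (fst z) (snd z) \<le> B" by (intro B) auto
          then show "c (fst z) (snd z) = cL (r L) (fst z) (snd z)"
            using elim by (auto simp: cL_def)
        qed
        also have "\<dots> \<le> (\<Sum>z\<in>{..K (r L)} \<times> {..K (r L)}. P (r L) z * cL (r L) (fst z) (snd z))"
          using elim cnn by (intro sum_mono2) (auto simp: P cL_def)
        finally show ?case using P(5)[of "r L"] by linarith
      qed
    qed
  qed
qed

section \<open>From countable transport matrices to couplings on a separable space\<close>

lemma suminf2_le_const:
  fixes f :: "nat \<Rightarrow> nat \<Rightarrow> ennreal"
  assumes "\<And>J. (\<Sum>z\<in>{..<J} \<times> {..<J}. f (fst z) (snd z)) \<le> B"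
  shows "(\<Sum>k. \<Sum>l. f k l) \<le> B"
proof (rule suminf_le_const)
  fix J
  have "(\<Sum>k<J. \<Sum>l. f k l) = (\<Sum>l. \<Sum>k<J. f k l)"
    by (rule suminf_sum[symmetric]) auto
  also have "\<dots> \<le> B"
  proof (rule suminf_le_const)
    fix J'
    have "(\<Sum>l<J'. \<Sum>k<J. f k l) = (\<Sum>z\<in>{..<J} \<times> {..<J'}. f (fst z) (snd z))"
      by (subst sum.swap) (simp add: sum.cartesian_product case_prod_beta)
    also have "\<dots> \<le> (\<Sum>z\<in>{..<max J J'} \<times> {..<max J J'}. f (fst z) (snd z))"
      by (intro sum_mono2) auto
    finally show "(\<Sum>l<J'. \<Sum>k<J. f k l) \<le> B" using assms order_trans by blast
  qed auto
  finally show "(\<Sum>k<J. \<Sum>l. f k l) \<le> B" .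
qed auto

lemma nn_integral_comp_nat:
  assumes [measurable]: "\<kappa> \<in> M \<rightarrow>\<^sub>M count_space (UNIV :: nat set)"
  shows "(\<integral>\<^sup>+ x. F (\<kappa> x) \<partial>M) = (\<Sum>k. F k * emeasure M {x \<in> space M. \<kappa> x = k})"
proof -
  have "(\<integral>\<^sup>+ x. F (\<kappa> x) \<partial>M) = (\<integral>\<^sup>+ x. (\<Sum>k. F k * indicator {x \<in> space M. \<kappa> x = k} x) \<partial>M)"
  proof (rule nn_integral_cong)
    fix x assume "x \<in> space M"
    then have "(\<Sum>k. F k * indicator {x \<in> space M. \<kappa> x = k} x) = (\<Sum>k. if k = \<kappa> x then F k else 0)"
      by (intro suminf_cong) auto
    also have "\<dots> = F (\<kappa> x)"
      using suminf_finite[of "{\<kappa> x}" "\<lambda>k. if k = \<kappa> x then F k else 0"] by auto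
    finally show "F (\<kappa> x) = (\<Sum>k. F k * indicator {x \<in> space M. \<kappa> x = k} x)" by simp
  qed
  also have "\<dots> = (\<Sum>k. F k * emeasure M {x \<in> space M. \<kappa> x = k})"
    by (subst nn_integral_suminf) (auto simp: nn_integral_cmult_indicator)
  finally show ?thesis .
qed

lemma (in prob_space) prob_fibres_sums:
  assumes [measurable]: "\<kappa> \<in> M \<rightarrow>\<^sub>M count_space (UNIV :: nat set)"
  shows "(\<lambda>k. prob {x \<in> space M. \<kappa> x = k}) sums 1"
proof -
  have "(\<Union>k. {x \<in> space M. \<kappa> x = k}) = space M" by auto
  moreover have "range (\<lambda>k. {x \<in> space M. \<kappa> x = k}) \<subseteq> events" by auto
  ultimately show ?thesis
    using finite_measure_UNION[of "\<lambda>k. {x \<in> space M. \<kappa> x = k}"]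
    by (auto simp: disjoint_family_on_def prob_space)
qed

text \<open>The density \<open>p l / (a * n l)\<close> integrates to 1 across a fibre of mass
  \<open>a\<close>. The bound \<open>p l \<le> n l\<close> covers empty cells: where
  \<open>n l = 0\<close> also \<open>p l = 0\<close>, so division by zero loses no mass.\<close>

lemma suminf_fibre_weights:
  assumes n: "\<And>l. 0 \<le> n l" and p: "\<And>l. 0 \<le> p l" "\<And>l. p l \<le> n l" "p sums a" and "0 < (a :: real)"
  shows "(\<Sum>l. ennreal (p l / (a * n l)) * ennreal (n l)) = 1"
proof -
  have "(\<Sum>l. ennreal (p l / (a * n l)) * ennreal (n l)) = (\<Sum>l. ennreal (p l / a))"
  proof (rule suminf_cong)
    show "ennreal (p l / (a * n l)) * ennreal (n l) = ennreal (p l / a)" for l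
      using assms(1)[of l] p(1,2)[of l] \<open>0 < a\<close> by (auto simp: ennreal_mult'[symmetric])
  qed
  also have "\<dots> = ennreal (a / a)"
    using p \<open>0 < a\<close> by (intro suminf_ennreal_eq sums_divide) auto
  finally show ?thesis using \<open>0 < a\<close> by simp
qed

text \<open>The matrix fixes only the masses of pairs of cells. Taking the two points independent
  once the cells are given leads to the density \<open>p (k, l) / (m k * n l)\<close> with respect
  to the product measure.\<close>

lemma coupling_of_discretisation:
  fixes p :: "nat \<times> nat \<Rightarrow> real"
  assumes M: "prob_space M" and N: "prob_space N"
    and \<kappa>[measurable]: "\<kappa> \<in> M \<rightarrow>\<^sub>M count_space UNIV" and \<kappa>'[measurable]: "\<kappa>' \<in> N \<rightarrow>\<^sub>M count_space UNIV"
    and p: "\<And>z. 0 \<le> p z"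
    and row: "\<And>k. (\<lambda>l. p (k, l)) sums measure M {x \<in> space M. \<kappa> x = k}"
    and col: "\<And>l. (\<lambda>k. p (k, l)) sums measure N {x \<in> space N. \<kappa>' x = l}"
  obtains \<pi> where "\<pi> \<in> couplings M N"
    "\<And>F. (\<integral>\<^sup>+ z. F (\<kappa> (fst z)) (\<kappa>' (snd z)) \<partial>\<pi>) = (\<Sum>k. \<Sum>l. F k l * ennreal (p (k, l)))"
proof -
  interpret M: prob_space M by fact
  interpret N: prob_space N by fact
  interpret MN: pair_prob_space M N ..
  define m where "m = (\<lambda>k. measure M {x \<in> space M. \<kappa> x = k})"
  define n where "n = (\<lambda>k. measure N {x \<in> space N. \<kappa>' x = k})"
  define w where "w = (\<lambda>k l. ennreal (p (k, l) / (m k * n l)))"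
  \<comment> \<open>The same weight with the factors in the order needed when integrating over the
    first variable.\<close>
  have w_swap: "w = (\<lambda>k l. ennreal (p (k, l) / (n l * m k)))"
    by (simp add: w_def mult.commute)
  have mn: "0 \<le> m k" "0 \<le> n k" for k by (auto simp: m_def n_def)
  have rowm: "(\<lambda>l. p (k, l)) sums m k" and coln: "(\<lambda>k. p (k, l)) sums n l" for k l
    using row col by (auto simp: m_def n_def)
  have pm: "p (k, l) \<le> m k" for k l
    using sum_le_suminf[of "\<lambda>l. p (k, l)" "{l}"] rowm[of k] p by (auto simp: sums_iff)
  have pn: "p (k, l) \<le> n l" for k l
    using sum_le_suminf[of "\<lambda>k. p (k, l)" "{k}"] coln[of l] p by (auto simp: sums_iff)
  have intM: "(\<integral>\<^sup>+ x. F (\<kappa> x) \<partial>M) = (\<Sum>k. F k * ennreal (m k))" for F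
    by (simp add: nn_integral_comp_nat m_def M.emeasure_eq_measure)
  have intN: "(\<integral>\<^sup>+ x. F (\<kappa>' x) \<partial>N) = (\<Sum>k. F k * ennreal (n k))" for F
    by (simp add: nn_integral_comp_nat n_def N.emeasure_eq_measure)
  have "(\<integral>\<^sup>+ x. (if m (\<kappa> x) = 0 then 1 else 0) \<partial>M) = (\<Sum>k. (if m k = 0 then 1 else 0) * ennreal (m k))"
    by (rule intM)
  also have "\<dots> = (\<Sum>k. 0)" by (rule suminf_cong) auto
  finally have "(\<integral>\<^sup>+ x. (if m (\<kappa> x) = 0 then 1 else 0) \<partial>M) = 0" by simp
  \<comment> \<open>On a cell of mass zero the density is 0 and does not integrate to 1; such cells
    carry no mass.\<close>
  then have AEm: "AE x in M. m (\<kappa> x) \<noteq> 0"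
    by (subst (asm) nn_integral_0_iff_AE) (auto elim: eventually_mono split: if_splits)
  have "(\<integral>\<^sup>+ x. (if n (\<kappa>' x) = 0 then 1 else 0) \<partial>N) = (\<Sum>k. (if n k = 0 then 1 else 0) * ennreal (n k))"
    by (rule intN)
  also have "\<dots> = (\<Sum>k. 0)" by (rule suminf_cong) auto
  finally have "(\<integral>\<^sup>+ x. (if n (\<kappa>' x) = 0 then 1 else 0) \<partial>N) = 0" by simp
  then have AEn: "AE x in N. n (\<kappa>' x) \<noteq> 0"
    by (subst (asm) nn_integral_0_iff_AE) (auto elim: eventually_mono split: if_splits)
  define \<pi> where "\<pi> = density (M \<Otimes>\<^sub>M N) (\<lambda>z. w (\<kappa> (fst z)) (\<kappa>' (snd z)))"
  have wm[measurable]: "(\<lambda>z. w (\<kappa> (fst z)) (\<kappa>' (snd z))) \<in> borel_measurable (M \<Otimes>\<^sub>M N)"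
    by measurable
  have int: "(\<integral>\<^sup>+ z. f z \<partial>\<pi>) = (\<integral>\<^sup>+ z. w (\<kappa> (fst z)) (\<kappa>' (snd z)) * f z \<partial>(M \<Otimes>\<^sub>M N))"
    if "f \<in> borel_measurable (M \<Otimes>\<^sub>M N)" for f
    unfolding \<pi>_def using that by (intro nn_integral_density wm)
  show ?thesis
  proof (rule that[of \<pi>])
    have "distr \<pi> M fst = M"
    proof (rule measure_eqI)
      fix A assume "A \<in> sets (distr \<pi> M fst)"
      then have A[measurable]: "A \<in> sets M" by simp
      have [measurable]: "fst \<in> \<pi> \<rightarrow>\<^sub>M M" by (simp add: \<pi>_def)
      have "emeasure (distr \<pi> M fst) A = (\<integral>\<^sup>+ x. indicator A x \<partial>distr \<pi> M fst)" by simp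
      also have "\<dots> = (\<integral>\<^sup>+ z. indicator A (fst z) \<partial>\<pi>)" by (subst nn_integral_distr) auto
      also have "\<dots> = (\<integral>\<^sup>+ x. \<integral>\<^sup>+ y. w (\<kappa> x) (\<kappa>' y) * indicator A x \<partial>N \<partial>M)"
        by (subst int, measurable, subst N.nn_integral_fst[symmetric]) auto
      also have "\<dots> = (\<integral>\<^sup>+ x. indicator A x \<partial>M)"
      proof (rule nn_integral_cong_AE, use AEm in eventually_elim)
        case (elim x)
        have "(\<integral>\<^sup>+ y. w (\<kappa> x) (\<kappa>' y) * indicator A x \<partial>N) = (\<integral>\<^sup>+ y. w (\<kappa> x) (\<kappa>' y) \<partial>N) * indicator A x"
          by (rule nn_integral_multc) measurable
        also have "(\<integral>\<^sup>+ y. w (\<kappa> x) (\<kappa>' y) \<partial>N) = 1"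
          using mn p pn rowm elim less_le[of 0 "m (\<kappa> x)"]
          by (subst intN[of "w (\<kappa> x)"], unfold w_def, intro suminf_fibre_weights) auto
        finally show ?case by simp
      qed
      finally show "emeasure (distr \<pi> M fst) A = emeasure M A" by simp
    qed simp
    moreover have "distr \<pi> N snd = N"
    proof (rule measure_eqI)
      fix A assume "A \<in> sets (distr \<pi> N snd)"
      then have A[measurable]: "A \<in> sets N" by simp
      have [measurable]: "snd \<in> \<pi> \<rightarrow>\<^sub>M N" by (simp add: \<pi>_def)
      have "emeasure (distr \<pi> N snd) A = (\<integral>\<^sup>+ x. indicator A x \<partial>distr \<pi> N snd)" by simp
      also have "\<dots> = (\<integral>\<^sup>+ z. indicator A (snd z) \<partial>\<pi>)" by (subst nn_integral_distr) auto
      also have "\<dots> = (\<integral>\<^sup>+ y. \<integral>\<^sup>+ x. w (\<kappa> x) (\<kappa>' y) * indicator A y \<partial>M \<partial>N)"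
        by (subst int, measurable, subst MN.nn_integral_snd[symmetric]) auto
      also have "\<dots> = (\<integral>\<^sup>+ x. indicator A x \<partial>N)"
      proof (rule nn_integral_cong_AE, use AEn in eventually_elim)
        case (elim y)
        have "(\<integral>\<^sup>+ x. w (\<kappa> x) (\<kappa>' y) * indicator A y \<partial>M) = (\<integral>\<^sup>+ x. w (\<kappa> x) (\<kappa>' y) \<partial>M) * indicator A y"
          by (rule nn_integral_multc) measurable
        also have "(\<integral>\<^sup>+ x. w (\<kappa> x) (\<kappa>' y) \<partial>M) = 1"
          using mn p pm coln elim less_le[of 0 "n (\<kappa>' y)"]
          by (subst intM[of "\<lambda>k. w k (\<kappa>' y)"], unfold w_swap, intro suminf_fibre_weights) auto
        finally show ?case by simp
      qed
      finally show "emeasure (distr \<pi> N snd) A = emeasure N A" by simp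
    qed simp
    ultimately show "\<pi> \<in> couplings M N" by (simp add: couplings_def \<pi>_def)
    fix F :: "nat \<Rightarrow> nat \<Rightarrow> ennreal"
    have "(\<integral>\<^sup>+ z. F (\<kappa> (fst z)) (\<kappa>' (snd z)) \<partial>\<pi>) =
        (\<integral>\<^sup>+ x. \<integral>\<^sup>+ y. w (\<kappa> x) (\<kappa>' y) * F (\<kappa> x) (\<kappa>' y) \<partial>N \<partial>M)"
      by (subst int, measurable, subst N.nn_integral_fst[symmetric]) auto
    also have "\<dots> = (\<Sum>k. (\<Sum>l. w k l * F k l * ennreal (n l)) * ennreal (m k))"
      unfolding intN[of "\<lambda>l. w _ l * F _ l"] by (rule intM)
    also have "\<dots> = (\<Sum>k. \<Sum>l. F k l * ennreal (p (k, l)))"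
    proof (rule suminf_cong)
      fix k
      have "(\<Sum>l. w k l * F k l * ennreal (n l)) * ennreal (m k) = (\<Sum>l. w k l * F k l * ennreal (n l) * ennreal (m k))"
        by simp
      also have "\<dots> = (\<Sum>l. F k l * ennreal (p (k, l)))"
      proof (rule suminf_cong)
        fix l
        have "w k l * F k l * ennreal (n l) * ennreal (m k) = F k l * (w k l * ennreal (n l * m k))"
          using mn by (simp add: ennreal_mult mult_ac)
        also have "w k l * ennreal (n l * m k) = ennreal (p (k, l))"
          using mn[of k] mn[of l] p[of "(k, l)"] pm[of k l] pn[of k l]
          by (auto simp: w_def ennreal_mult'[symmetric])
        finally show "w k l * F k l * ennreal (n l) * ennreal (m k) = F k l * ennreal (p (k, l))" .
      qed
      finally show "(\<Sum>l. w k l * F k l * ennreal (n l)) * ennreal (m k) = (\<Sum>l. F k l * ennreal (p (k, l)))" .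
    qed
    finally show "(\<integral>\<^sup>+ z. F (\<kappa> (fst z)) (\<kappa>' (snd z)) \<partial>\<pi>) = (\<Sum>k. \<Sum>l. F k l * ennreal (p (k, l)))" .
  qed
qed

lemma (in prob_space) integral_collapsed_index:
  assumes [measurable]: "\<kappa> \<in> M \<rightarrow>\<^sub>M count_space (UNIV :: nat set)"
  defines "m \<equiv> \<lambda>k. prob {x \<in> space M. \<kappa> x = k}"
  shows "(\<integral>x. g (min (\<kappa> x) K) \<partial>M) = (\<Sum>k\<le>K. g k * collapse_tail m K k)"
    and "prob {x \<in> space M. K \<le> \<kappa> x} = tail_mass m K"
proof -
  have "prob {x \<in> space M. \<kappa> x < K} = prob (\<Union>k<K. {x \<in> space M. \<kappa> x = k})"
    by (rule arg_cong[of _ _ prob]) auto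
  also have "\<dots> = (\<Sum>k<K. m k)"
    unfolding m_def by (intro finite_measure_finite_Union) (auto simp: disjoint_family_on_def)
  finally have lt: "prob {x \<in> space M. \<kappa> x < K} = (\<Sum>k<K. m k)" .
  have "prob {x \<in> space M. K \<le> \<kappa> x} = prob (space M - {x \<in> space M. \<kappa> x < K})"
    by (rule arg_cong[of _ _ prob]) auto
  also have "\<dots> = tail_mass m K" by (subst prob_compl) (auto simp: lt tail_mass_def)
  finally show tail: "prob {x \<in> space M. K \<le> \<kappa> x} = tail_mass m K" .
  have "(\<integral>x. g (min (\<kappa> x) K) \<partial>M) = (\<integral>x. (\<Sum>k\<le>K. g k * indicator {x \<in> space M. min (\<kappa> x) K = k} x) \<partial>M)"
  proof (rule Bochner_Integration.integral_cong[OF refl])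
    fix x assume "x \<in> space M"
    then have "(\<Sum>k\<le>K. g k * indicator {x \<in> space M. min (\<kappa> x) K = k} x) = (\<Sum>k\<le>K. if k = min (\<kappa> x) K then g k else 0)"
      by (intro sum.cong) auto
    then show "g (min (\<kappa> x) K) = (\<Sum>k\<le>K. g k * indicator {x \<in> space M. min (\<kappa> x) K = k} x)"
      by simp
  qed
  also have "\<dots> = (\<Sum>k\<le>K. g k * prob {x \<in> space M. min (\<kappa> x) K = k})"
    using integrable_const_bound[of "indicat_real {x \<in> space M. min (\<kappa> x) K = _}" 1]
    by (subst Bochner_Integration.integral_sum) (auto intro!: integrable_mult_right)
  also have "\<dots> = (\<Sum>k\<le>K. g k * collapse_tail m K k)"
  proof (intro sum.cong refl arg_cong2[where f = "(*)"])
    fix k assume "k \<in> {..K}"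
    then have "{x \<in> space M. min (\<kappa> x) K = k} = (if k < K then {x \<in> space M. \<kappa> x = k} else {x \<in> space M. K \<le> \<kappa> x})"
      by auto
    then show "prob {x \<in> space M. min (\<kappa> x) K = k} = collapse_tail m K k"
      by (auto simp: collapse_tail_def tail m_def[symmetric]) (simp add: m_def)
  qed
  finally show "(\<integral>x. g (min (\<kappa> x) K) \<partial>M) = (\<Sum>k\<le>K. g k * collapse_tail m K k)" .
qed

text \<open>Truncating the distance at \<open>L\<close> bounds the error on the cells that are lumped together.\<close>

definition mcshane :: "('s \<Rightarrow> 's \<Rightarrow> real) \<Rightarrow> (nat \<Rightarrow> 's) \<Rightarrow> real \<Rightarrow> nat \<Rightarrow> (nat \<Rightarrow> real) \<Rightarrow> 's \<Rightarrow> real" where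
  "mcshane \<rho> b L K g x = Min ((\<lambda>k. g k + min (\<rho> (b k) x) L) ` {..K})"

lemma mcshane_le: "k \<le> K \<Longrightarrow> mcshane \<rho> b L K g x \<le> g k + min (\<rho> (b k) x) L"
  unfolding mcshane_def by (intro Min_le) auto

lemma mcshane_attained: "\<exists>k\<le>K. mcshane \<rho> b L K g x = g k + min (\<rho> (b k) x) L"
proof -
  have "mcshane \<rho> b L K g x \<in> (\<lambda>k. g k + min (\<rho> (b k) x) L) ` {..K}"
    unfolding mcshane_def by (intro Min_in) auto
  then show ?thesis by auto
qed

text \<open>The hard half of Kantorovich duality. Points are rounded to a countable dense sequence;
  a potential on the rounded space extends to a bounded measurable Lipschitz function by
  \<open>mcshane\<close>, so the hypothesis on functions controls the finite dual problems. The
  resulting matrix is then spread back over the cells.\<close>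

lemma kantorovich_separable:
  fixes \<rho> :: "'s \<Rightarrow> 's \<Rightarrow> real"
  assumes M: "prob_space M" and N: "prob_space N" and sets: "sets N = sets M"
    and nonneg: "\<And>x y. x \<in> space M \<Longrightarrow> y \<in> space M \<Longrightarrow> 0 \<le> \<rho> x y"
    and refl: "\<And>x. x \<in> space M \<Longrightarrow> \<rho> x x = 0"
    and sym: "\<And>x y. x \<in> space M \<Longrightarrow> y \<in> space M \<Longrightarrow> \<rho> x y = \<rho> y x"
    and tri: "\<And>x y z. x \<in> space M \<Longrightarrow> y \<in> space M \<Longrightarrow> z \<in> space M \<Longrightarrow> \<rho> x z \<le> \<rho> x y + \<rho> y z"
    and meas: "\<And>b. b \<in> space M \<Longrightarrow> \<rho> b \<in> borel_measurable M"
    and C: "countable C" "C \<subseteq> space M" "\<And>x e. x \<in> space M \<Longrightarrow> 0 < e \<Longrightarrow> \<exists>b\<in>C. \<rho> b x < e"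
    and dual: "\<And>f B. f \<in> borel_measurable M \<Longrightarrow> (\<And>x. x \<in> space M \<Longrightarrow> \<bar>f x\<bar> \<le> B) \<Longrightarrow>
       (\<And>x y. x \<in> space M \<Longrightarrow> y \<in> space M \<Longrightarrow> f x - f y \<le> \<rho> x y) \<Longrightarrow>
       (\<integral>x. f x \<partial>M) - (\<integral>x. f x \<partial>N) \<le> A"
  shows "wasserstein1 \<rho> M N \<le> ennreal A"
proof (rule ennreal_le_epsilon)
  fix e :: real assume "0 < e"
  \<comment> \<open>Four rounding errors occur: one for each of the two integrals on the dual side,
    and one for each endpoint when the cost between representatives is turned back into a cost
    between points.\<close>
  define \<epsilon> where "\<epsilon> = e / 4"
  have \<epsilon>: "0 < \<epsilon>" using \<open>0 < e\<close> by (simp add: \<epsilon>_def)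
  interpret M: prob_space M by fact
  interpret N: prob_space N by fact
  note [measurable_cong] = sets
  have sp: "space N = space M" using sets by (rule sets_eq_imp_space_eq)
  have "A \<ge> 0" using dual[of "\<lambda>_. 0" 0] nonneg by simp
  have "C \<noteq> {}" using C(3)[of _ 1] M.not_empty by auto
  define b where "b = from_nat_into C"
  have rb: "range b = C" using C \<open>C \<noteq> {}\<close> by (simp add: b_def range_from_nat_into)
  have b: "b k \<in> space M" for k using rb C by auto
  \<comment> \<open>Taking the first sufficiently near representative makes the rounding a
    measurable map, with no choice involved.\<close>
  define \<kappa> where "\<kappa> = (\<lambda>x. LEAST k. \<rho> (b k) x < \<epsilon>)"
  have near: "\<rho> (b (\<kappa> x)) x < \<epsilon>" if "x \<in> space M" for x
  proof -
    have "\<exists>k. \<rho> (b k) x < \<epsilon>" using C(3)[OF that \<epsilon>] rb by auto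
    then show ?thesis unfolding \<kappa>_def by (rule LeastI_ex)
  qed
  have [measurable]: "\<rho> (b k) \<in> borel_measurable M" for k by (intro meas b)
  have \<kappa>M[measurable]: "\<kappa> \<in> M \<rightarrow>\<^sub>M count_space UNIV" unfolding \<kappa>_def by measurable
  have \<kappa>N: "\<kappa> \<in> N \<rightarrow>\<^sub>M count_space UNIV" by measurable
  define m where "m = (\<lambda>k. measure M {x \<in> space M. \<kappa> x = k})"
  define n where "n = (\<lambda>k. measure N {x \<in> space N. \<kappa> x = k})"
  define c where "c = (\<lambda>k l. \<rho> (b k) (b l))"
  have msum: "m sums 1" and nsum: "n sums 1"
    unfolding m_def n_def by (intro M.prob_fibres_sums N.prob_fibres_sums \<kappa>M \<kappa>N)+
  obtain p where p: "\<And>z. 0 \<le> p z" "\<And>k. (\<lambda>l. p (k, l)) sums m k" "\<And>l. (\<lambda>k. p (k, l)) sums n l"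
    "\<And>J. (\<Sum>z\<in>{..<J} \<times> {..<J}. p z * c (fst z) (snd z)) \<le> A + 2 * \<epsilon>"
  proof (rule countable_kantorovich[of m n c "A + 2 * \<epsilon>"])
    show "m sums 1" "n sums 1" by fact+
    show "c j l \<le> c j k + c k l" for j k l unfolding c_def by (intro tri b)
    fix K L and g :: "nat \<Rightarrow> real"
    assume L: "0 < L" and g: "\<And>k l. k \<le> K \<Longrightarrow> l \<le> K \<Longrightarrow> g k - g l \<le> min (c k l) L"
    define f where "f = mcshane \<rho> b L K g"
    have fle: "f x \<le> g k + min (\<rho> (b k) x) L" if "k \<le> K" for x k
      unfolding f_def using that by (rule mcshane_le)
    have fex: "\<exists>k\<le>K. f x = g k + min (\<rho> (b k) x) L" for x
      unfolding f_def by (rule mcshane_attained)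
    have fm[measurable]: "f \<in> borel_measurable M"
      unfolding f_def mcshane_def by (intro borel_measurable_Min) auto
    have fb: "\<bar>f x\<bar> \<le> (\<Sum>k\<le>K. \<bar>g k\<bar>) + L" if x: "x \<in> space M" for x
    proof -
      obtain k where k: "k \<le> K" "f x = g k + min (\<rho> (b k) x) L" using fex by blast
      moreover have "\<bar>g k\<bar> \<le> (\<Sum>k\<le>K. \<bar>g k\<bar>)" using k by (intro member_le_sum) auto
      ultimately show ?thesis using nonneg[OF b[of k] x] L by auto
    qed
    have "f x - f y \<le> \<rho> x y" if xy: "x \<in> space M" "y \<in> space M" for x y
    proof -
      obtain k where k: "k \<le> K" "f y = g k + min (\<rho> (b k) y) L" using fex by blast
      with fle[OF k(1), of x] tri[OF b[of k] xy(2,1)] sym[OF xy] nonneg[OF xy] show ?thesis by auto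
    qed
    with dual[OF fm fb] have fd: "(\<integral>x. f x \<partial>M) - (\<integral>x. f x \<partial>N) \<le> A" by simp
    \<comment> \<open>On a cell below \<open>K\<close> the extension differs from the value at the
      representative by at most the rounding error, by the triangle inequality. On the lumped cells
      only the cap \<open>L\<close> is available.\<close>
    have close: "\<bar>g (min (\<kappa> x) K) - f x\<bar> \<le> \<epsilon> + L * indicator {x \<in> space M. K \<le> \<kappa> x} x"
      if x: "x \<in> space M" for x
    proof -
      obtain k where k: "k \<le> K" "f x = g k + min (\<rho> (b k) x) L" using fex by blast
      show ?thesis
      proof (cases "K \<le> \<kappa> x")
        case True
        then show ?thesis
          using k g[of K k] fle[of K x] nonneg[OF b[of k] x] L \<epsilon> x by auto
      next
        case False
        then show ?thesis
          using k g[of "\<kappa> x" k] fle[of "\<kappa> x" x] near[OF x] L \<epsilon> x tri[OF b[of "\<kappa> x"] x b[of k]]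
            sym[OF x b[of k]] by (auto simp: c_def min_def split: if_splits)
      qed
    qed
    have bound: "\<bar>(\<Sum>k\<le>K. g k * collapse_tail (\<lambda>k. measure P {x \<in> space P. \<kappa> x = k}) K k) - (\<integral>x. f x \<partial>P)\<bar>
        \<le> \<epsilon> + L * tail_mass (\<lambda>k. measure P {x \<in> space P. \<kappa> x = k}) K"
      if P: "prob_space P" and sP[measurable_cong]: "sets P = sets M" for P
    proof -
      interpret P: prob_space P by fact
      have spP: "space P = space M" using sP by (rule sets_eq_imp_space_eq)
      have \<kappa>P[measurable]: "\<kappa> \<in> P \<rightarrow>\<^sub>M count_space UNIV" by measurable
      have intf: "integrable P f"
        by (rule P.integrable_const_bound[where B = "(\<Sum>k\<le>K. \<bar>g k\<bar>) + L"]) (auto simp: fb spP)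
      have intg: "integrable P (\<lambda>x. g (min (\<kappa> x) K))"
        by (rule P.integrable_const_bound[where B = "(\<Sum>k\<le>K. \<bar>g k\<bar>)"]) (auto intro!: member_le_sum)
      have [measurable]: "{x \<in> space M. K \<le> \<kappa> x} \<in> P.events" by measurable
      have inti: "integrable P (indicat_real {x \<in> space M. K \<le> \<kappa> x})"
        by (rule P.integrable_const_bound[where B = 1]) auto
      have "\<bar>(\<integral>x. g (min (\<kappa> x) K) \<partial>P) - (\<integral>x. f x \<partial>P)\<bar> = \<bar>\<integral>x. (g (min (\<kappa> x) K) - f x) \<partial>P\<bar>"
        by (simp add: intf intg)
      also have "\<dots> \<le> (\<integral>x. \<bar>g (min (\<kappa> x) K) - f x\<bar> \<partial>P)"
        by (rule integral_abs_bound)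
      also have "\<dots> \<le> (\<integral>x. \<epsilon> + L * indicator {x \<in> space M. K \<le> \<kappa> x} x \<partial>P)"
        using intf intg inti by (intro integral_mono) (auto simp: close spP intro!: integrable_mult_right)
      also have "\<dots> = \<epsilon> + L * measure P {x \<in> space M. K \<le> \<kappa> x}"
        using inti by (subst Bochner_Integration.integral_add) (auto intro!: integrable_mult_right simp: P.prob_space[unfolded spP] spP)
      finally show ?thesis
        using P.integral_collapsed_index(1)[OF \<kappa>P, of g K] P.integral_collapsed_index(2)[OF \<kappa>P, of K] by (simp add: spP)
    qed
    have "(\<Sum>k\<le>K. g k * (collapse_tail m K k - collapse_tail n K k)) =
      (\<Sum>k\<le>K. g k * collapse_tail m K k) - (\<Sum>k\<le>K. g k * collapse_tail n K k)"
      by (simp add: algebra_simps sum_subtractf)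
    then show "(\<Sum>k\<le>K. g k * (collapse_tail m K k - collapse_tail n K k)) \<le> A + 2 * \<epsilon> + L * (tail_mass m K + tail_mass n K)"
      using bound[OF M HOL.refl] bound[OF N sets] fd unfolding m_def[symmetric] n_def[symmetric]
      by (simp add: algebra_simps)
  qed (auto simp: m_def n_def c_def refl nonneg sym b)
  obtain \<pi> where \<pi>: "\<pi> \<in> couplings M N"
    "\<And>F. (\<integral>\<^sup>+ z. F (\<kappa> (fst z)) (\<kappa> (snd z)) \<partial>\<pi>) = (\<Sum>k. \<Sum>l. F k l * ennreal (p (k, l)))"
    using coupling_of_discretisation[OF M N \<kappa>M \<kappa>N, where p = p, OF p(1) p(2)[unfolded m_def] p(3)[unfolded n_def]]
    by blast
  have sp\<pi>: "space \<pi> = space M \<times> space M"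
    using \<pi>(1) sets_eq_imp_space_eq[of \<pi> "M \<Otimes>\<^sub>M N"] by (auto simp: couplings_def space_pair_measure sp)
  have "wasserstein1 \<rho> M N \<le> (\<integral>\<^sup>+ z. ennreal (\<rho> (fst z) (snd z)) \<partial>\<pi>)"
    unfolding wasserstein1_def using \<pi>(1) by (rule INF_lower)
  also have "\<dots> \<le> (\<integral>\<^sup>+ z. ennreal (c (\<kappa> (fst z)) (\<kappa> (snd z)) + 2 * \<epsilon>) \<partial>\<pi>)"
  proof (rule nn_integral_mono, rule ennreal_leI)
    fix z assume "z \<in> space \<pi>"
    then have z: "fst z \<in> space M" "snd z \<in> space M" by (auto simp: sp\<pi>)
    let ?x = "b (\<kappa> (fst z))" and ?y = "b (\<kappa> (snd z))"
    have "\<rho> (fst z) (snd z) \<le> \<rho> (fst z) ?x + \<rho> ?x (snd z)" by (intro tri z b)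
    also have "\<rho> ?x (snd z) \<le> \<rho> ?x ?y + \<rho> ?y (snd z)" by (intro tri z b)
    finally show "\<rho> (fst z) (snd z) \<le> c (\<kappa> (fst z)) (\<kappa> (snd z)) + 2 * \<epsilon>"
      using near[OF z(1)] near[OF z(2)] sym[OF z(1) b[of "\<kappa> (fst z)"]] by (simp add: c_def)
  qed
  also have "\<dots> = (\<Sum>k. \<Sum>l. ennreal (c k l + 2 * \<epsilon>) * ennreal (p (k, l)))"
    by (rule \<pi>(2))
  also have "\<dots> \<le> ennreal (A + 4 * \<epsilon>)"
  proof (rule suminf2_le_const)
    fix J
    have cb: "0 \<le> c k l + 2 * \<epsilon>" for k l using \<epsilon> nonneg[OF b[of k] b[of l]] by (simp add: c_def)
    have "(\<Sum>z\<in>{..<J} \<times> {..<J}. ennreal (c (fst z) (snd z) + 2 * \<epsilon>) * ennreal (p (fst z, snd z))) =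
        ennreal (\<Sum>z\<in>{..<J} \<times> {..<J}. (c (fst z) (snd z) + 2 * \<epsilon>) * p z)"
      using cb p(1) by (simp add: ennreal_mult'[symmetric] sum_ennreal)
    also have "\<dots> \<le> ennreal (A + 4 * \<epsilon>)"
    proof (rule ennreal_leI)
      have "(\<Sum>z\<in>{..<J} \<times> {..<J}. p z) = (\<Sum>k<J. \<Sum>l<J. p (k, l))"
        by (simp add: sum.cartesian_product)
      also have "\<dots> \<le> (\<Sum>k<J. m k)"
        using p(1,2) sum_le_suminf[of "\<lambda>l. p (_, l)" "{..<J}"] by (intro sum_mono) (auto simp: sums_iff)
      also have "\<dots> \<le> 1"
        using msum sum_le_suminf[of m "{..<J}"] by (auto simp: sums_iff m_def)
      finally have "2 * \<epsilon> * (\<Sum>z\<in>{..<J} \<times> {..<J}. p z) \<le> 2 * \<epsilon>" using \<epsilon> by simp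
      moreover have "(\<Sum>z\<in>{..<J} \<times> {..<J}. (c (fst z) (snd z) + 2 * \<epsilon>) * p z) =
          (\<Sum>z\<in>{..<J} \<times> {..<J}. p z * c (fst z) (snd z)) + 2 * \<epsilon> * (\<Sum>z\<in>{..<J} \<times> {..<J}. p z)"
        by (simp add: distrib_left sum.distrib sum_distrib_left mult.commute[of _ "p _"])
      ultimately show "(\<Sum>z\<in>{..<J} \<times> {..<J}. (c (fst z) (snd z) + 2 * \<epsilon>) * p z) \<le> A + 4 * \<epsilon>"
        using p(4)[of J] by linarith
    qed
    finally show "(\<Sum>z\<in>{..<J} \<times> {..<J}. ennreal (c (fst z) (snd z) + 2 * \<epsilon>) * ennreal (p (fst z, snd z))) \<le> ennreal (A + 4 * \<epsilon>)" .
  qed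
  also have "\<dots> = ennreal A + ennreal e"
    using \<open>0 \<le> A\<close> \<open>0 < e\<close> by (simp add: \<epsilon>_def ennreal_plus)
  finally show "wasserstein1 \<rho> M N \<le> ennreal A + ennreal e" .
qed

section \<open>Couplings, kernels and resampling\<close>

lemma pair_measure_in_couplings:
  assumes "prob_space M" "prob_space N"
  shows "M \<Otimes>\<^sub>M N \<in> couplings M N"
proof -
  interpret M: prob_space M by fact
  interpret N: prob_space N by fact
  interpret MN: pair_prob_space M N ..
  have "distr (M \<Otimes>\<^sub>M N) N snd = distr (distr (N \<Otimes>\<^sub>M M) (M \<Otimes>\<^sub>M N) (\<lambda>(x, y). (y, x))) N snd"
    by (subst MN.distr_pair_swap) simp
  also have "\<dots> = distr (N \<Otimes>\<^sub>M M) N fst"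
    by (subst distr_distr) (auto simp: o_def case_prod_beta)
  finally show ?thesis
    by (simp add: couplings_def M.distr_pair_fst N.distr_pair_fst)
qed

lemma couplingsD:
  assumes "\<pi> \<in> couplings M N"
  shows "sets \<pi> = sets (M \<Otimes>\<^sub>M N)" "space \<pi> = space M \<times> space N"
    "fst \<in> \<pi> \<rightarrow>\<^sub>M M" "snd \<in> \<pi> \<rightarrow>\<^sub>M N" "distr \<pi> M fst = M" "distr \<pi> N snd = N"
    "prob_space M \<Longrightarrow> prob_space \<pi>"
proof -
  show s[measurable_cong]: "sets \<pi> = sets (M \<Otimes>\<^sub>M N)" using assms by (simp add: couplings_def)
  show "space \<pi> = space M \<times> space N" using sets_eq_imp_space_eq[OF s] by (simp add: space_pair_measure)
  show m: "fst \<in> \<pi> \<rightarrow>\<^sub>M M" "snd \<in> \<pi> \<rightarrow>\<^sub>M N" by measurable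
  show d: "distr \<pi> M fst = M" "distr \<pi> N snd = N" using assms by (simp_all add: couplings_def)
  show "prob_space \<pi>" if "prob_space M"
    using prob_space_distrD[OF m(1)] that by (simp add: d)
qed

lemma wasserstein1_eq_0:
  assumes "prob_space M" "prob_space N"
    and "\<And>x y. x \<in> space M \<Longrightarrow> y \<in> space N \<Longrightarrow> \<rho> x y = 0"
  shows "wasserstein1 \<rho> M N = 0"
proof -
  have "wasserstein1 \<rho> M N \<le> (\<integral>\<^sup>+ z. ennreal (\<rho> (fst z) (snd z)) \<partial>(M \<Otimes>\<^sub>M N))"
    unfolding wasserstein1_def by (rule INF_lower[OF pair_measure_in_couplings[OF assms(1,2)]])
  also have "\<dots> = (\<integral>\<^sup>+ z. 0 \<partial>(M \<Otimes>\<^sub>M N))"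
    using assms(3) by (intro nn_integral_cong) (auto simp: space_pair_measure)
  finally show ?thesis by simp
qed

text \<open>The easy half of duality: under any coupling both integrals live on one space, and their
  difference is bounded by the integrated cost. The factor \<open>L\<close> is divided out of the
  function first, because \<open>d\<close> is not assumed measurable here and a constant is not to
  be moved through its integral; \<open>L = 0\<close> means a constant function.\<close>

lemma abs_integral_diff_le_wasserstein1:
  fixes g :: "'a \<Rightarrow> real"
  assumes M: "prob_space M" "sets M = sets E" and N: "prob_space N" "sets N = sets E"
    and g[measurable]: "g \<in> borel_measurable E" and B: "\<And>u. u \<in> space E \<Longrightarrow> \<bar>g u\<bar> \<le> B"
    and L: "0 \<le> L" "\<And>u v. u \<in> space E \<Longrightarrow> v \<in> space E \<Longrightarrow> \<bar>g u - g v\<bar> \<le> L * d u v"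
  shows "ennreal \<bar>(\<integral>u. g u \<partial>M) - (\<integral>u. g u \<partial>N)\<bar> \<le> ennreal L * wasserstein1 d M N"
proof (cases "L = 0")
  case True
  interpret M: prob_space M by fact
  interpret N: prob_space N by fact
  have sp: "space M = space E" "space N = space E" using M N by (auto dest: sets_eq_imp_space_eq)
  obtain u0 where u0: "u0 \<in> space E" using M.not_empty sp by auto
  have eq: "g u = g u0" if "u \<in> space E" for u using L(2)[OF that u0] True by simp
  have "(\<integral>u. g u \<partial>M) = (\<integral>u. g u0 \<partial>M)" "(\<integral>u. g u \<partial>N) = (\<integral>u. g u0 \<partial>N)"
    by (intro Bochner_Integration.integral_cong refl eq; simp add: sp)+
  then show ?thesis by (simp add: M.prob_space N.prob_space)
next
  case False
  with L have "0 < L" by simp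
  define h where "h = (\<lambda>u. g u / L)"
  have [measurable]: "h \<in> borel_measurable E" unfolding h_def by measurable
  have hB: "\<bar>h u\<bar> \<le> B / L" if "u \<in> space E" for u
    using B[OF that] \<open>0 < L\<close> by (simp add: h_def divide_right_mono)
  have hd: "\<bar>h u - h v\<bar> \<le> d u v" if "u \<in> space E" "v \<in> space E" for u v
    using L(2)[OF that] \<open>0 < L\<close> by (simp add: h_def field_simps flip: diff_divide_distrib)
  have "ennreal \<bar>(\<integral>u. h u \<partial>M) - (\<integral>u. h u \<partial>N)\<bar> \<le> wasserstein1 d M N"
    unfolding wasserstein1_def
  proof (rule INF_greatest)
    fix \<pi> assume "\<pi> \<in> couplings M N"
    note cpl = couplingsD[OF this]
    note [measurable_cong] = M(2) N(2)
    have [measurable_cong]: "sets \<pi> = sets (E \<Otimes>\<^sub>M E)"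
      using cpl(1) M(2) N(2) by (simp cong: sets_pair_measure_cong)
    have sp: "space \<pi> = space E \<times> space E"
      using cpl(2) sets_eq_imp_space_eq[OF M(2)] sets_eq_imp_space_eq[OF N(2)] by simp
    note m = cpl(5,6)
    interpret \<pi>: prob_space \<pi> by (rule cpl(7)[OF M(1)])
    have i1: "(\<integral>u. h u \<partial>M) = (\<integral>z. h (fst z) \<partial>\<pi>)"
      by (subst (1) m(1)[symmetric], subst integral_distr) auto
    have i2: "(\<integral>u. h u \<partial>N) = (\<integral>z. h (snd z) \<partial>\<pi>)"
      by (subst (1) m(2)[symmetric], subst integral_distr) auto
    have int: "integrable \<pi> (\<lambda>z. h (fst z))" "integrable \<pi> (\<lambda>z. h (snd z))"
      by (rule \<pi>.integrable_const_bound[where B = "B / L"], use hB sp in auto)+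
    have "ennreal \<bar>(\<integral>u. h u \<partial>M) - (\<integral>u. h u \<partial>N)\<bar> = ennreal \<bar>\<integral>z. (h (fst z) - h (snd z)) \<partial>\<pi>\<bar>"
      by (simp add: i1 i2 int)
    also have "\<dots> \<le> ennreal (\<integral>z. \<bar>h (fst z) - h (snd z)\<bar> \<partial>\<pi>)"
      by (intro ennreal_leI integral_abs_bound)
    also have "\<dots> = (\<integral>\<^sup>+ z. ennreal \<bar>h (fst z) - h (snd z)\<bar> \<partial>\<pi>)"
      using int by (intro nn_integral_eq_integral[symmetric]) auto
    also have "\<dots> \<le> (\<integral>\<^sup>+ z. ennreal (d (fst z) (snd z)) \<partial>\<pi>)"
      by (intro nn_integral_mono ennreal_leI hd) (auto simp: sp)
    finally show "ennreal \<bar>(\<integral>u. h u \<partial>M) - (\<integral>u. h u \<partial>N)\<bar> \<le> (\<integral>\<^sup>+ z. ennreal (d (fst z) (snd z)) \<partial>\<pi>)" .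
  qed
  then have "ennreal L * ennreal \<bar>(\<integral>u. h u \<partial>M) - (\<integral>u. h u \<partial>N)\<bar> \<le> ennreal L * wasserstein1 d M N"
    by (rule mult_left_mono) simp
  moreover have "\<bar>(\<integral>u. g u \<partial>M) - (\<integral>u. g u \<partial>N)\<bar> = L * \<bar>(\<integral>u. h u \<partial>M) - (\<integral>u. h u \<partial>N)\<bar>"
  proof -
    have "(\<integral>u. g u \<partial>M) = L * (\<integral>u. h u \<partial>M)" "(\<integral>u. g u \<partial>N) = L * (\<integral>u. h u \<partial>N)"
      using \<open>0 < L\<close> by (simp_all add: h_def)
    then show ?thesis using \<open>0 < L\<close> by (simp add: abs_mult flip: right_diff_distrib)
  qed
  ultimately show ?thesis using L(1) by (simp add: ennreal_mult)
qed

text \<open>Telescoping: \<open>y\<close> is reached from \<open>x\<close> by switching one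
  coordinate at a time, and each switch is paid by the bound for its coordinate.\<close>

lemma abs_diff_le_sum_of_coordinate_bounds:
  fixes F :: "('i \<Rightarrow> 'a) \<Rightarrow> real"
  assumes "finite T"
    and F: "\<And>x y j. x \<in> PiE T X \<Longrightarrow> y \<in> PiE T X \<Longrightarrow> j \<in> T \<Longrightarrow> (\<forall>k\<in>T - {j}. x k = y k) \<Longrightarrow>
      \<bar>F x - F y\<bar> \<le> b j (x j) (y j)"
    and x: "x \<in> PiE T X" and y: "y \<in> PiE T X"
  shows "\<bar>F x - F y\<bar> \<le> (\<Sum>j\<in>T. b j (x j) (y j))"
proof -
  define z where "z = (\<lambda>A k. if k \<in> A then y k else x k)"
  have zX: "z A \<in> PiE T X" if "A \<subseteq> T" for A using x y that by (auto simp: z_def PiE_iff extensional_def)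
  have "\<bar>F x - F (z A)\<bar> \<le> (\<Sum>j\<in>A. b j (x j) (y j))" if "A \<subseteq> T" for A
    using finite_subset[OF that \<open>finite T\<close>] that
  proof induction
    case empty
    then show ?case by (simp add: z_def)
  next
    case (insert j A)
    have "\<bar>F (z A) - F (z (insert j A))\<bar> \<le> b j (z A j) (z (insert j A) j)"
      using insert.prems by (intro F zX) (auto simp: z_def)
    then show ?case using insert by (simp add: z_def)
  qed
  from this[of T] have "\<bar>F x - F (z T)\<bar> \<le> (\<Sum>j\<in>T. b j (x j) (y j))" by simp
  moreover have "z T = y" using x y by (auto simp: z_def PiE_iff extensional_def)
  ultimately show ?thesis by simp
qed

text \<open>The joint law of a point drawn from \<open>M\<close> and a second point drawn from the
  kernel at the first one. Keeping the base point makes it possible to compare two kernels over the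
  same base as two ordinary measures.\<close>

definition semidirect :: "'a measure \<Rightarrow> 'b measure \<Rightarrow> ('a \<Rightarrow> 'b measure) \<Rightarrow> ('a \<times> 'b) measure" where
  "semidirect M E \<kappa> = M \<bind> (\<lambda>x. distr (\<kappa> x) (M \<Otimes>\<^sub>M E) (Pair x))"

context
  fixes M :: "'a measure" and E :: "'b measure" and \<kappa> :: "'a \<Rightarrow> 'b measure"
  assumes M: "prob_space M" and \<kappa>[measurable]: "\<kappa> \<in> M \<rightarrow>\<^sub>M prob_algebra E"
begin

lemma kernel_in_prob_algebra: "x \<in> space M \<Longrightarrow> \<kappa> x \<in> space (prob_algebra E)"
  using \<kappa> by (rule measurable_space)

lemma semidirect_kernel[measurable]:
  "(\<lambda>x. distr (\<kappa> x) (M \<Otimes>\<^sub>M E) (Pair x)) \<in> M \<rightarrow>\<^sub>M prob_algebra (M \<Otimes>\<^sub>M E)"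
  by measurable

lemma M_in_prob_algebra: "M \<in> space (prob_algebra M)"
  using M by (simp add: space_prob_algebra)

lemma sets_semidirect[measurable_cong, simp]: "sets (semidirect M E \<kappa>) = sets (M \<Otimes>\<^sub>M E)"
  unfolding semidirect_def
  by (rule sets_bind'[OF M_in_prob_algebra semidirect_kernel])

lemma space_semidirect[simp]: "space (semidirect M E \<kappa>) = space M \<times> space E"
  using sets_eq_imp_space_eq[OF sets_semidirect] by (simp add: space_pair_measure)

lemma prob_space_semidirect: "prob_space (semidirect M E \<kappa>)"
  unfolding semidirect_def by (rule prob_space_bind'[OF M_in_prob_algebra semidirect_kernel])

lemma nn_integral_semidirect:
  assumes [measurable]: "f \<in> borel_measurable (M \<Otimes>\<^sub>M E)"
  shows "(\<integral>\<^sup>+ z. f z \<partial>semidirect M E \<kappa>) = (\<integral>\<^sup>+ x. \<integral>\<^sup>+ u. f (x, u) \<partial>\<kappa> x \<partial>M)"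
proof -
  have "(\<integral>\<^sup>+ z. f z \<partial>semidirect M E \<kappa>) = (\<integral>\<^sup>+ x. \<integral>\<^sup>+ z. f z \<partial>distr (\<kappa> x) (M \<Otimes>\<^sub>M E) (Pair x) \<partial>M)"
    unfolding semidirect_def
    by (rule nn_integral_bind[OF assms measurable_prob_algebraD[OF semidirect_kernel]])
  also have "\<dots> = (\<integral>\<^sup>+ x. \<integral>\<^sup>+ u. f (x, u) \<partial>\<kappa> x \<partial>M)"
  proof (rule nn_integral_cong)
    fix x assume "x \<in> space M"
    then have [measurable_cong]: "sets (\<kappa> x) = sets E" and [measurable]: "x \<in> space M"
      using kernel_in_prob_algebra by (auto simp: space_prob_algebra)
    show "(\<integral>\<^sup>+ z. f z \<partial>distr (\<kappa> x) (M \<Otimes>\<^sub>M E) (Pair x)) = (\<integral>\<^sup>+ u. f (x, u) \<partial>\<kappa> x)"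
      by (subst nn_integral_distr) auto
  qed
  finally show ?thesis .
qed

lemma integral_kernel_measurable:
  fixes f :: "'a \<times> 'b \<Rightarrow> real"
  assumes [measurable]: "f \<in> borel_measurable (M \<Otimes>\<^sub>M E)"
  shows "(\<lambda>x. \<integral>u. f (x, u) \<partial>\<kappa> x) \<in> borel_measurable M"
proof -
  have "(\<lambda>x. \<integral>z. f z \<partial>distr (\<kappa> x) (M \<Otimes>\<^sub>M E) (Pair x)) \<in> borel_measurable M"
    by (rule measurable_compose[OF measurable_prob_algebraD[OF semidirect_kernel] integral_measurable_subprob_algebra]) fact
  also have "?this \<longleftrightarrow> ?thesis"
  proof (rule measurable_cong)
    fix x assume "x \<in> space M"
    then have [measurable_cong]: "sets (\<kappa> x) = sets E" and [measurable]: "x \<in> space M"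
      using kernel_in_prob_algebra by (auto simp: space_prob_algebra)
    show "(\<integral>z. f z \<partial>distr (\<kappa> x) (M \<Otimes>\<^sub>M E) (Pair x)) = (\<integral>u. f (x, u) \<partial>\<kappa> x)"
      by (subst integral_distr) auto
  qed
  finally show ?thesis .
qed

lemma integral_semidirect:
  fixes f :: "'a \<times> 'b \<Rightarrow> real"
  assumes [measurable]: "f \<in> borel_measurable (M \<Otimes>\<^sub>M E)"
    and B: "\<And>x u. x \<in> space M \<Longrightarrow> u \<in> space E \<Longrightarrow> \<bar>f (x, u)\<bar> \<le> B"
  shows "(\<integral>z. f z \<partial>semidirect M E \<kappa>) = (\<integral>x. \<integral>u. f (x, u) \<partial>\<kappa> x \<partial>M)"
proof -
  have "(\<integral>z. f z \<partial>semidirect M E \<kappa>) = (\<integral>x. \<integral>z. f z \<partial>distr (\<kappa> x) (M \<Otimes>\<^sub>M E) (Pair x) \<partial>M)"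
    unfolding semidirect_def
  proof (rule integral_bind[where B = B and B' = 1])
    show "(\<lambda>x. distr (\<kappa> x) (M \<Otimes>\<^sub>M E) (Pair x)) \<in> M \<rightarrow>\<^sub>M subprob_algebra (M \<Otimes>\<^sub>M E)"
      by (rule measurable_prob_algebraD[OF semidirect_kernel])
    show "finite_measure M" using M by (simp add: prob_space.finite_measure)
    show "AE x in M. emeasure (distr (\<kappa> x) (M \<Otimes>\<^sub>M E) (Pair x)) (space (distr (\<kappa> x) (M \<Otimes>\<^sub>M E) (Pair x))) \<le> ennreal 1"
      using measurable_space[OF semidirect_kernel]
      by (intro AE_I2) (auto simp: space_prob_algebra intro!: prob_space.emeasure_le_1)
    show "\<bar>f z\<bar> \<le> B" if "z \<in> space (M \<Otimes>\<^sub>M E)" for z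
      using B that by (auto simp: space_pair_measure)
  qed (auto simp: assms)
  also have "\<dots> = (\<integral>x. \<integral>u. f (x, u) \<partial>\<kappa> x \<partial>M)"
  proof (rule Bochner_Integration.integral_cong[OF refl])
    fix x assume "x \<in> space M"
    then have [measurable_cong]: "sets (\<kappa> x) = sets E" and [measurable]: "x \<in> space M"
      using kernel_in_prob_algebra by (auto simp: space_prob_algebra)
    show "(\<integral>z. f z \<partial>distr (\<kappa> x) (M \<Otimes>\<^sub>M E) (Pair x)) = (\<integral>u. f (x, u) \<partial>\<kappa> x)"
      by (subst integral_distr) auto
  qed
  finally show ?thesis .
qed

end

section \<open>Invariance under single-site resampling\<close>

lemma measurable_site_update[measurable]:
  assumes "i \<in> T"
  shows "(\<lambda>z. (fst z)(i := snd z)) \<in> (\<Pi>\<^sub>M j\<in>T. E) \<Otimes>\<^sub>M E \<rightarrow>\<^sub>M (\<Pi>\<^sub>M j\<in>T. E)"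
  using measurable_add_dim[of i T "\<lambda>_. E"] assms by (simp add: insert_absorb case_prod_beta')

text \<open>Redrawing one coordinate from its conditional law given the others leaves the joint law
  unchanged. It suffices to test rectangles: there the event splits into an off-site event and an
  event at \<open>i\<close>, and integrating the conditional probability over the off-site event is
  the defining property of the conditional expectation.\<close>

lemma resample_site:
  assumes "finite T" and i: "i \<in> T" and \<nu>: "prob_space \<nu>" and s[measurable_cong]: "sets \<nu> = sets (\<Pi>\<^sub>M j\<in>T. E)"
    and \<kappa>: "is_site_cond_distr T E \<nu> i \<kappa>"
  shows "distr (semidirect \<nu> E \<kappa>) (\<Pi>\<^sub>M j\<in>T. E) (\<lambda>z. (fst z)(i := snd z)) = \<nu>"
proof -
  interpret prob_space \<nu> by fact
  have \<kappa>m[measurable]: "\<kappa> \<in> \<nu> \<rightarrow>\<^sub>M prob_algebra E"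
    using \<kappa> by (simp add: is_site_cond_distr_def measurable_cong_sets[OF s refl])
  have sp: "space \<nu> = space (\<Pi>\<^sub>M j\<in>T. E)" using s by (rule sets_eq_imp_space_eq)
  have \<kappa>sp: "prob_space (\<kappa> x)" "sets (\<kappa> x) = sets E" if "x \<in> space \<nu>" for x
    using kernel_in_prob_algebra[OF \<nu> _ that, of \<kappa> E] by (auto simp: space_prob_algebra)
  let ?F = "off_site_algebra T E i"
  let ?u = "\<lambda>z. (fst z)(i := snd z)"
  have um[measurable]: "?u \<in> semidirect \<nu> E \<kappa> \<rightarrow>\<^sub>M (\<Pi>\<^sub>M j\<in>T. E)"
    using measurable_site_update[OF i]
    by (subst measurable_cong_sets[OF _ refl, of _ "(\<Pi>\<^sub>M j\<in>T. E) \<Otimes>\<^sub>M E"])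
      (auto simp: sets_semidirect[OF \<nu> \<kappa>m] intro!: sets_pair_measure_cong s)
  have res: "(\<lambda>x. restrict x (T - {i})) \<in> (\<Pi>\<^sub>M j\<in>T. E) \<rightarrow>\<^sub>M (\<Pi>\<^sub>M j\<in>T - {i}. E)"
    by (rule measurable_restrict_subset) auto
  have "subalgebra \<nu> ?F"
    unfolding subalgebra_def off_site_algebra_def
    using sets_image_in_sets[OF refl res] by (auto simp: sp s)
  then interpret finite_measure_subalgebra \<nu> ?F by unfold_locales
  have eq: "emeasure (distr (semidirect \<nu> E \<kappa>) (\<Pi>\<^sub>M j\<in>T. E) ?u) (PiE T A) = emeasure \<nu> (PiE T A)"
    if A[measurable]: "\<And>j. j \<in> T \<Longrightarrow> A j \<in> sets E" for A :: "'a \<Rightarrow> 'b set"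
  proof -
    \<comment> \<open>The off-site part of the rectangle; it lies in the conditioning algebra, and
      resampling site \<open>i\<close> does not affect it.\<close>
    define B where "B = {x \<in> space (\<Pi>\<^sub>M j\<in>T. E). \<forall>j\<in>T - {i}. x j \<in> A j}"
    have "B = (\<lambda>x. restrict x (T - {i})) -` PiE (T - {i}) A \<inter> space (\<Pi>\<^sub>M j\<in>T. E)"
      unfolding B_def set_eq_iff Int_iff vimage_eq restrict_PiE_iff mem_Collect_eq by blast
    moreover have "PiE (T - {i}) A \<in> sets (\<Pi>\<^sub>M j\<in>T - {i}. E)"
      using \<open>finite T\<close> A by (intro sets_PiM_I_finite) auto
    ultimately have BF: "B \<in> sets ?F"
      unfolding off_site_algebra_def by (auto intro: in_vimage_algebra)
    then have Bm[measurable]: "B \<in> sets \<nu>" using \<open>subalgebra \<nu> ?F\<close> by (auto simp: subalgebra_def)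
    have Ai[measurable]: "A i \<in> sets E" using i A by auto
    have PA: "PiE T A \<in> sets (\<Pi>\<^sub>M j\<in>T. E)" using \<open>finite T\<close> A by (intro sets_PiM_I_finite) auto
    have ind: "indicator (PiE T A) (x(i := u)) = (indicator B x * indicator (A i) u :: ennreal)"
      if "x \<in> space \<nu>" "u \<in> space E" for x u
    proof -
      have "x(i := u) \<in> PiE T A \<longleftrightarrow> x \<in> B \<and> u \<in> A i"
        using that i by (auto simp: B_def sp space_PiM PiE_iff extensional_def)
      then show ?thesis by (auto simp: indicator_def)
    qed
    have inz: "(\<lambda>z. indicat_real (A i) (z i)) \<in> borel_measurable \<nu>"
      using i by measurable
    have intz: "integrable \<nu> (\<lambda>z. indicat_real (A i) (z i))"
      by (rule integrable_const_bound[where B = 1]) (use inz in auto)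
    have "emeasure (distr (semidirect \<nu> E \<kappa>) (\<Pi>\<^sub>M j\<in>T. E) ?u) (PiE T A) =
        (\<integral>\<^sup>+ z. indicator (PiE T A) (?u z) \<partial>semidirect \<nu> E \<kappa>)"
      using PA by (subst nn_integral_indicator[symmetric], simp, subst nn_integral_distr) auto
    also have "\<dots> = (\<integral>\<^sup>+ z. indicator B (fst z) * indicator (A i) (snd z) \<partial>semidirect \<nu> E \<kappa>)"
      using ind by (intro nn_integral_cong) (auto simp: space_semidirect[OF \<nu> \<kappa>m])
    also have "\<dots> = (\<integral>\<^sup>+ x. \<integral>\<^sup>+ u. indicator B x * indicator (A i) u \<partial>\<kappa> x \<partial>\<nu>)"
      by (subst nn_integral_semidirect[OF \<nu> \<kappa>m]) auto
    also have "\<dots> = (\<integral>\<^sup>+ x. ennreal (indicator B x * measure (\<kappa> x) (A i)) \<partial>\<nu>)"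
    proof (rule nn_integral_cong)
      fix x assume x: "x \<in> space \<nu>"
      interpret K: prob_space "\<kappa> x" by (rule \<kappa>sp[OF x])
      have [measurable_cong]: "sets (\<kappa> x) = sets E" by (rule \<kappa>sp[OF x])
      show "(\<integral>\<^sup>+ u. indicator B x * indicator (A i) u \<partial>\<kappa> x) = ennreal (indicator B x * measure (\<kappa> x) (A i))"
        by (subst nn_integral_cmult) (auto simp: K.emeasure_eq_measure indicator_def)
    qed
    also have "\<dots> = (\<integral>\<^sup>+ x. ennreal (indicator B x * real_cond_exp \<nu> ?F (\<lambda>z. indicator (A i) (z i)) x) \<partial>\<nu>)"
    proof (rule nn_integral_cong_AE)
      have "AE x in \<nu>. measure (\<kappa> x) (A i) = real_cond_exp \<nu> ?F (\<lambda>z. indicator (A i) (z i)) x"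
        using \<kappa> Ai by (simp add: is_site_cond_distr_def)
      then show "AE x in \<nu>. ennreal (indicator B x * measure (\<kappa> x) (A i)) =
          ennreal (indicator B x * real_cond_exp \<nu> ?F (\<lambda>z. indicator (A i) (z i)) x)"
        by eventually_elim simp
    qed
    also have "\<dots> = ennreal (\<integral>x. indicator B x * real_cond_exp \<nu> ?F (\<lambda>z. indicator (A i) (z i)) x \<partial>\<nu>)"
    proof (rule nn_integral_eq_integral)
      show "integrable \<nu> (\<lambda>x. indicator B x * real_cond_exp \<nu> ?F (\<lambda>z. indicator (A i) (z i)) x)"
        using integrable_mult_indicator[OF Bm real_cond_exp_int(1)[OF intz]] by simp
      show "AE x in \<nu>. 0 \<le> indicator B x * real_cond_exp \<nu> ?F (\<lambda>z. indicator (A i) (z i)) x"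
        using real_cond_exp_pos[of "\<lambda>z. indicat_real (A i) (z i)"] inz by auto
    qed
    also have "(\<integral>x. indicator B x * real_cond_exp \<nu> ?F (\<lambda>z. indicator (A i) (z i)) x \<partial>\<nu>) =
        (\<integral>x. indicator B x * indicator (A i) (x i) \<partial>\<nu>)"
      using real_cond_exp_intA[OF intz BF] by (simp add: set_lebesgue_integral_def)
    also have "\<dots> = (\<integral>x. indicator (PiE T A) x \<partial>\<nu>)"
      using i by (intro Bochner_Integration.integral_cong refl)
        (auto simp: B_def sp space_PiM PiE_iff indicator_def)
    also have "\<dots> = measure \<nu> (PiE T A)" using PA by (simp add: s)
    finally show "emeasure (distr (semidirect \<nu> E \<kappa>) (\<Pi>\<^sub>M j\<in>T. E) ?u) (PiE T A) = emeasure \<nu> (PiE T A)"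
      unfolding emeasure_eq_measure .
  qed
  have gen: "range (\<lambda>_::nat. PiE T (\<lambda>_. space E)) \<subseteq> prod_algebra T (\<lambda>_. E)"
    using prod_algebraI_finite[OF \<open>finite T\<close>, of "\<lambda>_. space E" "\<lambda>_. E"] by auto
  show ?thesis
  proof (rule measure_eqI_PiM_finite[OF \<open>finite T\<close> _ s eq gen])
    show "emeasure (distr (semidirect \<nu> E \<kappa>) (\<Pi>\<^sub>M j\<in>T. E) ?u) (PiE T (\<lambda>_. space E)) \<noteq> \<infinity>" for n :: nat
      by (subst eq) auto
  qed (auto simp: space_PiM)
qed

section \<open>Averaged resampling of Lipschitz functions\<close>

text \<open>The two kinds of spaces enter through common metric axioms. Measurability of
  \<open>d\<close> stays outside because they supply it in different forms, for sections in one case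
  and jointly in the other. Nonemptiness of \<open>T\<close> permits averaging over sites.\<close>

locale dobrushin_uniqueness =
  fixes T :: "'i set" and E :: "'a measure" and d :: "'a \<Rightarrow> 'a \<Rightarrow> real"
    and \<mu> :: "('i \<Rightarrow> 'a) measure" and \<mu>c :: "'i \<Rightarrow> ('i \<Rightarrow> 'a) \<Rightarrow> 'a measure"
  assumes finite_T: "finite T" and T_nonempty: "T \<noteq> {}"
    and d_nonneg: "\<And>x y. x \<in> space E \<Longrightarrow> y \<in> space E \<Longrightarrow> 0 \<le> d x y"
    and d_refl: "\<And>x. x \<in> space E \<Longrightarrow> d x x = 0"
    and d_pos: "\<And>x y. x \<in> space E \<Longrightarrow> y \<in> space E \<Longrightarrow> x \<noteq> y \<Longrightarrow> 0 < d x y"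
    and d_sym: "\<And>x y. x \<in> space E \<Longrightarrow> y \<in> space E \<Longrightarrow> d x y = d y x"
    and d_tri: "\<And>x y z. x \<in> space E \<Longrightarrow> y \<in> space E \<Longrightarrow> z \<in> space E \<Longrightarrow> d x z \<le> d x y + d y z"
    and prob_\<mu>: "prob_space \<mu>" and sets_\<mu>: "sets \<mu> = sets (\<Pi>\<^sub>M i\<in>T. E)"
    and cond_\<mu>: "\<And>i. i \<in> T \<Longrightarrow> is_site_cond_distr T E \<mu> i (\<mu>c i)"
    and norm_less_1: "dobrushin_norm1 T E d \<mu>c < 1"
begin

abbreviation S where "S \<equiv> (\<Pi>\<^sub>M i\<in>T. E)"

text \<open>Passing to real numbers loses nothing for sites in \<open>T\<close>: the column sums are
  below 1, so every such entry is finite.\<close>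

definition c where "c i j = enn2real (dobrushin_coeff T E d \<mu>c i j)"

definition r where "r = enn2real (dobrushin_norm1 T E d \<mu>c)"

lemma r_less_1: "r < 1" and r_nonneg: "0 \<le> r" and ennreal_r: "ennreal r = dobrushin_norm1 T E d \<mu>c"
proof -
  show *: "ennreal r = dobrushin_norm1 T E d \<mu>c"
    unfolding r_def using norm_less_1 by (intro ennreal_enn2real) (auto elim: order.strict_trans)
  show "0 \<le> r" by (simp add: r_def)
  then show "r < 1" using norm_less_1 by (simp add: *[symmetric])
qed

lemma sum_coeff_le: "j \<in> T \<Longrightarrow> (\<Sum>i\<in>T. dobrushin_coeff T E d \<mu>c i j) \<le> ennreal r"
  unfolding ennreal_r dobrushin_norm1_def by (rule SUP_upper)

lemma ennreal_c:
  assumes "i \<in> T" "j \<in> T"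
  shows "ennreal (c i j) = dobrushin_coeff T E d \<mu>c i j"
proof -
  have "dobrushin_coeff T E d \<mu>c i j \<le> (\<Sum>i\<in>T. dobrushin_coeff T E d \<mu>c i j)"
    using assms finite_T by (intro member_le_sum) auto
  also have "\<dots> \<le> ennreal r" using assms by (intro sum_coeff_le)
  finally show ?thesis unfolding c_def by (intro ennreal_enn2real) (auto simp: le_less_trans)
qed

lemma c_nonneg: "0 \<le> c i j"
  by (simp add: c_def)

lemma sum_c_le: "j \<in> T \<Longrightarrow> (\<Sum>i\<in>T. c i j) \<le> r"
  using sum_coeff_le[of j] r_nonneg
  by (simp add: ennreal_c[symmetric] sum_ennreal c_nonneg sum_nonneg cong: sum.cong)

lemma \<mu>c_measurable[measurable]: "i \<in> T \<Longrightarrow> \<mu>c i \<in> S \<rightarrow>\<^sub>M prob_algebra E"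
  using cond_\<mu> by (simp add: is_site_cond_distr_def)

lemma \<mu>c_cong:
  assumes "i \<in> T" "x \<in> space S" "y \<in> space S" "\<forall>j\<in>T - {i}. x j = y j"
  shows "\<mu>c i x = \<mu>c i y"
  using cond_\<mu>[OF assms(1)] assms(2-) unfolding is_site_cond_distr_def by blast

lemma \<mu>c_space:
  assumes "i \<in> T" "x \<in> space S"
  shows "prob_space (\<mu>c i x)" "sets (\<mu>c i x) = sets E" "space (\<mu>c i x) = space E"
  using measurable_space[OF \<mu>c_measurable[OF assms(1)] assms(2)]
  by (auto simp: space_prob_algebra dest: sets_eq_imp_space_eq)

lemma wasserstein1_\<mu>c_le:
  assumes i: "i \<in> T" and j: "j \<in> T" and x: "x \<in> space S" and y: "y \<in> space S"
    and off: "\<forall>k\<in>T - {j}. x k = y k" and "x j \<noteq> y j"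
  shows "wasserstein1 d (\<mu>c i x) (\<mu>c i y) \<le> ennreal (c i j * d (x j) (y j))"
proof -
  have d: "0 < d (x j) (y j)" using j x y assms(6) by (intro d_pos) (auto simp: space_PiM)
  have "wasserstein1 d (\<mu>c i x) (\<mu>c i y) / ennreal (d (x j) (y j)) \<le> ennreal (c i j)"
    unfolding ennreal_c[OF i j] dobrushin_coeff_def
    by (rule SUP_upper2[of "(x, y)"]) (use assms in auto)
  then have "wasserstein1 d (\<mu>c i x) (\<mu>c i y) / ennreal (d (x j) (y j)) * ennreal (d (x j) (y j))
      \<le> ennreal (c i j) * ennreal (d (x j) (y j))"
    by (rule mult_right_mono) simp
  then show ?thesis
    using d by (simp add: ennreal_mult c_nonneg ennreal_divide_times ennreal_times_divide mult_divide_eq_ennreal)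
qed

lemma integral_\<mu>c_diff_le:
  assumes i: "i \<in> T" and j: "j \<in> T" and x: "x \<in> space S" and y: "y \<in> space S"
    and off: "\<forall>k\<in>T - {j}. x k = y k"
    and g: "g \<in> borel_measurable E" "\<And>u. u \<in> space E \<Longrightarrow> \<bar>g u\<bar> \<le> B"
    and L: "0 \<le> L" "\<And>u v. u \<in> space E \<Longrightarrow> v \<in> space E \<Longrightarrow> \<bar>g u - g v\<bar> \<le> L * d u v"
  shows "\<bar>(\<integral>u. g u \<partial>\<mu>c i x) - (\<integral>u. g u \<partial>\<mu>c i y)\<bar> \<le> L * c i j * d (x j) (y j)"
proof (cases "x j = y j")
  case True
  then have "x = y" using x y off by (intro PiE_ext) (auto simp: space_PiM)
  moreover have "d (x j) (x j) = 0" using x j by (intro d_refl) (auto simp: space_PiM)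
  ultimately show ?thesis by simp
next
  case False
  have dn: "0 \<le> d (x j) (y j)" using x y j by (intro d_nonneg) (auto simp: space_PiM)
  have "ennreal \<bar>(\<integral>u. g u \<partial>\<mu>c i x) - (\<integral>u. g u \<partial>\<mu>c i y)\<bar> \<le> ennreal L * wasserstein1 d (\<mu>c i x) (\<mu>c i y)"
    by (rule abs_integral_diff_le_wasserstein1[OF \<mu>c_space(1,2)[OF i x] \<mu>c_space(1,2)[OF i y] g L])
  also have "\<dots> \<le> ennreal L * ennreal (c i j * d (x j) (y j))"
    by (intro mult_left_mono wasserstein1_\<mu>c_le assms False) auto
  finally show ?thesis using L dn c_nonneg[of i j] by (simp add: ennreal_mult[symmetric] mult.assoc)
qed

lemma S_d_nonneg: "x \<in> space S \<Longrightarrow> y \<in> space S \<Longrightarrow> j \<in> T \<Longrightarrow> 0 \<le> d (x j) (y j)"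
  by (intro d_nonneg) (auto simp: space_PiM)

lemma site_update_in_space: "i \<in> T \<Longrightarrow> x \<in> space S \<Longrightarrow> u \<in> space E \<Longrightarrow> x(i := u) \<in> space S"
  by (auto simp: space_PiM PiE_iff extensional_def)

lemma measurable_site_section:
  assumes i: "i \<in> T" and x[measurable]: "x \<in> space S" and f[measurable]: "f \<in> borel_measurable S"
  shows "(\<lambda>u. f (x(i := u))) \<in> borel_measurable E"
proof -
  have "(\<lambda>u. (fst (x, u))(i := snd (x, u))) \<in> E \<rightarrow>\<^sub>M S"
    by (rule measurable_compose[OF _ measurable_site_update[OF i]]) measurable
  then show ?thesis by simp
qed

text \<open>Telescoping over coordinates makes this the Lipschitz condition for
  \<open>l1_metric\<close>. The coordinatewise form is the one on which the interdependence
  coefficients act.\<close>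

definition coord_lipschitz :: "real \<Rightarrow> (('i \<Rightarrow> 'a) \<Rightarrow> real) \<Rightarrow> bool" where
  "coord_lipschitz L f \<longleftrightarrow> (\<forall>j\<in>T. \<forall>x\<in>space S. \<forall>y\<in>space S.
     (\<forall>k\<in>T - {j}. x k = y k) \<longrightarrow> \<bar>f x - f y\<bar> \<le> L * d (x j) (y j))"

text \<open>The heat-bath operator at site \<open>i\<close>, a version of the conditional
  expectation of \<open>f\<close> under \<open>\<mu>\<close> given the other coordinates.\<close>

definition resample :: "'i \<Rightarrow> (('i \<Rightarrow> 'a) \<Rightarrow> real) \<Rightarrow> ('i \<Rightarrow> 'a) \<Rightarrow> real" where
  "resample i f x = (\<integral>u. f (x(i := u)) \<partial>\<mu>c i x)"

context
  fixes f :: "('i \<Rightarrow> 'a) \<Rightarrow> real" and B :: real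
  assumes f[measurable]: "f \<in> borel_measurable S" and B: "\<And>x. x \<in> space S \<Longrightarrow> \<bar>f x\<bar> \<le> B"
begin

lemma site_integrable:
  assumes i: "i \<in> T" and x: "x \<in> space S" and y: "y \<in> space S"
  shows "integrable (\<mu>c i x) (\<lambda>u. f (y(i := u)))"
proof -
  interpret prob_space "\<mu>c i x" by (rule \<mu>c_space[OF i x])
  have "(\<lambda>u. f (y(i := u))) \<in> borel_measurable (\<mu>c i x)"
    using measurable_site_section[OF i y f] by (simp cong: measurable_cong_sets add: \<mu>c_space[OF i x])
  then show ?thesis
    by (intro integrable_const_bound[where B = B])
      (auto intro!: B site_update_in_space[OF i y] simp: \<mu>c_space[OF i x])
qed

lemma resample_bounded:
  assumes i: "i \<in> T" and x: "x \<in> space S"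
  shows "\<bar>resample i f x\<bar> \<le> B"
proof -
  interpret prob_space "\<mu>c i x" by (rule \<mu>c_space[OF i x])
  have "\<bar>resample i f x\<bar> \<le> (\<integral>u. \<bar>f (x(i := u))\<bar> \<partial>\<mu>c i x)"
    unfolding resample_def by (rule integral_abs_bound)
  also have "\<dots> \<le> (\<integral>u. B \<partial>\<mu>c i x)"
    using site_integrable[OF i x x]
    by (intro integral_mono) (auto intro!: B site_update_in_space[OF i x] simp: \<mu>c_space[OF i x])
  finally show ?thesis by (simp add: prob_space)
qed

lemma resample_measurable:
  assumes i: "i \<in> T"
  shows "resample i f \<in> borel_measurable S"
proof -
  have "(\<lambda>z. f ((fst z)(i := snd z))) \<in> borel_measurable (\<mu> \<Otimes>\<^sub>M E)"
    using measurable_compose[OF measurable_site_update[OF i] f]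
    by (simp cong: measurable_cong_sets sets_pair_measure_cong add: sets_\<mu>)
  moreover have "\<mu>c i \<in> \<mu> \<rightarrow>\<^sub>M prob_algebra E"
    using \<mu>c_measurable[OF i] by (simp add: measurable_cong_sets[OF sets_\<mu> refl])
  ultimately have "(\<lambda>x. \<integral>u. f ((fst (x, u))(i := snd (x, u))) \<partial>\<mu>c i x) \<in> borel_measurable \<mu>"
    by (intro integral_kernel_measurable[OF prob_\<mu>])
  then show ?thesis by (simp add: resample_def[abs_def] measurable_cong_sets[OF sets_\<mu> refl])
qed

lemma integral_resample:
  assumes i: "i \<in> T" and \<nu>: "prob_space \<nu>" and s[measurable_cong]: "sets \<nu> = sets S" and \<kappa>: "is_site_cond_distr T E \<nu> i \<kappa>"
  shows "(\<integral>x. \<integral>u. f (x(i := u)) \<partial>\<kappa> x \<partial>\<nu>) = (\<integral>x. f x \<partial>\<nu>)"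
proof -
  have sp: "space \<nu> = space S" using s by (rule sets_eq_imp_space_eq)
  have \<kappa>m: "\<kappa> \<in> \<nu> \<rightarrow>\<^sub>M prob_algebra E"
    using \<kappa> by (simp add: is_site_cond_distr_def measurable_cong_sets[OF s refl])
  have um: "(\<lambda>z. (fst z)(i := snd z)) \<in> \<nu> \<Otimes>\<^sub>M E \<rightarrow>\<^sub>M S"
    using measurable_site_update[OF i] by (simp cong: measurable_cong_sets sets_pair_measure_cong add: s)
  have "(\<integral>x. f x \<partial>\<nu>) = (\<integral>x. f x \<partial>distr (semidirect \<nu> E \<kappa>) S (\<lambda>z. (fst z)(i := snd z)))"
    by (simp only: resample_site[OF finite_T i \<nu> s \<kappa>])
  also have "\<dots> = (\<integral>z. f ((fst z)(i := snd z)) \<partial>semidirect \<nu> E \<kappa>)"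
    using um by (intro integral_distr) (auto simp: measurable_cong_sets[OF sets_semidirect[OF \<nu> \<kappa>m] refl])
  also have "\<dots> = (\<integral>x. \<integral>u. f ((fst (x, u))(i := snd (x, u))) \<partial>\<kappa> x \<partial>\<nu>)"
    using measurable_compose[OF um f]
    by (intro integral_semidirect[OF \<nu> \<kappa>m, where B = B]) (auto intro!: B site_update_in_space[OF i] simp: sp)
  finally show ?thesis by simp
qed

text \<open>A change at \<open>j\<close> acts in two ways: directly through the argument of
  \<open>f\<close>, with constant \<open>L\<close>, and through the kernel, with constant
  \<open>L * c i j\<close>. The direct effect is erased when \<open>i = j\<close>. The two are
  separated by inserting the integral of the function at \<open>y\<close> against the kernel at
  \<open>x\<close>.\<close>

lemma resample_lipschitz:
  assumes L: "0 \<le> L" "coord_lipschitz L f" and i: "i \<in> T" and j: "j \<in> T"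
    and x: "x \<in> space S" and y: "y \<in> space S" and off: "\<forall>k\<in>T - {j}. x k = y k"
  shows "\<bar>resample i f x - resample i f y\<bar> \<le> L * ((if i = j then 0 else 1) + c i j) * d (x j) (y j)"
proof (cases "i = j")
  case True
  have "\<mu>c i x = \<mu>c i y" using x y off i True by (intro \<mu>c_cong) auto
  moreover have "x(i := u) = y(i := u)" for u
  proof
    show "(x(i := u)) k = (y(i := u)) k" for k
      using x y off True by (cases "k \<in> T") (auto simp: space_PiM PiE_iff extensional_def)
  qed
  ultimately have "resample i f x = resample i f y" by (simp add: resample_def)
  moreover have "0 \<le> d (x j) (y j)" using x y j by (intro d_nonneg) (auto simp: space_PiM)
  ultimately show ?thesis using L c_nonneg by (simp add: True)
next
  case False
  interpret X: prob_space "\<mu>c i x" by (rule \<mu>c_space[OF i x])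
  have lip: "\<bar>f x - f y\<bar> \<le> L * d (x j) (y j)"
    if "j \<in> T" "x \<in> space S" "y \<in> space S" "\<forall>k\<in>T - {j}. x k = y k" for x y j
    using L(2) that unfolding coord_lipschitz_def by blast
  have "resample i f x - resample i f y = (\<integral>u. (f (x(i := u)) - f (y(i := u))) \<partial>\<mu>c i x) +
      ((\<integral>u. f (y(i := u)) \<partial>\<mu>c i x) - (\<integral>u. f (y(i := u)) \<partial>\<mu>c i y))"
    using site_integrable[OF i x x] site_integrable[OF i x y] by (simp add: resample_def)
  moreover have "\<bar>\<integral>u. (f (x(i := u)) - f (y(i := u))) \<partial>\<mu>c i x\<bar> \<le> L * d (x j) (y j)"
  proof -
    have "\<bar>\<integral>u. (f (x(i := u)) - f (y(i := u))) \<partial>\<mu>c i x\<bar> \<le> (\<integral>u. \<bar>f (x(i := u)) - f (y(i := u))\<bar> \<partial>\<mu>c i x)"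
      by (rule integral_abs_bound)
    also have "\<dots> \<le> (\<integral>u. L * d (x j) (y j) \<partial>\<mu>c i x)"
    proof (rule integral_mono)
      fix u assume "u \<in> space (\<mu>c i x)"
      then have "u \<in> space E" by (simp add: \<mu>c_space[OF i x])
      then show "\<bar>f (x(i := u)) - f (y(i := u))\<bar> \<le> L * d (x j) (y j)"
        using lip[OF j site_update_in_space[OF i x] site_update_in_space[OF i y], of u u] off False by auto
    qed (use site_integrable[OF i x x] site_integrable[OF i x y] in auto)
    finally show ?thesis by (simp add: X.prob_space)
  qed
  moreover have "\<bar>(\<integral>u. f (y(i := u)) \<partial>\<mu>c i x) - (\<integral>u. f (y(i := u)) \<partial>\<mu>c i y)\<bar> \<le> L * c i j * d (x j) (y j)"
  proof (rule integral_\<mu>c_diff_le[OF i j x y off measurable_site_section[OF i y f] _ L(1)])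
    show "\<bar>f (y(i := u))\<bar> \<le> B" if "u \<in> space E" for u by (rule B[OF site_update_in_space[OF i y that]])
    show "\<bar>f (y(i := u)) - f (y(i := v))\<bar> \<le> L * d u v" if "u \<in> space E" "v \<in> space E" for u v
      using lip[OF i site_update_in_space[OF i y that(1)] site_update_in_space[OF i y that(2)]] by simp
  qed
  ultimately show ?thesis using False by (simp add: algebra_simps)
qed

text \<open>The kernel of \<open>\<nu>\<close> preserves \<open>\<nu>\<close>, so the integral of
  \<open>f\<close> may be replaced by that of its resampling with the kernel of
  \<open>\<nu>\<close>. What remains is a pointwise comparison of two kernels at the same
  configuration.\<close>

lemma integral_resample_diff_le:
  assumes L: "0 \<le> L" "coord_lipschitz L f" and i: "i \<in> T" and \<nu>: "prob_space \<nu>" and s: "sets \<nu> = sets S"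
    and \<kappa>: "is_site_cond_distr T E \<nu> i \<kappa>"
  shows "ennreal \<bar>(\<integral>x. f x \<partial>\<nu>) - (\<integral>x. resample i f x \<partial>\<nu>)\<bar> \<le> ennreal L * (\<integral>\<^sup>+ x. wasserstein1 d (\<mu>c i x) (\<kappa> x) \<partial>\<nu>)"
proof -
  interpret prob_space \<nu> by fact
  note [measurable_cong] = s
  have sp: "space \<nu> = space S" using s by (rule sets_eq_imp_space_eq)
  have \<kappa>m: "\<kappa> \<in> \<nu> \<rightarrow>\<^sub>M prob_algebra E"
    using \<kappa> by (simp add: is_site_cond_distr_def measurable_cong_sets[OF s refl])
  have \<kappa>sp: "prob_space (\<kappa> x)" "sets (\<kappa> x) = sets E" "space (\<kappa> x) = space E" if "x \<in> space S" for x
    using kernel_in_prob_algebra[OF \<nu> \<kappa>m, of x] that by (auto simp: space_prob_algebra sp dest: sets_eq_imp_space_eq)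
  have um: "(\<lambda>z. (fst z)(i := snd z)) \<in> \<nu> \<Otimes>\<^sub>M E \<rightarrow>\<^sub>M S"
    using measurable_site_update[OF i] by (simp cong: measurable_cong_sets sets_pair_measure_cong add: s)
  define \<kappa>f where "\<kappa>f = (\<lambda>x. \<integral>u. f (x(i := u)) \<partial>\<kappa> x)"
  have \<kappa>fm[measurable]: "\<kappa>f \<in> borel_measurable \<nu>"
    using integral_kernel_measurable[OF \<nu> \<kappa>m measurable_compose[OF um f]] by (simp add: \<kappa>f_def)
  have rm[measurable]: "resample i f \<in> borel_measurable \<nu>"
    using resample_measurable[OF i] by (simp add: measurable_cong_sets[OF s refl])
  have \<kappa>fB: "\<bar>\<kappa>f x\<bar> \<le> B" if x: "x \<in> space S" for x
  proof -
    interpret K: prob_space "\<kappa> x" by (rule \<kappa>sp[OF x])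
    have "(\<lambda>u. f (x(i := u))) \<in> borel_measurable (\<kappa> x)"
      using measurable_site_section[OF i x f] by (simp cong: measurable_cong_sets add: \<kappa>sp[OF x])
    then have int: "integrable (\<kappa> x) (\<lambda>u. f (x(i := u)))"
      by (intro K.integrable_const_bound[where B = B]) (auto intro!: B site_update_in_space[OF i x] simp: \<kappa>sp[OF x])
    have "\<bar>\<kappa>f x\<bar> \<le> (\<integral>u. \<bar>f (x(i := u))\<bar> \<partial>\<kappa> x)"
      unfolding \<kappa>f_def by (rule integral_abs_bound)
    also have "\<dots> \<le> (\<integral>u. B \<partial>\<kappa> x)"
      using int by (intro integral_mono) (auto intro!: B site_update_in_space[OF i x] simp: \<kappa>sp[OF x])
    finally show ?thesis by (simp add: K.prob_space)
  qed
  have i1: "integrable \<nu> \<kappa>f" by (rule integrable_const_bound[where B = B]) (auto simp: sp \<kappa>fB)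
  have i2: "integrable \<nu> (resample i f)"
    by (rule integrable_const_bound[where B = B]) (auto simp: sp resample_bounded[OF i])
  have pw: "ennreal \<bar>\<kappa>f x - resample i f x\<bar> \<le> ennreal L * wasserstein1 d (\<mu>c i x) (\<kappa> x)" if x: "x \<in> space S" for x
  proof -
    have "ennreal \<bar>resample i f x - \<kappa>f x\<bar> \<le> ennreal L * wasserstein1 d (\<mu>c i x) (\<kappa> x)"
      unfolding \<kappa>f_def resample_def
    proof (rule abs_integral_diff_le_wasserstein1[OF \<mu>c_space(1,2)[OF i x] \<kappa>sp(1,2)[OF x] measurable_site_section[OF i x f] _ L(1)])
      show "\<bar>f (x(i := u))\<bar> \<le> B" if "u \<in> space E" for u by (rule B[OF site_update_in_space[OF i x that]])
      show "\<bar>f (x(i := u)) - f (x(i := v))\<bar> \<le> L * d u v" if "u \<in> space E" "v \<in> space E" for u v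
        using L(2)[unfolded coord_lipschitz_def, rule_format, OF i site_update_in_space[OF i x that(1)] site_update_in_space[OF i x that(2)]]
        by simp
    qed
    then show ?thesis by (simp add: abs_minus_commute)
  qed
  have "ennreal \<bar>(\<integral>x. f x \<partial>\<nu>) - (\<integral>x. resample i f x \<partial>\<nu>)\<bar> = ennreal \<bar>\<integral>x. (\<kappa>f x - resample i f x) \<partial>\<nu>\<bar>"
    using integral_resample[OF i \<nu> s \<kappa>] by (simp add: i1 i2 \<kappa>f_def[symmetric])
  also have "\<dots> \<le> ennreal (\<integral>x. \<bar>\<kappa>f x - resample i f x\<bar> \<partial>\<nu>)"
    by (intro ennreal_leI integral_abs_bound)
  also have "\<dots> = (\<integral>\<^sup>+ x. ennreal \<bar>\<kappa>f x - resample i f x\<bar> \<partial>\<nu>)"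
    using i1 i2 by (intro nn_integral_eq_integral[symmetric]) auto
  also have "\<dots> \<le> ennreal L * (\<integral>\<^sup>+ x. wasserstein1 d (\<mu>c i x) (\<kappa> x) \<partial>\<nu>)"
  proof (cases "L = 0")
    case True
    then have "(\<integral>\<^sup>+ x. ennreal \<bar>\<kappa>f x - resample i f x\<bar> \<partial>\<nu>) = (\<integral>\<^sup>+ x. 0 \<partial>\<nu>)"
      using pw by (intro nn_integral_cong) (auto simp: sp)
    then show ?thesis by simp
  next
    case False
    with L have "0 < L" by simp
    \<comment> \<open>The integrand need not be measurable, so the factor \<open>L\<close> is moved to the other side.\<close>
    have "(\<integral>\<^sup>+ x. ennreal \<bar>\<kappa>f x - resample i f x\<bar> \<partial>\<nu>) =
        (\<integral>\<^sup>+ x. ennreal L * (ennreal (1 / L) * ennreal \<bar>\<kappa>f x - resample i f x\<bar>) \<partial>\<nu>)"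
      using \<open>0 < L\<close> by (intro nn_integral_cong) (simp add: ennreal_mult'[symmetric])
    also have "\<dots> = ennreal L * (\<integral>\<^sup>+ x. ennreal (1 / L) * ennreal \<bar>\<kappa>f x - resample i f x\<bar> \<partial>\<nu>)"
      by (rule nn_integral_cmult) measurable
    also have "\<dots> \<le> ennreal L * (\<integral>\<^sup>+ x. wasserstein1 d (\<mu>c i x) (\<kappa> x) \<partial>\<nu>)"
    proof (intro mult_left_mono nn_integral_mono)
      fix x assume "x \<in> space \<nu>"
      then have "ennreal (1 / L) * ennreal \<bar>\<kappa>f x - resample i f x\<bar> \<le> ennreal (1 / L) * (ennreal L * wasserstein1 d (\<mu>c i x) (\<kappa> x))"
        by (intro mult_left_mono pw) (auto simp: sp)
      also have "\<dots> = ennreal (1 / L * L) * wasserstein1 d (\<mu>c i x) (\<kappa> x)"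
        using \<open>0 < L\<close> by (subst ennreal_mult) (simp_all add: mult.assoc)
      finally show "ennreal (1 / L) * ennreal \<bar>\<kappa>f x - resample i f x\<bar> \<le> wasserstein1 d (\<mu>c i x) (\<kappa> x)"
        using \<open>0 < L\<close> by simp
    qed simp
    finally show ?thesis .
  qed
  finally show ?thesis .
qed

end

end

section \<open>Contraction and iteration of the averaged resampling operator\<close>

context dobrushin_uniqueness
begin

definition gibbs_average :: "(('i \<Rightarrow> 'a) \<Rightarrow> real) \<Rightarrow> ('i \<Rightarrow> 'a) \<Rightarrow> real" where
  "gibbs_average f x = (\<Sum>i\<in>T. resample i f x) / card T"

definition q where "q = 1 - (1 - r) / card T"

lemma card_T: "0 < card T"
  using finite_T T_nonempty by (simp add: card_gt_0_iff)

lemma q_nonneg: "0 \<le> q" and q_less_1: "q < 1"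
proof -
  have "1 - r \<le> real (card T)" using card_T r_nonneg by linarith
  then show "0 \<le> q" using card_T by (simp add: q_def divide_simps)
  show "q < 1" using card_T r_less_1 by (simp add: q_def)
qed

context
  fixes f :: "('i \<Rightarrow> 'a) \<Rightarrow> real" and B :: real
  assumes f: "f \<in> borel_measurable S" and B: "\<And>x. x \<in> space S \<Longrightarrow> \<bar>f x\<bar> \<le> B"
begin

lemma gibbs_average_measurable: "gibbs_average f \<in> borel_measurable S"
  unfolding gibbs_average_def[abs_def]
  by (intro borel_measurable_divide borel_measurable_sum resample_measurable[OF f B]) auto

lemma gibbs_average_bounded:
  assumes "x \<in> space S"
  shows "\<bar>gibbs_average f x\<bar> \<le> B"
proof -
  have "\<bar>\<Sum>i\<in>T. resample i f x\<bar> \<le> (\<Sum>i\<in>T. \<bar>resample i f x\<bar>)" by (rule sum_abs)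
  also have "\<dots> \<le> (\<Sum>i\<in>T. B)" using assms by (intro sum_mono resample_bounded[OF f B])
  finally show ?thesis using card_T by (simp add: gibbs_average_def abs_divide field_simps)
qed

text \<open>For a change at \<open>j\<close>, all resampled sites but \<open>j\<close> itself keep
  the direct effect, and the kernel effects add up to a column sum. Hence the factor is
  \<open>(card T - 1 + r) / card T\<close>, which is \<open>q\<close>.\<close>

lemma gibbs_average_lipschitz:
  assumes L: "0 \<le> L" "coord_lipschitz L f"
  shows "coord_lipschitz (q * L) (gibbs_average f)"
  unfolding coord_lipschitz_def
proof (intro ballI impI)
  fix j x y assume j: "j \<in> T" and x: "x \<in> space S" and y: "y \<in> space S" and off: "\<forall>k\<in>T - {j}. x k = y k"
  let ?D = "d (x j) (y j)"
  have "\<bar>gibbs_average f x - gibbs_average f y\<bar> = \<bar>\<Sum>i\<in>T. (resample i f x - resample i f y)\<bar> / card T"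
    by (simp add: gibbs_average_def sum_subtractf flip: diff_divide_distrib)
  also have "\<dots> \<le> (\<Sum>i\<in>T. L * ((if i = j then 0 else 1) + c i j) * ?D) / card T"
    by (intro divide_right_mono order_trans[OF sum_abs] sum_mono resample_lipschitz[OF f B L] j x y off) auto
  also have "(\<Sum>i\<in>T. L * ((if i = j then 0 else 1) + c i j) * ?D) =
      L * ?D * ((\<Sum>i\<in>T. if i = j then 0 else 1) + (\<Sum>i\<in>T. c i j))"
    by (simp add: sum_distrib_left sum.distrib algebra_simps)
  also have "(\<Sum>i\<in>T. if i = j then 0 else 1) = real (card T) - 1"
  proof -
    have "(\<Sum>i\<in>T. if i = j then 0 else 1 :: real) = (\<Sum>i\<in>T - {j}. 1)"
      using finite_T by (intro sum.mono_neutral_cong_right) auto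
    then show ?thesis using j finite_T card_T by (simp add: card_Diff_singleton of_nat_diff Suc_leI)
  qed
  also have "L * ?D * (real (card T) - 1 + (\<Sum>i\<in>T. c i j)) / card T \<le> L * ?D * (real (card T) - 1 + r) / card T"
    using sum_c_le[OF j] L(1) S_d_nonneg[OF x y j] by (intro divide_right_mono mult_left_mono) auto
  also have "\<dots> = q * L * ?D"
    using card_T by (simp add: q_def field_simps)
  finally show "\<bar>gibbs_average f x - gibbs_average f y\<bar> \<le> q * L * ?D" .
qed

lemma integral_gibbs_average:
  assumes "\<And>i. i \<in> T \<Longrightarrow> integrable \<nu> (resample i f)"
  shows "(\<integral>x. gibbs_average f x \<partial>\<nu>) = (\<Sum>i\<in>T. \<integral>x. resample i f x \<partial>\<nu>) / card T"
  unfolding gibbs_average_def using assms by (simp add: Bochner_Integration.integral_sum)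

lemma integrable_resample:
  assumes "prob_space \<nu>" "sets \<nu> = sets S" "i \<in> T"
  shows "integrable \<nu> (resample i f)"
proof -
  interpret prob_space \<nu> by fact
  have "space \<nu> = space S" using assms(2) by (rule sets_eq_imp_space_eq)
  then show ?thesis
    using resample_measurable[OF f B \<open>i \<in> T\<close>] resample_bounded[OF f B \<open>i \<in> T\<close>]
    by (intro integrable_const_bound[where B = B]) (auto simp: measurable_cong_sets[OF assms(2) refl])
qed

lemma integral_gibbs_average_\<mu>: "(\<integral>x. gibbs_average f x \<partial>\<mu>) = (\<integral>x. f x \<partial>\<mu>)"
proof -
  have "(\<integral>x. resample i f x \<partial>\<mu>) = (\<integral>x. f x \<partial>\<mu>)" if "i \<in> T" for i
    unfolding resample_def by (rule integral_resample[OF f B that prob_\<mu> sets_\<mu> cond_\<mu>[OF that]])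
  then show ?thesis
    using card_T by (subst integral_gibbs_average) (auto intro!: integrable_resample prob_\<mu> sets_\<mu>)
qed

end

context
  fixes \<nu> :: "('i \<Rightarrow> 'a) measure" and \<nu>c :: "'i \<Rightarrow> ('i \<Rightarrow> 'a) \<Rightarrow> 'a measure" and a :: real
  assumes \<nu>: "prob_space \<nu>" and sets_\<nu>: "sets \<nu> = sets S"
    and cond_\<nu>: "\<And>i. i \<in> T \<Longrightarrow> is_site_cond_distr T E \<nu> i (\<nu>c i)"
    and a: "0 \<le> a" "(\<Sum>j\<in>T. \<integral>\<^sup>+ x. wasserstein1 d (\<mu>c j x) (\<nu>c j x) \<partial>\<nu>) = ennreal a"
begin

lemma integral_gibbs_average_diff_le:
  assumes f: "f \<in> borel_measurable S" and B: "\<And>x. x \<in> space S \<Longrightarrow> \<bar>f x\<bar> \<le> B"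
    and L: "0 \<le> L" "coord_lipschitz L f"
  shows "\<bar>(\<integral>x. f x \<partial>\<nu>) - (\<integral>x. gibbs_average f x \<partial>\<nu>)\<bar> \<le> L * a / card T"
proof -
  let ?D = "\<lambda>i. \<bar>(\<integral>x. f x \<partial>\<nu>) - (\<integral>x. resample i f x \<partial>\<nu>)\<bar>"
  have "ennreal (\<Sum>i\<in>T. ?D i) = (\<Sum>i\<in>T. ennreal (?D i))" by (simp add: sum_ennreal)
  also have "\<dots> \<le> (\<Sum>i\<in>T. ennreal L * (\<integral>\<^sup>+ x. wasserstein1 d (\<mu>c i x) (\<nu>c i x) \<partial>\<nu>))"
    by (intro sum_mono integral_resample_diff_le[OF f B L] \<nu> sets_\<nu> cond_\<nu>)
  also have "\<dots> = ennreal (L * a)"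
    using a L by (simp add: ennreal_mult flip: sum_distrib_left)
  finally have D: "(\<Sum>i\<in>T. ?D i) \<le> L * a" using a L by simp
  have "(\<integral>x. gibbs_average f x \<partial>\<nu>) = (\<Sum>i\<in>T. \<integral>x. resample i f x \<partial>\<nu>) / card T"
    by (intro integral_gibbs_average[OF f B] integrable_resample[OF f B \<nu> sets_\<nu>])
  then have "(\<integral>x. f x \<partial>\<nu>) - (\<integral>x. gibbs_average f x \<partial>\<nu>) =
      (\<Sum>i\<in>T. (\<integral>x. f x \<partial>\<nu>) - (\<integral>x. resample i f x \<partial>\<nu>)) / card T"
    using card_T by (simp add: sum_subtractf diff_divide_distrib)
  also have "\<bar>\<dots>\<bar> \<le> (\<Sum>i\<in>T. ?D i) / card T"
    using sum_abs[of "\<lambda>i. (\<integral>x. f x \<partial>\<nu>) - (\<integral>x. resample i f x \<partial>\<nu>)" T]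
    by (simp add: abs_divide divide_right_mono)
  also have "\<dots> \<le> L * a / card T" using D by (intro divide_right_mono) auto
  finally show ?thesis .
qed

text \<open>Iteration leaves the integral under \<open>\<mu>\<close> fixed and moves the one under
  \<open>\<nu>\<close> by a geometric series in total. In the limit the iterates are constant in the
  configuration, so both measures assign them the same integral.\<close>

lemma integral_diff_le:
  assumes f: "f \<in> borel_measurable S" and B: "\<And>x. x \<in> space S \<Longrightarrow> \<bar>f x\<bar> \<le> B"
    and lip: "coord_lipschitz 1 f"
  shows "(\<integral>x. f x \<partial>\<mu>) - (\<integral>x. f x \<partial>\<nu>) \<le> a / (1 - r)"
proof -
  interpret \<mu>: prob_space \<mu> by (rule prob_\<mu>)
  interpret \<nu>: prob_space \<nu> by (rule \<nu>)
  have sp: "space \<mu> = space S" "space \<nu> = space S"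
    using sets_\<mu> sets_\<nu> by (auto dest: sets_eq_imp_space_eq)
  define F where "F = (\<lambda>n. (gibbs_average ^^ n) f)"
  have F0: "F 0 = f" and FS: "F (Suc n) = gibbs_average (F n)" for n by (auto simp: F_def)
  have F: "F n \<in> borel_measurable S \<and> (\<forall>x\<in>space S. \<bar>F n x\<bar> \<le> B) \<and> coord_lipschitz (q ^ n) (F n)" for n
  proof (induction n)
    case 0
    then show ?case using f B lip by (simp add: F0)
  next
    case (Suc n)
    then show ?case
      using gibbs_average_measurable[of "F n" B] gibbs_average_bounded[of "F n" B]
        gibbs_average_lipschitz[of "F n" B "q ^ n"] q_nonneg by (simp add: FS)
  qed
  have F\<mu>: "(\<integral>x. F n x \<partial>\<mu>) = (\<integral>x. f x \<partial>\<mu>)" for n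
  proof (induction n)
    case (Suc n)
    then show ?case using integral_gibbs_average_\<mu>[of "F n" B] F[of n] by (simp add: FS)
  qed (simp add: F0)
  have F\<nu>: "\<bar>(\<integral>x. f x \<partial>\<nu>) - (\<integral>x. F n x \<partial>\<nu>)\<bar> \<le> (\<Sum>k<n. q ^ k) * (a / card T)" for n
  proof (induction n)
    case (Suc n)
    have "\<bar>(\<integral>x. F n x \<partial>\<nu>) - (\<integral>x. F (Suc n) x \<partial>\<nu>)\<bar> \<le> q ^ n * a / card T"
      unfolding FS using F[of n] q_nonneg by (intro integral_gibbs_average_diff_le[where B = B]) auto
    moreover have "(\<Sum>k<Suc n. q ^ k) * (a / card T) = (\<Sum>k<n. q ^ k) * (a / card T) + q ^ n * a / card T"
      by (simp add: distrib_right add_divide_distrib)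
    ultimately show ?case using Suc by linarith
  qed (simp add: F0)
  have geom: "(\<Sum>k<n. q ^ k) * (a / card T) \<le> a / (1 - r)" for n
  proof -
    have "(\<Sum>k<n. q ^ k) = (1 - q ^ n) / (1 - q)" using q_less_1 by (simp add: sum_gp_strict)
    also have "\<dots> \<le> 1 / (1 - q)" using q_nonneg q_less_1 by (intro divide_right_mono) auto
    \<comment> \<open>The factor \<open>card T\<close> cancels against the cost
      \<open>a / card T\<close> of a single step.\<close>
    also have "\<dots> = card T / (1 - r)" by (simp add: q_def)
    finally have "(\<Sum>k<n. q ^ k) * (a / card T) \<le> card T / (1 - r) * (a / card T)"
      using a by (intro mult_right_mono) auto
    then show ?thesis using card_T by simp
  qed
  obtain x0 where x0: "x0 \<in> space S" using \<mu>.not_empty unfolding sp by blast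
  \<comment> \<open>Convergence is only pointwise, as the distance to \<open>x0\<close> may be
    unbounded; the uniform bound \<open>B\<close> on the iterates permits dominated
    convergence.\<close>
  have lim: "(\<lambda>n. F n x - F n x0) \<longlonglongrightarrow> 0" if x: "x \<in> space S" for x
  proof (rule Lim_null_comparison)
    show "(\<lambda>n. q ^ n * (\<Sum>j\<in>T. d (x j) (x0 j))) \<longlonglongrightarrow> 0"
      using q_nonneg q_less_1 by (intro tendsto_mult_left_zero LIMSEQ_realpow_zero)
    have "\<bar>F n x - F n x0\<bar> \<le> (\<Sum>j\<in>T. q ^ n * d (x j) (x0 j))" for n
      using x x0 F[of n] unfolding space_PiM coord_lipschitz_def
      by (intro abs_diff_le_sum_of_coordinate_bounds[where X = "\<lambda>_. space E"] finite_T) auto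
    then show "\<forall>\<^sub>F n in sequentially. norm (F n x - F n x0) \<le> q ^ n * (\<Sum>j\<in>T. d (x j) (x0 j))"
      by (simp add: sum_distrib_left)
  qed
  have int_lim: "(\<lambda>n. (\<integral>x. F n x \<partial>P) - F n x0) \<longlonglongrightarrow> 0" if "prob_space P" "sets P = sets S" for P
  proof -
    interpret P: prob_space P by fact
    have spP: "space P = space S" using that(2) by (rule sets_eq_imp_space_eq)
    have Fm[measurable]: "F n \<in> borel_measurable P" for n using F[of n] by (simp add: measurable_cong_sets[OF that(2) refl])
    have intF: "integrable P (F n)" for n
      using F[of n] Fm by (intro P.integrable_const_bound[where B = B]) (auto simp: spP)
    have "(\<lambda>n. \<integral>x. (F n x - F n x0) \<partial>P) \<longlonglongrightarrow> (\<integral>x. 0 \<partial>P)"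
    proof (rule integral_dominated_convergence[where w = "\<lambda>_. 2 * B"])
      show "AE x in P. norm (F n x - F n x0) \<le> 2 * B" for n
      proof (rule AE_I2)
        fix x assume "x \<in> space P"
        then have "\<bar>F n x\<bar> \<le> B" "\<bar>F n x0\<bar> \<le> B" using F[of n] x0 by (auto simp: spP)
        then show "norm (F n x - F n x0) \<le> 2 * B" by simp
      qed
    qed (auto simp: Fm spP lim)
    then show ?thesis using intF by (simp add: P.prob_space)
  qed
  have "(\<lambda>n. ((\<integral>x. F n x \<partial>\<mu>) - F n x0) - ((\<integral>x. F n x \<partial>\<nu>) - F n x0)) \<longlonglongrightarrow> 0 - 0"
    by (intro tendsto_diff int_lim prob_\<mu> sets_\<mu> \<nu> sets_\<nu>)
  then have "(\<lambda>n. a / (1 - r) + ((\<integral>x. F n x \<partial>\<mu>) - (\<integral>x. F n x \<partial>\<nu>))) \<longlonglongrightarrow> a / (1 - r) + 0"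
    by (intro tendsto_add tendsto_const) simp
  moreover have "(\<integral>x. f x \<partial>\<mu>) - (\<integral>x. f x \<partial>\<nu>) \<le> a / (1 - r) + ((\<integral>x. F n x \<partial>\<mu>) - (\<integral>x. F n x \<partial>\<nu>))" for n
    using F\<nu>[of n] geom[of n] by (simp add: F\<mu> abs_le_iff)
  ultimately show ?thesis
    using LIMSEQ_le_const by fastforce
qed

lemma wasserstein1_le_of_separable:
  assumes C: "countable C" "C \<subseteq> space E" "\<And>x e. x \<in> space E \<Longrightarrow> 0 < e \<Longrightarrow> \<exists>b\<in>C. d b x < e"
    and meas: "\<And>b. b \<in> space E \<Longrightarrow> d b \<in> borel_measurable E"
  shows "wasserstein1 (l1_metric T d) \<mu> \<nu> \<le> ennreal (a / (1 - r))"
proof (rule kantorovich_separable[where C = "PiE T (\<lambda>_. C)"])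
  have sp: "space \<mu> = space S" "space \<nu> = space S"
    using sets_\<mu> sets_\<nu> by (auto dest: sets_eq_imp_space_eq)
  have in_E: "x j \<in> space E" if "x \<in> space \<mu>" "j \<in> T" for x j
    using that by (auto simp: sp space_PiM)
  show "prob_space \<mu>" "prob_space \<nu>" by (fact prob_\<mu> \<nu>)+
  show "sets \<nu> = sets \<mu>" by (simp add: sets_\<mu> sets_\<nu>)
  show "0 \<le> l1_metric T d x y" if "x \<in> space \<mu>" "y \<in> space \<mu>" for x y
    unfolding l1_metric_def using that by (intro sum_nonneg d_nonneg in_E)
  show "l1_metric T d x x = 0" if "x \<in> space \<mu>" for x
    unfolding l1_metric_def using that by (intro sum.neutral ballI d_refl in_E)
  show "l1_metric T d x y = l1_metric T d y x" if "x \<in> space \<mu>" "y \<in> space \<mu>" for x y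
    unfolding l1_metric_def using that by (intro sum.cong refl d_sym in_E)
  show "l1_metric T d x z \<le> l1_metric T d x y + l1_metric T d y z"
    if "x \<in> space \<mu>" "y \<in> space \<mu>" "z \<in> space \<mu>" for x y z
    unfolding l1_metric_def sum.distrib[symmetric] using that by (intro sum_mono d_tri in_E)
  show "l1_metric T d b \<in> borel_measurable \<mu>" if "b \<in> space \<mu>" for b
  proof -
    have "(\<lambda>x. d (b j) (x j)) \<in> borel_measurable S" if j: "j \<in> T" for j
      using measurable_component_singleton[OF j, of "\<lambda>_. E"] meas[OF in_E[OF \<open>b \<in> space \<mu>\<close> j]]
      by (rule measurable_compose)
    then have "(\<lambda>x. \<Sum>j\<in>T. d (b j) (x j)) \<in> borel_measurable S"
      by (rule borel_measurable_sum)
    then show ?thesis by (simp add: l1_metric_def[abs_def] measurable_cong_sets[OF sets_\<mu> refl])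
  qed
  show "countable (PiE T (\<lambda>_. C))" using C finite_T by (intro countable_PiE) auto
  show "PiE T (\<lambda>_. C) \<subseteq> space \<mu>" using C by (auto simp: sp space_PiM PiE_iff)
  show "\<exists>b\<in>PiE T (\<lambda>_. C). l1_metric T d b x < e" if x: "x \<in> space \<mu>" and e: "0 < e" for x e
  proof -
    have "\<forall>j\<in>T. \<exists>b\<in>C. d b (x j) < e / card T"
      using C(3) in_E[OF x] e card_T by auto
    then obtain b where b: "\<And>j. j \<in> T \<Longrightarrow> b j \<in> C" "\<And>j. j \<in> T \<Longrightarrow> d (b j) (x j) < e / card T"
      by metis
    have "(\<Sum>j\<in>T. d (b j) (x j)) < (\<Sum>j\<in>T. e / card T)"
      using finite_T T_nonempty b by (intro sum_strict_mono) auto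
    then have "l1_metric T d (restrict b T) x < e" using card_T by (simp add: l1_metric_def)
    then show ?thesis using b by (intro bexI[of _ "restrict b T"]) auto
  qed
  show "(\<integral>x. f x \<partial>\<mu>) - (\<integral>x. f x \<partial>\<nu>) \<le> a / (1 - r)"
    if f: "f \<in> borel_measurable \<mu>" and B: "\<And>x. x \<in> space \<mu> \<Longrightarrow> \<bar>f x\<bar> \<le> B"
      and lip: "\<And>x y. x \<in> space \<mu> \<Longrightarrow> y \<in> space \<mu> \<Longrightarrow> f x - f y \<le> l1_metric T d x y" for f B
  proof (rule integral_diff_le[where B = B])
    show "f \<in> borel_measurable S" using f by (simp add: measurable_cong_sets[OF sets_\<mu> refl])
    show "\<bar>f x\<bar> \<le> B" if "x \<in> space S" for x using B that by (simp add: sp)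
    show "coord_lipschitz 1 f"
      unfolding coord_lipschitz_def
    proof (intro ballI impI)
      fix j x y assume j: "j \<in> T" and x: "x \<in> space S" and y: "y \<in> space S" and off: "\<forall>k\<in>T - {j}. x k = y k"
      have "l1_metric T d x y = d (x j) (y j) + (\<Sum>k\<in>T - {j}. d (x k) (y k))"
        unfolding l1_metric_def using finite_T j by (rule sum.remove)
      also have "(\<Sum>k\<in>T - {j}. d (x k) (y k)) = 0"
        using off y by (intro sum.neutral ballI) (auto intro!: d_refl in_E simp: sp)
      finally have *: "l1_metric T d x y = d (x j) (y j)" by simp
      have "l1_metric T d y x = d (x j) (y j)"
        using * x y unfolding l1_metric_def by (subst sum.cong[OF refl d_sym]) (auto intro!: in_E simp: sp)
      then show "\<bar>f x - f y\<bar> \<le> 1 * d (x j) (y j)"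
        using * lip[of x y] lip[of y x] x y by (simp add: sp abs_le_iff)
    qed
  qed
qed

end

end

section \<open>Maximal couplings of kernels\<close>

text \<open>The functions \<open>h\<close> and \<open>k\<close> are the fractions of mass of \<open>P\<close> and \<open>Q\<close> lying outside their common part.\<close>

lemma common_part:
  assumes P: "prob_space P" and Q: "prob_space Q" and sQ[measurable_cong]: "sets Q = sets P"
  obtains h k :: "'z \<Rightarrow> real" and D where
    "h \<in> borel_measurable P" "k \<in> borel_measurable P"
    "\<And>z. 0 \<le> h z" "\<And>z. h z \<le> 1" "\<And>z. 0 \<le> k z" "\<And>z. k z \<le> 1"
    "density P (\<lambda>z. ennreal (1 - h z)) = density Q (\<lambda>z. ennreal (1 - k z))"
    "D \<in> sets P" "(\<integral>\<^sup>+ z. ennreal (h z) \<partial>P) + emeasure Q D = emeasure P D"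
proof -
  interpret P: prob_space P by fact
  interpret Q: prob_space Q by fact
  have spQ: "space Q = space P" using sQ by (rule sets_eq_imp_space_eq)
  \<comment> \<open>The sum of the two measures dominates both, so their common part can be
    expressed by the pointwise minimum of two densities.\<close>
  define R where "R = measure_of (space P) (sets P) (\<lambda>A. emeasure P A + emeasure Q A)"
  have sR[measurable_cong]: "sets R = sets P" and spR: "space R = space P" by (simp_all add: R_def)
  have eR: "emeasure R A = emeasure P A + emeasure Q A" if "A \<in> sets P" for A
    unfolding R_def
  proof (rule emeasure_measure_of_sigma[OF sets.sigma_algebra_axioms _ _ that])
    show "countably_additive (sets P) (\<lambda>A. emeasure P A + emeasure Q A)"
    proof (rule countably_additiveI)
      fix A :: "nat \<Rightarrow> 'z set"
      assume "range A \<subseteq> sets P" "disjoint_family A"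
      then show "(\<Sum>i. emeasure P (A i) + emeasure Q (A i)) = emeasure P (\<Union> (range A)) + emeasure Q (\<Union> (range A))"
        by (subst suminf_add[symmetric]) (auto simp: suminf_emeasure sQ)
    qed
  qed (simp add: positive_def)
  have finR: "finite_measure R"
    by standard (simp add: spR eR P.emeasure_space_1 Q.emeasure_space_1[unfolded spQ])
  interpret R: finite_measure R by fact
  have acs: "\<exists>f\<in>borel_measurable R. (\<forall>z. 0 \<le> (f z :: real)) \<and> density R (\<lambda>z. ennreal (f z)) = N"
    if N: "prob_space N" "sets N = sets P" and le: "\<And>A. A \<in> sets P \<Longrightarrow> emeasure N A \<le> emeasure R A" for N
  proof -
    interpret N: prob_space N by fact
    have "absolutely_continuous R N"
      using le N sR by (fastforce simp: absolutely_continuous_def null_sets_def)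
    then obtain f where f[measurable]: "f \<in> borel_measurable R" and fN: "density R f = N"
      using R.Radon_Nikodym N sR by auto
    have "space N = space R" using sets_eq_imp_space_eq[OF N(2)] by (simp add: spR)
    then have "emeasure N (space N) = emeasure (density R f) (space R)" by (simp add: fN)
    also have "\<dots> = (\<integral>\<^sup>+ z. f z \<partial>R)"
      by (subst emeasure_density) (auto intro!: nn_integral_cong)
    finally have "(\<integral>\<^sup>+ z. f z \<partial>R) = emeasure N (space N)" ..
    then have "(\<integral>\<^sup>+ z. f z \<partial>R) \<noteq> \<infinity>" by (simp add: N.emeasure_space_1)
    then have "AE z in R. f z \<noteq> \<infinity>" by (intro nn_integral_PInf_AE) auto
    then have "AE z in R. ennreal (enn2real (f z)) = f z"
      by eventually_elim (simp add: less_top)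
    then have "density R (\<lambda>z. ennreal (enn2real (f z))) = N"
      unfolding fN[symmetric] by (intro density_cong) auto
    then show ?thesis by (intro bexI[of _ "\<lambda>z. enn2real (f z)"]) auto
  qed
  obtain f where f[measurable]: "f \<in> borel_measurable R" and f0: "\<And>z. 0 \<le> f z" and fP: "density R (\<lambda>z. ennreal (f z)) = P"
    using acs[OF P] by (auto simp: eR)
  obtain g where g[measurable]: "g \<in> borel_measurable R" and g0: "\<And>z. 0 \<le> g z" and gQ: "density R (\<lambda>z. ennreal (g z)) = Q"
    using acs[OF Q sQ] by (auto simp: eR)
  \<comment> \<open>The density \<open>f * (1 - h)\<close> equals the minimum of \<open>f\<close>
    and \<open>g\<close>. Where \<open>f = 0\<close> the numerator is 0 as well, so the value 0 of
    the quotient is the right one.\<close>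
  define h where "h = (\<lambda>z. max 0 (f z - g z) / f z)"
  define k where "k = (\<lambda>z. max 0 (g z - f z) / g z)"
  \<comment> \<open>A Hahn set for the difference: the positive excess of \<open>f\<close> over
    \<open>g\<close> is integrated by subtracting the two measures of this single set. The identity
    is later written additively to avoid extended subtraction.\<close>
  define D where "D = {z \<in> space P. g z < f z}"
  have hR[measurable]: "h \<in> borel_measurable R" and kR[measurable]: "k \<in> borel_measurable R"
    unfolding h_def k_def by measurable
  have DR[measurable]: "D \<in> sets R" unfolding D_def spR[symmetric] by measurable
  have fh: "f z * h z = max 0 (f z - g z)" for z using f0[of z] g0[of z] by (auto simp: h_def)
  have gk: "g z * k z = max 0 (g z - f z)" for z using f0[of z] g0[of z] by (auto simp: k_def)
  show ?thesis
  proof (rule that[of h k D])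
    show "h \<in> borel_measurable P" "k \<in> borel_measurable P" "D \<in> sets P"
      using hR kR DR by (simp_all add: sR measurable_cong_sets[OF sR refl])
    show "0 \<le> h z" "0 \<le> k z" for z using f0 g0 by (auto simp: h_def k_def)
    show h1: "h z \<le> 1" for z using f0[of z] g0[of z] by (auto simp: h_def divide_le_eq_1)
    show k1: "k z \<le> 1" for z using f0[of z] g0[of z] by (auto simp: k_def divide_le_eq_1)
    have "density P (\<lambda>z. ennreal (1 - h z)) = density (density R (\<lambda>z. ennreal (f z))) (\<lambda>z. ennreal (1 - h z))"
      by (simp only: fP)
    also have "\<dots> = density R (\<lambda>z. ennreal (f z) * ennreal (1 - h z))"
      by (rule density_density_eq) measurable
    also have "(\<lambda>z. ennreal (f z) * ennreal (1 - h z)) = (\<lambda>z. ennreal (g z) * ennreal (1 - k z))"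
    proof
      fix z
      have "f z * (1 - h z) = g z * (1 - k z)" unfolding right_diff_distrib fh gk by (auto simp: max_def)
      then show "ennreal (f z) * ennreal (1 - h z) = ennreal (g z) * ennreal (1 - k z)"
        using f0[of z] g0[of z] h1[of z] k1[of z] by (simp add: ennreal_mult[symmetric])
    qed
    also have "density R \<dots> = density (density R (\<lambda>z. ennreal (g z))) (\<lambda>z. ennreal (1 - k z))"
      by (rule density_density_eq[symmetric]) measurable
    also have "\<dots> = density Q (\<lambda>z. ennreal (1 - k z))" by (simp only: gQ)
    finally show "density P (\<lambda>z. ennreal (1 - h z)) = density Q (\<lambda>z. ennreal (1 - k z))" .
    have "(\<integral>\<^sup>+ z. ennreal (h z) \<partial>P) = (\<integral>\<^sup>+ z. ennreal (h z) \<partial>density R (\<lambda>z. ennreal (f z)))"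
      by (simp only: fP)
    also have "\<dots> = (\<integral>\<^sup>+ z. ennreal (f z) * ennreal (h z) \<partial>R)"
      by (rule nn_integral_density) measurable
    moreover have "emeasure Q D = (\<integral>\<^sup>+ z. ennreal (g z) * indicator D z \<partial>R)"
      by (subst gQ[symmetric], subst emeasure_density) auto
    ultimately have "(\<integral>\<^sup>+ z. ennreal (h z) \<partial>P) + emeasure Q D =
        (\<integral>\<^sup>+ z. ennreal (f z) * ennreal (h z) \<partial>R) + (\<integral>\<^sup>+ z. ennreal (g z) * indicator D z \<partial>R)" by simp
    also have "\<dots> = (\<integral>\<^sup>+ z. ennreal (f z) * ennreal (h z) + ennreal (g z) * indicator D z \<partial>R)"
      by (rule nn_integral_add[symmetric]) measurable
    also have "\<dots> = (\<integral>\<^sup>+ z. ennreal (f z) * indicator D z \<partial>R)"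
    proof (rule nn_integral_cong)
      fix z assume "z \<in> space R"
      moreover have "ennreal (f z) * ennreal (h z) = ennreal (max 0 (f z - g z))"
        using f0[of z] g0[of z] by (simp add: ennreal_mult'[symmetric] fh)
      ultimately show "ennreal (f z) * ennreal (h z) + ennreal (g z) * indicator D z = ennreal (f z) * indicator D z"
        using f0[of z] g0[of z]
        by (cases "g z < f z") (auto simp: D_def spR ennreal_plus[symmetric] max_def simp del: ennreal_plus)
    qed
    also have "\<dots> = emeasure P D"
      by (subst fP[symmetric], subst emeasure_density) auto
    finally show "(\<integral>\<^sup>+ z. ennreal (h z) \<partial>P) + emeasure Q D = emeasure P D" .
  qed
qed

section \<open>Disintegration of common parts and change of base\<close>

lemma emeasure_density_semidirect_Times:
  assumes M: "prob_space M" and \<kappa>[measurable]: "\<kappa> \<in> M \<rightarrow>\<^sub>M prob_algebra E"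
    and s[measurable]: "s \<in> borel_measurable (M \<Otimes>\<^sub>M E)" and C[measurable]: "C \<in> sets M" and U[measurable]: "U \<in> sets E"
  shows "emeasure (density (semidirect M E \<kappa>) s) (C \<times> U) =
    (\<integral>\<^sup>+ y. (\<integral>\<^sup>+ u. s (y, u) * indicator U u \<partial>\<kappa> y) * indicator C y \<partial>M)"
proof -
  have [measurable]: "s \<in> borel_measurable (semidirect M E \<kappa>)"
    using s by (simp add: measurable_cong_sets[OF sets_semidirect[OF M \<kappa>] refl])
  have "emeasure (density (semidirect M E \<kappa>) s) (C \<times> U) = (\<integral>\<^sup>+ z. s z * indicator (C \<times> U) z \<partial>semidirect M E \<kappa>)"
    by (rule emeasure_density) (simp_all add: sets_semidirect[OF M \<kappa>])
  also have "\<dots> = (\<integral>\<^sup>+ y. \<integral>\<^sup>+ u. s (y, u) * indicator (C \<times> U) (y, u) \<partial>\<kappa> y \<partial>M)"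
    by (rule nn_integral_semidirect[OF M \<kappa>]) measurable
  also have "\<dots> = (\<integral>\<^sup>+ y. (\<integral>\<^sup>+ u. s (y, u) * indicator U u \<partial>\<kappa> y) * indicator C y \<partial>M)"
    by (intro nn_integral_cong) (auto simp: indicator_def intro!: nn_integral_cong)
  finally show ?thesis .
qed

text \<open>For fixed \<open>U\<close>, equal joint measures have equal densities with respect to
  the base measure. The exceptional null set depends on \<open>U\<close>: a general \<open>E\<close>
  offers no countable family of sets on which to unite these null sets.\<close>

lemma AE_kernel_density_eq:
  assumes M: "prob_space M" and \<kappa>1[measurable]: "\<kappa>1 \<in> M \<rightarrow>\<^sub>M prob_algebra E" and \<kappa>2[measurable]: "\<kappa>2 \<in> M \<rightarrow>\<^sub>M prob_algebra E"
    and s1[measurable]: "s1 \<in> borel_measurable (M \<Otimes>\<^sub>M E)" and s2[measurable]: "s2 \<in> borel_measurable (M \<Otimes>\<^sub>M E)"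
    and s1_le: "\<And>z. s1 z \<le> (1 :: ennreal)"
    and eq: "density (semidirect M E \<kappa>1) s1 = density (semidirect M E \<kappa>2) s2"
    and U[measurable]: "U \<in> sets E"
  shows "AE y in M. (\<integral>\<^sup>+ u. s1 (y, u) * indicator U u \<partial>\<kappa>1 y) = (\<integral>\<^sup>+ u. s2 (y, u) * indicator U u \<partial>\<kappa>2 y)"
proof -
  interpret prob_space M by fact
  let ?F1 = "\<lambda>y. \<integral>\<^sup>+ u. s1 (y, u) * indicator U u \<partial>\<kappa>1 y"
  let ?F2 = "\<lambda>y. \<integral>\<^sup>+ u. s2 (y, u) * indicator U u \<partial>\<kappa>2 y"
  have F1[measurable]: "?F1 \<in> borel_measurable M"
    by (rule nn_integral_measurable_subprob_algebra2[OF _ measurable_prob_algebraD[OF \<kappa>1]]) measurable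
  have F2[measurable]: "?F2 \<in> borel_measurable M"
    by (rule nn_integral_measurable_subprob_algebra2[OF _ measurable_prob_algebraD[OF \<kappa>2]]) measurable
  have F1_le: "?F1 y \<le> 1" if y: "y \<in> space M" for y
  proof -
    interpret K: prob_space "\<kappa>1 y" using kernel_in_prob_algebra[OF M \<kappa>1 y] by (simp add: space_prob_algebra)
    have "?F1 y \<le> (\<integral>\<^sup>+ u. 1 \<partial>\<kappa>1 y)"
      using s1_le by (intro nn_integral_mono) (auto simp: indicator_def)
    then show ?thesis by (simp add: K.emeasure_space_1)
  qed
  have "(\<integral>\<^sup>+ y. ?F1 y \<partial>M) \<le> (\<integral>\<^sup>+ y. 1 \<partial>M)" by (rule nn_integral_mono[OF F1_le])
  then have "(\<integral>\<^sup>+ y. ?F1 y \<partial>M) \<noteq> \<infinity>" by (auto simp: emeasure_space_1 top_unique)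
  moreover have "density M ?F1 = density M ?F2"
  proof (rule measure_eqI)
    fix C assume "C \<in> sets (density M ?F1)"
    then have C[measurable]: "C \<in> sets M" by simp
    show "emeasure (density M ?F1) C = emeasure (density M ?F2) C"
      unfolding emeasure_density[OF F1 C] emeasure_density[OF F2 C]
        emeasure_density_semidirect_Times[OF M \<kappa>1 s1 C U, symmetric]
        emeasure_density_semidirect_Times[OF M \<kappa>2 s2 C U, symmetric] eq ..
  qed simp
  ultimately show ?thesis
    by (subst (asm) finite_density_unique) auto
qed

text \<open>Both sides are determined by rectangles, and for each fixed rectangle an almost sure
  identity over \<open>M\<close> suffices. Such an identity pulls back along \<open>p\<close>,
  because \<open>p\<close> has law \<open>M\<close>.\<close>

lemma density_semidirect_lift:
  assumes M: "prob_space M" and \<kappa>1[measurable]: "\<kappa>1 \<in> M \<rightarrow>\<^sub>M prob_algebra E" and \<kappa>2[measurable]: "\<kappa>2 \<in> M \<rightarrow>\<^sub>M prob_algebra E"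
    and s1[measurable]: "s1 \<in> borel_measurable (M \<Otimes>\<^sub>M E)" and s2[measurable]: "s2 \<in> borel_measurable (M \<Otimes>\<^sub>M E)"
    and s1_le: "\<And>z. s1 z \<le> (1 :: ennreal)"
    and eq: "density (semidirect M E \<kappa>1) s1 = density (semidirect M E \<kappa>2) s2"
    and \<pi>: "prob_space \<pi>" and p[measurable]: "p \<in> \<pi> \<rightarrow>\<^sub>M M" and distr: "distr \<pi> M p = M"
  shows "density (semidirect \<pi> E (\<lambda>\<omega>. \<kappa>1 (p \<omega>))) (\<lambda>z. s1 (p (fst z), snd z)) =
    density (semidirect \<pi> E (\<lambda>\<omega>. \<kappa>2 (p \<omega>))) (\<lambda>z. s2 (p (fst z), snd z))"
    (is "?L = ?R")
proof -
  have k1: "(\<lambda>\<omega>. \<kappa>1 (p \<omega>)) \<in> \<pi> \<rightarrow>\<^sub>M prob_algebra E" and k2: "(\<lambda>\<omega>. \<kappa>2 (p \<omega>)) \<in> \<pi> \<rightarrow>\<^sub>M prob_algebra E"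
    by measurable
  have t1: "(\<lambda>z. s1 (p (fst z), snd z)) \<in> borel_measurable (\<pi> \<Otimes>\<^sub>M E)"
    and t2: "(\<lambda>z. s2 (p (fst z), snd z)) \<in> borel_measurable (\<pi> \<Otimes>\<^sub>M E)" by measurable
  let ?G = "{a \<times> b | a b. a \<in> sets \<pi> \<and> b \<in> sets E}"
  show ?thesis
  proof (rule measure_eqI_generator_eq[OF Int_stable_pair_measure_generator[of \<pi> E], where \<Omega> = "space \<pi> \<times> space E" and A = "\<lambda>_. space \<pi> \<times> space E"])
    show "?G \<subseteq> Pow (space \<pi> \<times> space E)" by (rule pair_measure_closed)
    show "sets ?L = sigma_sets (space \<pi> \<times> space E) ?G" "sets ?R = sigma_sets (space \<pi> \<times> space E) ?G"
      using sets_semidirect[OF \<pi> k1] sets_semidirect[OF \<pi> k2] by (simp_all add: sets_pair_measure)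
    fix X assume "X \<in> ?G"
    then obtain C U where X: "X = C \<times> U" and C[measurable]: "C \<in> sets \<pi>" and U[measurable]: "U \<in> sets E" by auto
    have "AE y in distr \<pi> M p. (\<integral>\<^sup>+ u. s1 (y, u) * indicator U u \<partial>\<kappa>1 y) = (\<integral>\<^sup>+ u. s2 (y, u) * indicator U u \<partial>\<kappa>2 y)"
      unfolding distr by (rule AE_kernel_density_eq[OF M \<kappa>1 \<kappa>2 s1 s2 s1_le eq U])
    then have ae: "AE \<omega> in \<pi>. (\<integral>\<^sup>+ u. s1 (p \<omega>, u) * indicator U u \<partial>\<kappa>1 (p \<omega>)) = (\<integral>\<^sup>+ u. s2 (p \<omega>, u) * indicator U u \<partial>\<kappa>2 (p \<omega>))"
      by (rule AE_distrD[OF p])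
    have "emeasure ?L X = (\<integral>\<^sup>+ \<omega>. (\<integral>\<^sup>+ u. s1 (p \<omega>, u) * indicator U u \<partial>\<kappa>1 (p \<omega>)) * indicator C \<omega> \<partial>\<pi>)"
      unfolding X using emeasure_density_semidirect_Times[OF \<pi> k1 t1 C U] by simp
    also have "\<dots> = (\<integral>\<^sup>+ \<omega>. (\<integral>\<^sup>+ u. s2 (p \<omega>, u) * indicator U u \<partial>\<kappa>2 (p \<omega>)) * indicator C \<omega> \<partial>\<pi>)"
      by (intro nn_integral_cong_AE, use ae in eventually_elim) simp
    also have "\<dots> = emeasure ?R X"
      unfolding X using emeasure_density_semidirect_Times[OF \<pi> k2 t2 C U] by simp
    finally show "emeasure ?L X = emeasure ?R X" .
  next
    show "emeasure ?L (space \<pi> \<times> space E) \<noteq> \<infinity>" for i :: nat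
    proof -
      interpret S: prob_space "semidirect \<pi> E (\<lambda>\<omega>. \<kappa>1 (p \<omega>))" by (rule prob_space_semidirect[OF \<pi> k1])
      have t1': "(\<lambda>z. s1 (p (fst z), snd z)) \<in> borel_measurable (semidirect \<pi> E (\<lambda>\<omega>. \<kappa>1 (p \<omega>)))"
        using t1 by (simp only: measurable_cong_sets[OF sets_semidirect[OF \<pi> k1] refl])
      have "emeasure ?L (space \<pi> \<times> space E) \<le> (\<integral>\<^sup>+ z. 1 \<partial>semidirect \<pi> E (\<lambda>\<omega>. \<kappa>1 (p \<omega>)))"
      proof (subst emeasure_density[OF t1'])
        show "space \<pi> \<times> space E \<in> sets (semidirect \<pi> E (\<lambda>\<omega>. \<kappa>1 (p \<omega>)))"
          by (simp add: sets_semidirect[OF \<pi> k1])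
        show "(\<integral>\<^sup>+ z. s1 (p (fst z), snd z) * indicator (space \<pi> \<times> space E) z \<partial>semidirect \<pi> E (\<lambda>\<omega>. \<kappa>1 (p \<omega>)))
            \<le> (\<integral>\<^sup>+ z. 1 \<partial>semidirect \<pi> E (\<lambda>\<omega>. \<kappa>1 (p \<omega>)))"
          using s1_le by (intro nn_integral_mono) (auto simp: indicator_def)
      qed
      also have "\<dots> = 1" by (simp add: S.emeasure_space_1)
      finally show ?thesis by (auto simp: top_unique)
    qed
  qed auto
qed

text \<open>The maximal coupling of two kernels over the same base: with the probabilities given by the
  common part both coordinates agree, otherwise they are drawn independently from the normalised
  residual measures.\<close>

lemma kernel_coupling:
  assumes \<pi>: "prob_space \<pi>" and \<alpha>[measurable]: "\<alpha> \<in> \<pi> \<rightarrow>\<^sub>M prob_algebra E" and \<beta>[measurable]: "\<beta> \<in> \<pi> \<rightarrow>\<^sub>M prob_algebra E"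
  obtains \<Gamma> D where
    "sets \<Gamma> = sets (\<pi> \<Otimes>\<^sub>M (E \<Otimes>\<^sub>M E))"
    "\<And>\<phi>. \<phi> \<in> borel_measurable (\<pi> \<Otimes>\<^sub>M E) \<Longrightarrow>
       (\<integral>\<^sup>+ z. \<phi> (fst z, fst (snd z)) \<partial>\<Gamma>) = (\<integral>\<^sup>+ z. \<phi> z \<partial>semidirect \<pi> E \<alpha>)"
    "\<And>\<phi>. \<phi> \<in> borel_measurable (\<pi> \<Otimes>\<^sub>M E) \<Longrightarrow>
       (\<integral>\<^sup>+ z. \<phi> (fst z, snd (snd z)) \<partial>\<Gamma>) = (\<integral>\<^sup>+ z. \<phi> z \<partial>semidirect \<pi> E \<beta>)"
    "D \<in> sets (\<pi> \<Otimes>\<^sub>M E)"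
    "\<And>g. g \<in> borel_measurable (E \<Otimes>\<^sub>M E) \<Longrightarrow> (\<And>u. u \<in> space E \<Longrightarrow> g (u, u) = 0) \<Longrightarrow> (\<And>z. g z \<le> 1) \<Longrightarrow>
       (\<integral>\<^sup>+ z. g (snd z) \<partial>\<Gamma>) + emeasure (semidirect \<pi> E \<beta>) D \<le> emeasure (semidirect \<pi> E \<alpha>) D"
proof -
  interpret prob_space \<pi> by fact
  define P where "P = semidirect \<pi> E \<alpha>"
  define Q where "Q = semidirect \<pi> E \<beta>"
  have sP[measurable_cong]: "sets P = sets (\<pi> \<Otimes>\<^sub>M E)" and sQ[measurable_cong]: "sets Q = sets (\<pi> \<Otimes>\<^sub>M E)"
    unfolding P_def Q_def by (fact sets_semidirect[OF \<pi> \<alpha>] sets_semidirect[OF \<pi> \<beta>])+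
  have pP: "prob_space P" and pQ: "prob_space Q"
    unfolding P_def Q_def by (fact prob_space_semidirect[OF \<pi> \<alpha>] prob_space_semidirect[OF \<pi> \<beta>])+
  have sQP: "sets Q = sets P" by (simp add: sP sQ)
  obtain h k D where hP: "h \<in> borel_measurable P" and kP: "k \<in> borel_measurable P"
    and h: "\<And>z. 0 \<le> h z" "\<And>z. h z \<le> (1::real)" and k: "\<And>z. 0 \<le> k z" "\<And>z. k z \<le> (1::real)"
    and eq: "density P (\<lambda>z. ennreal (1 - h z)) = density Q (\<lambda>z. ennreal (1 - k z))"
    and D: "D \<in> sets P" and cost: "(\<integral>\<^sup>+ z. ennreal (h z) \<partial>P) + emeasure Q D = emeasure P D"
    using common_part[OF pP pQ sQP] by blast
  have hm[measurable]: "h \<in> borel_measurable (\<pi> \<Otimes>\<^sub>M E)" and km[measurable]: "k \<in> borel_measurable (\<pi> \<Otimes>\<^sub>M E)"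
    using hP kP by (simp_all only: measurable_cong_sets[OF sP refl])
  have intP: "(\<integral>\<^sup>+ z. \<phi> z \<partial>P) = (\<integral>\<^sup>+ \<omega>. \<integral>\<^sup>+ u. \<phi> (\<omega>, u) \<partial>\<alpha> \<omega> \<partial>\<pi>)" if "\<phi> \<in> borel_measurable (\<pi> \<Otimes>\<^sub>M E)" for \<phi>
    unfolding P_def by (rule nn_integral_semidirect[OF \<pi> \<alpha> that])
  have intQ: "(\<integral>\<^sup>+ z. \<phi> z \<partial>Q) = (\<integral>\<^sup>+ \<omega>. \<integral>\<^sup>+ u. \<phi> (\<omega>, u) \<partial>\<beta> \<omega> \<partial>\<pi>)" if "\<phi> \<in> borel_measurable (\<pi> \<Otimes>\<^sub>M E)" for \<phi>
    unfolding Q_def by (rule nn_integral_semidirect[OF \<pi> \<beta> that])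
  have common: "(\<integral>\<^sup>+ z. ennreal (1 - h z) * \<phi> z \<partial>P) = (\<integral>\<^sup>+ z. ennreal (1 - k z) * \<phi> z \<partial>Q)"
    if [measurable]: "\<phi> \<in> borel_measurable (\<pi> \<Otimes>\<^sub>M E)" for \<phi>
  proof -
    have "(\<integral>\<^sup>+ z. ennreal (1 - h z) * \<phi> z \<partial>P) = (\<integral>\<^sup>+ z. \<phi> z \<partial>density P (\<lambda>z. ennreal (1 - h z)))"
      by (rule nn_integral_density[symmetric]) measurable
    also have "\<dots> = (\<integral>\<^sup>+ z. ennreal (1 - k z) * \<phi> z \<partial>Q)"
      unfolding eq by (rule nn_integral_density) measurable
    finally show ?thesis .
  qed
  have a: "prob_space (\<alpha> \<omega>)" "sets (\<alpha> \<omega>) = sets E" "space (\<alpha> \<omega>) = space E"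
    and b: "prob_space (\<beta> \<omega>)" "sets (\<beta> \<omega>) = sets E" "space (\<beta> \<omega>) = space E" if "\<omega> \<in> space \<pi>" for \<omega>
    using kernel_in_prob_algebra[OF \<pi> \<alpha> that] kernel_in_prob_algebra[OF \<pi> \<beta> that]
    by (auto simp: space_prob_algebra dest: sets_eq_imp_space_eq)
  define m where "m = (\<lambda>\<omega>. \<integral>\<^sup>+ u. ennreal (h (\<omega>, u)) \<partial>\<alpha> \<omega>)"
  define m' where "m' = (\<lambda>\<omega>. \<integral>\<^sup>+ u. ennreal (k (\<omega>, u)) \<partial>\<beta> \<omega>)"
  have mm[measurable]: "m \<in> borel_measurable \<pi>"
    unfolding m_def by (rule nn_integral_measurable_subprob_algebra2[OF _ measurable_prob_algebraD[OF \<alpha>]]) measurable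
  have mm'[measurable]: "m' \<in> borel_measurable \<pi>"
    unfolding m'_def by (rule nn_integral_measurable_subprob_algebra2[OF _ measurable_prob_algebraD[OF \<beta>]]) measurable
  have m_le: "m \<omega> \<le> 1" if \<omega>: "\<omega> \<in> space \<pi>" for \<omega>
  proof -
    interpret A: prob_space "\<alpha> \<omega>" by (rule a[OF \<omega>])
    have "m \<omega> \<le> (\<integral>\<^sup>+ u. 1 \<partial>\<alpha> \<omega>)"
      unfolding m_def using h by (intro nn_integral_mono) simp
    then show ?thesis by (simp add: A.emeasure_space_1)
  qed
  have m_less_top: "m \<omega> < top" if "\<omega> \<in> space \<pi>" for \<omega>
    using m_le[OF that] by (rule le_less_trans) simp
  have "(\<integral>\<^sup>+ \<omega>. m \<omega> \<partial>\<pi>) \<le> (\<integral>\<^sup>+ \<omega>. 1 \<partial>\<pi>)" by (rule nn_integral_mono[OF m_le])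
  then have m_fin: "(\<integral>\<^sup>+ \<omega>. m \<omega> \<partial>\<pi>) \<noteq> \<infinity>" by (auto simp: emeasure_space_1 top_unique)
  \<comment> \<open>Over every base event, residual and common mass add up to the mass of the event.
    The common masses coincide and are finite, so they cancel, and the two residual masses agree
    almost everywhere.\<close>
  have "density \<pi> m = density \<pi> m'"
  proof (rule measure_eqI)
    fix C assume "C \<in> sets (density \<pi> m)"
    then have C[measurable]: "C \<in> sets \<pi>" by simp
    let ?c = "\<integral>\<^sup>+ z. ennreal (1 - h z) * indicator C (fst z) \<partial>P"
    have "?c + (\<integral>\<^sup>+ \<omega>. m \<omega> * indicator C \<omega> \<partial>\<pi>) = emeasure \<pi> C"
    proof -
      have "(\<integral>\<^sup>+ \<omega>. m \<omega> * indicator C \<omega> \<partial>\<pi>) = (\<integral>\<^sup>+ z. ennreal (h z) * indicator C (fst z) \<partial>P)"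
        unfolding m_def by (subst intP, measurable)
          (auto intro!: nn_integral_cong nn_integral_multc[symmetric] simp: measurable_cong_sets[OF a(2) refl])
      then have "?c + (\<integral>\<^sup>+ \<omega>. m \<omega> * indicator C \<omega> \<partial>\<pi>) =
          (\<integral>\<^sup>+ z. ennreal (1 - h z) * indicator C (fst z) + ennreal (h z) * indicator C (fst z) \<partial>P)"
        by (subst nn_integral_add) auto
      also have "\<dots> = (\<integral>\<^sup>+ z. indicator C (fst z) \<partial>P)"
        using h by (intro nn_integral_cong) (simp add: distrib_right[symmetric] ennreal_plus[symmetric] del: ennreal_plus)
      also have "\<dots> = (\<integral>\<^sup>+ \<omega>. indicator C \<omega> \<partial>\<pi>)"
      proof (subst intP)
        show "(\<integral>\<^sup>+ \<omega>. \<integral>\<^sup>+ u. indicator C (fst (\<omega>, u)) \<partial>\<alpha> \<omega> \<partial>\<pi>) = (\<integral>\<^sup>+ \<omega>. indicator C \<omega> \<partial>\<pi>)"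
          by (rule nn_integral_cong) (simp add: prob_space.emeasure_space_1[OF a(1)])
      qed measurable
      finally show ?thesis by simp
    qed
    moreover have "?c + (\<integral>\<^sup>+ \<omega>. m' \<omega> * indicator C \<omega> \<partial>\<pi>) = emeasure \<pi> C"
    proof -
      have "(\<integral>\<^sup>+ \<omega>. m' \<omega> * indicator C \<omega> \<partial>\<pi>) = (\<integral>\<^sup>+ z. ennreal (k z) * indicator C (fst z) \<partial>Q)"
        unfolding m'_def by (subst intQ, measurable)
          (auto intro!: nn_integral_cong nn_integral_multc[symmetric] simp: measurable_cong_sets[OF b(2) refl])
      then have "?c + (\<integral>\<^sup>+ \<omega>. m' \<omega> * indicator C \<omega> \<partial>\<pi>) =
          (\<integral>\<^sup>+ z. ennreal (1 - k z) * indicator C (fst z) + ennreal (k z) * indicator C (fst z) \<partial>Q)"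
        by (subst nn_integral_add) (auto simp: common)
      also have "\<dots> = (\<integral>\<^sup>+ z. indicator C (fst z) \<partial>Q)"
        using k by (intro nn_integral_cong) (simp add: distrib_right[symmetric] ennreal_plus[symmetric] del: ennreal_plus)
      also have "\<dots> = (\<integral>\<^sup>+ \<omega>. indicator C \<omega> \<partial>\<pi>)"
      proof (subst intQ)
        show "(\<integral>\<^sup>+ \<omega>. \<integral>\<^sup>+ u. indicator C (fst (\<omega>, u)) \<partial>\<beta> \<omega> \<partial>\<pi>) = (\<integral>\<^sup>+ \<omega>. indicator C \<omega> \<partial>\<pi>)"
          by (rule nn_integral_cong) (simp add: prob_space.emeasure_space_1[OF b(1)])
      qed measurable
      finally show ?thesis by simp
    qed
    moreover have "?c \<noteq> \<infinity>"
      using \<open>?c + (\<integral>\<^sup>+ \<omega>. m \<omega> * indicator C \<omega> \<partial>\<pi>) = emeasure \<pi> C\<close> emeasure_finite[of C]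
      by (metis ennreal_add_eq_top infinity_ennreal_def)
    ultimately have "(\<integral>\<^sup>+ \<omega>. m \<omega> * indicator C \<omega> \<partial>\<pi>) = (\<integral>\<^sup>+ \<omega>. m' \<omega> * indicator C \<omega> \<partial>\<pi>)"
      by (metis ennreal_add_left_cancel infinity_ennreal_def)
    then show "emeasure (density \<pi> m) C = emeasure (density \<pi> m') C"
      by (simp add: emeasure_density)
  qed simp
  then have m_eq: "AE \<omega> in \<pi>. m \<omega> = m' \<omega>"
    using m_fin by (subst (asm) finite_density_unique) auto

  define \<Lambda> where "\<Lambda> = semidirect \<pi> (E \<Otimes>\<^sub>M E) (\<lambda>\<omega>. \<alpha> \<omega> \<Otimes>\<^sub>M \<beta> \<omega>)"
  have ab[measurable]: "(\<lambda>\<omega>. \<alpha> \<omega> \<Otimes>\<^sub>M \<beta> \<omega>) \<in> \<pi> \<rightarrow>\<^sub>M prob_algebra (E \<Otimes>\<^sub>M E)"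
  proof (rule measurable_prob_algebraI)
    show "prob_space (\<alpha> \<omega> \<Otimes>\<^sub>M \<beta> \<omega>)" if "\<omega> \<in> space \<pi>" for \<omega>
    proof -
      interpret A: prob_space "\<alpha> \<omega>" by (rule a[OF that])
      interpret B: prob_space "\<beta> \<omega>" by (rule b[OF that])
      interpret AB: pair_prob_space "\<alpha> \<omega>" "\<beta> \<omega>" ..
      show ?thesis by (rule AB.prob_space_axioms)
    qed
    show "(\<lambda>\<omega>. \<alpha> \<omega> \<Otimes>\<^sub>M \<beta> \<omega>) \<in> \<pi> \<rightarrow>\<^sub>M subprob_algebra (E \<Otimes>\<^sub>M E)"
      by (intro measurable_pair_measure measurable_prob_algebraD \<alpha> \<beta>)
  qed
  have s\<Lambda>[measurable_cong]: "sets \<Lambda> = sets (\<pi> \<Otimes>\<^sub>M (E \<Otimes>\<^sub>M E))"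
    unfolding \<Lambda>_def by (rule sets_semidirect[OF \<pi> ab])
  have int\<Lambda>: "(\<integral>\<^sup>+ z. F z \<partial>\<Lambda>) = (\<integral>\<^sup>+ \<omega>. \<integral>\<^sup>+ u. \<integral>\<^sup>+ v. F (\<omega>, (u, v)) \<partial>\<beta> \<omega> \<partial>\<alpha> \<omega> \<partial>\<pi>)"
    and int\<Lambda>': "(\<integral>\<^sup>+ z. F z \<partial>\<Lambda>) = (\<integral>\<^sup>+ \<omega>. \<integral>\<^sup>+ v. \<integral>\<^sup>+ u. F (\<omega>, (u, v)) \<partial>\<alpha> \<omega> \<partial>\<beta> \<omega> \<partial>\<pi>)"
    if F[measurable]: "F \<in> borel_measurable (\<pi> \<Otimes>\<^sub>M (E \<Otimes>\<^sub>M E))" for F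
  proof -
    have *: "(\<integral>\<^sup>+ z. F z \<partial>\<Lambda>) = (\<integral>\<^sup>+ \<omega>. \<integral>\<^sup>+ w. F (\<omega>, w) \<partial>(\<alpha> \<omega> \<Otimes>\<^sub>M \<beta> \<omega>) \<partial>\<pi>)"
      unfolding \<Lambda>_def by (rule nn_integral_semidirect[OF \<pi> ab F])
    show "(\<integral>\<^sup>+ z. F z \<partial>\<Lambda>) = (\<integral>\<^sup>+ \<omega>. \<integral>\<^sup>+ u. \<integral>\<^sup>+ v. F (\<omega>, (u, v)) \<partial>\<beta> \<omega> \<partial>\<alpha> \<omega> \<partial>\<pi>)"
      unfolding *
    proof (rule nn_integral_cong)
      fix \<omega> assume \<omega>[measurable]: "\<omega> \<in> space \<pi>"
      note [measurable_cong] = a(2)[OF \<omega>] b(2)[OF \<omega>]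
      interpret B: prob_space "\<beta> \<omega>" by (rule b[OF \<omega>])
      show "(\<integral>\<^sup>+ w. F (\<omega>, w) \<partial>(\<alpha> \<omega> \<Otimes>\<^sub>M \<beta> \<omega>)) = (\<integral>\<^sup>+ u. \<integral>\<^sup>+ v. F (\<omega>, (u, v)) \<partial>\<beta> \<omega> \<partial>\<alpha> \<omega>)"
        by (subst B.nn_integral_fst[symmetric]) auto
    qed
    show "(\<integral>\<^sup>+ z. F z \<partial>\<Lambda>) = (\<integral>\<^sup>+ \<omega>. \<integral>\<^sup>+ v. \<integral>\<^sup>+ u. F (\<omega>, (u, v)) \<partial>\<alpha> \<omega> \<partial>\<beta> \<omega> \<partial>\<pi>)"
      unfolding *
    proof (rule nn_integral_cong)
      fix \<omega> assume \<omega>[measurable]: "\<omega> \<in> space \<pi>"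
      note [measurable_cong] = a(2)[OF \<omega>] b(2)[OF \<omega>]
      interpret A: prob_space "\<alpha> \<omega>" by (rule a[OF \<omega>])
      interpret B: prob_space "\<beta> \<omega>" by (rule b[OF \<omega>])
      interpret AB: pair_prob_space "\<alpha> \<omega>" "\<beta> \<omega>" ..
      show "(\<integral>\<^sup>+ w. F (\<omega>, w) \<partial>(\<alpha> \<omega> \<Otimes>\<^sub>M \<beta> \<omega>)) = (\<integral>\<^sup>+ v. \<integral>\<^sup>+ u. F (\<omega>, (u, v)) \<partial>\<alpha> \<omega> \<partial>\<beta> \<omega>)"
        by (subst AB.nn_integral_snd[symmetric]) auto
    qed
  qed

  \<comment> \<open>Starting from two independent draws, a flag selects the branch: on
    \<open>True\<close> the first draw is kept with its common weight and \<open>G\<close> copies it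
    to both coordinates; on \<open>False\<close> both draws are kept with the product of residual
    weights. Dividing by \<open>m\<close> normalises because both residual masses equal it.\<close>
  define W where "W = (\<lambda>(z, c). if c then ennreal (1 - h (fst z, fst (snd z)))
    else ennreal (h (fst z, fst (snd z))) * ennreal (k (fst z, snd (snd z))) / m (fst z))"
  define G where "G = (\<lambda>(z, c). (fst z, (fst (snd z), if c then fst (snd z) else snd (snd z))) :: 'a \<times> 'b \<times> 'b)"
  let ?B = "count_space (UNIV :: bool set)"
  have Wm[measurable]: "W \<in> borel_measurable (\<Lambda> \<Otimes>\<^sub>M ?B)" unfolding W_def by measurable
  have Gm[measurable]: "G \<in> \<Lambda> \<Otimes>\<^sub>M ?B \<rightarrow>\<^sub>M \<pi> \<Otimes>\<^sub>M (E \<Otimes>\<^sub>M E)" unfolding G_def by measurable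
  define \<Gamma> where "\<Gamma> = distr (density (\<Lambda> \<Otimes>\<^sub>M ?B) W) (\<pi> \<Otimes>\<^sub>M (E \<Otimes>\<^sub>M E)) G"
  have int\<Gamma>: "(\<integral>\<^sup>+ z. F z \<partial>\<Gamma>) =
      (\<integral>\<^sup>+ z. ennreal (1 - h (fst z, fst (snd z))) * F (fst z, (fst (snd z), fst (snd z))) +
        ennreal (h (fst z, fst (snd z))) * ennreal (k (fst z, snd (snd z))) / m (fst z) * F z \<partial>\<Lambda>)"
    if F[measurable]: "F \<in> borel_measurable (\<pi> \<Otimes>\<^sub>M (E \<Otimes>\<^sub>M E))" for F
  proof -
    interpret B: sigma_finite_measure ?B by (rule sigma_finite_measure_count_space_finite) simp
    have "(\<integral>\<^sup>+ z. F z \<partial>\<Gamma>) = (\<integral>\<^sup>+ z. F (G z) \<partial>density (\<Lambda> \<Otimes>\<^sub>M ?B) W)"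
      unfolding \<Gamma>_def by (rule nn_integral_distr) simp_all
    also have "\<dots> = (\<integral>\<^sup>+ z. W z * F (G z) \<partial>(\<Lambda> \<Otimes>\<^sub>M ?B))"
      by (rule nn_integral_density) measurable
    also have "\<dots> = (\<integral>\<^sup>+ z. \<integral>\<^sup>+ c. W (z, c) * F (G (z, c)) \<partial>?B \<partial>\<Lambda>)"
      by (rule B.nn_integral_fst[symmetric]) measurable
    also have "\<dots> = (\<integral>\<^sup>+ z. W (z, True) * F (G (z, True)) + W (z, False) * F (G (z, False)) \<partial>\<Lambda>)"
      by (simp add: nn_integral_count_space_finite UNIV_bool add.commute)
    finally show ?thesis by (simp add: W_def G_def)
  qed
  have u_marg: "(\<integral>\<^sup>+ z. \<phi> (fst z, fst (snd z)) \<partial>\<Gamma>) = (\<integral>\<^sup>+ z. \<phi> z \<partial>P)"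
    if [measurable]: "\<phi> \<in> borel_measurable (\<pi> \<Otimes>\<^sub>M E)" for \<phi>
  proof -
    have "(\<integral>\<^sup>+ z. \<phi> (fst z, fst (snd z)) \<partial>\<Gamma>) = (\<integral>\<^sup>+ \<omega>. \<integral>\<^sup>+ u. \<integral>\<^sup>+ v. ennreal (1 - h (\<omega>, u)) * \<phi> (\<omega>, u) +
        ennreal (h (\<omega>, u)) * ennreal (k (\<omega>, v)) / m \<omega> * \<phi> (\<omega>, u) \<partial>\<beta> \<omega> \<partial>\<alpha> \<omega> \<partial>\<pi>)"
      by (subst int\<Gamma>, measurable, subst int\<Lambda>) auto
    also have "\<dots> = (\<integral>\<^sup>+ \<omega>. \<integral>\<^sup>+ u. \<phi> (\<omega>, u) \<partial>\<alpha> \<omega> \<partial>\<pi>)"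
    proof (rule nn_integral_cong_AE, use m_eq AE_space in eventually_elim)
      case (elim \<omega>)
      note \<omega>[measurable] = elim(2)
      note [measurable_cong] = a(2)[OF \<omega>] b(2)[OF \<omega>]
      interpret B: prob_space "\<beta> \<omega>" by (rule b[OF \<omega>])
      have "(\<integral>\<^sup>+ v. ennreal (1 - h (\<omega>, u)) * \<phi> (\<omega>, u) + ennreal (h (\<omega>, u)) * ennreal (k (\<omega>, v)) / m \<omega> * \<phi> (\<omega>, u) \<partial>\<beta> \<omega>) =
          ennreal (1 - h (\<omega>, u)) * \<phi> (\<omega>, u) + ennreal (h (\<omega>, u)) * \<phi> (\<omega>, u) * (m \<omega> / m \<omega>)"
        if [measurable]: "u \<in> space E" for u
      proof -
        have "(\<integral>\<^sup>+ v. ennreal (h (\<omega>, u)) * ennreal (k (\<omega>, v)) / m \<omega> * \<phi> (\<omega>, u) \<partial>\<beta> \<omega>) =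
            (\<integral>\<^sup>+ v. (ennreal (h (\<omega>, u)) * \<phi> (\<omega>, u) / m \<omega>) * ennreal (k (\<omega>, v)) \<partial>\<beta> \<omega>)"
          by (intro nn_integral_cong) (simp add: divide_ennreal_def mult_ac)
        also have "\<dots> = (ennreal (h (\<omega>, u)) * \<phi> (\<omega>, u) / m \<omega>) * m \<omega>"
          unfolding elim(1) m'_def by (rule nn_integral_cmult) measurable
        finally show ?thesis
          by (subst nn_integral_add) (auto simp: B.emeasure_space_1 divide_ennreal_def mult_ac)
      qed
      then have "(\<integral>\<^sup>+ u. \<integral>\<^sup>+ v. ennreal (1 - h (\<omega>, u)) * \<phi> (\<omega>, u) +
          ennreal (h (\<omega>, u)) * ennreal (k (\<omega>, v)) / m \<omega> * \<phi> (\<omega>, u) \<partial>\<beta> \<omega> \<partial>\<alpha> \<omega>) =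
          (\<integral>\<^sup>+ u. ennreal (1 - h (\<omega>, u)) * \<phi> (\<omega>, u) + ennreal (h (\<omega>, u)) * \<phi> (\<omega>, u) * (m \<omega> / m \<omega>) \<partial>\<alpha> \<omega>)"
        by (intro nn_integral_cong) (simp add: a(3)[OF \<omega>])
      also have "\<dots> = (\<integral>\<^sup>+ u. \<phi> (\<omega>, u) \<partial>\<alpha> \<omega>)"
      proof (rule nn_integral_cong_AE)
        \<comment> \<open>If the residual mass is 0, then \<open>m \<omega> / m \<omega>\<close> is
          0 and not 1; in that case \<open>h\<close> vanishes almost surely and the affected term is
          absent.\<close>
        have "AE u in \<alpha> \<omega>. m \<omega> = 0 \<longrightarrow> h (\<omega>, u) = 0"
        proof (cases "m \<omega> = 0")
          case True
          then have "AE u in \<alpha> \<omega>. ennreal (h (\<omega>, u)) = 0"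
            unfolding m_def by (subst (asm) nn_integral_0_iff_AE) auto
          then show ?thesis by eventually_elim (use h in \<open>simp add: antisym\<close>)
        qed simp
        then show "AE u in \<alpha> \<omega>. ennreal (1 - h (\<omega>, u)) * \<phi> (\<omega>, u) + ennreal (h (\<omega>, u)) * \<phi> (\<omega>, u) * (m \<omega> / m \<omega>) = \<phi> (\<omega>, u)"
        proof eventually_elim
          case (elim u)
          show ?case
          proof (cases "m \<omega> = 0")
            case False
            then have "m \<omega> / m \<omega> = 1"
              using m_less_top[OF \<omega>] by (intro ennreal_divide_self)
            then show ?thesis
              using h[of "(\<omega>, u)"] by (simp add: distrib_right[symmetric] ennreal_plus[symmetric] del: ennreal_plus)
          qed (use elim in simp)
        qed
      qed
      finally show ?case .
    qed
    also have "\<dots> = (\<integral>\<^sup>+ z. \<phi> z \<partial>P)" by (rule intP[symmetric]) fact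
    finally show ?thesis .
  qed
  have v_marg: "(\<integral>\<^sup>+ z. \<phi> (fst z, snd (snd z)) \<partial>\<Gamma>) = (\<integral>\<^sup>+ z. \<phi> z \<partial>Q)"
    if [measurable]: "\<phi> \<in> borel_measurable (\<pi> \<Otimes>\<^sub>M E)" for \<phi>
  proof -
    have "(\<integral>\<^sup>+ z. \<phi> (fst z, snd (snd z)) \<partial>\<Gamma>) =
        (\<integral>\<^sup>+ z. ennreal (1 - h (fst z, fst (snd z))) * \<phi> (fst z, fst (snd z)) \<partial>\<Lambda>) +
        (\<integral>\<^sup>+ z. ennreal (h (fst z, fst (snd z))) * ennreal (k (fst z, snd (snd z))) / m (fst z) * \<phi> (fst z, snd (snd z)) \<partial>\<Lambda>)"
      by (subst int\<Gamma>, measurable, subst nn_integral_add) auto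
    also have "(\<integral>\<^sup>+ z. ennreal (1 - h (fst z, fst (snd z))) * \<phi> (fst z, fst (snd z)) \<partial>\<Lambda>) =
        (\<integral>\<^sup>+ z. ennreal (1 - h z) * \<phi> z \<partial>P)"
      by (subst int\<Lambda>, measurable, subst intP)
        (auto intro!: nn_integral_cong simp: prob_space.emeasure_space_1[OF b(1)])
    \<comment> \<open>On the \<open>True\<close> branch the second coordinate is a draw from the
      first kernel. It has the right law because the common part of \<open>P\<close> is also the
      common part of \<open>Q\<close>.\<close>
    also have "\<dots> = (\<integral>\<^sup>+ z. ennreal (1 - k z) * \<phi> z \<partial>Q)" by (rule common) fact
    also have "(\<integral>\<^sup>+ z. ennreal (h (fst z, fst (snd z))) * ennreal (k (fst z, snd (snd z))) / m (fst z) * \<phi> (fst z, snd (snd z)) \<partial>\<Lambda>) =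
        (\<integral>\<^sup>+ \<omega>. \<integral>\<^sup>+ v. \<integral>\<^sup>+ u. ennreal (h (\<omega>, u)) * ennreal (k (\<omega>, v)) / m \<omega> * \<phi> (\<omega>, v) \<partial>\<alpha> \<omega> \<partial>\<beta> \<omega> \<partial>\<pi>)"
      by (subst int\<Lambda>') auto
    also have "\<dots> = (\<integral>\<^sup>+ \<omega>. \<integral>\<^sup>+ v. ennreal (k (\<omega>, v)) * \<phi> (\<omega>, v) \<partial>\<beta> \<omega> \<partial>\<pi>)"
    proof (rule nn_integral_cong_AE, use m_eq AE_space in eventually_elim)
      case (elim \<omega>)
      note \<omega>[measurable] = elim(2)
      note [measurable_cong] = a(2)[OF \<omega>] b(2)[OF \<omega>]
      have "(\<integral>\<^sup>+ u. ennreal (h (\<omega>, u)) * ennreal (k (\<omega>, v)) / m \<omega> * \<phi> (\<omega>, v) \<partial>\<alpha> \<omega>) =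
          ennreal (k (\<omega>, v)) * \<phi> (\<omega>, v) * (m \<omega> / m \<omega>)" if [measurable]: "v \<in> space E" for v
      proof -
        have "(\<integral>\<^sup>+ u. ennreal (h (\<omega>, u)) * ennreal (k (\<omega>, v)) / m \<omega> * \<phi> (\<omega>, v) \<partial>\<alpha> \<omega>) =
            (\<integral>\<^sup>+ u. (ennreal (k (\<omega>, v)) * \<phi> (\<omega>, v) / m \<omega>) * ennreal (h (\<omega>, u)) \<partial>\<alpha> \<omega>)"
          by (intro nn_integral_cong) (simp add: divide_ennreal_def mult_ac)
        also have "\<dots> = (ennreal (k (\<omega>, v)) * \<phi> (\<omega>, v) / m \<omega>) * m \<omega>"
          unfolding m_def by (rule nn_integral_cmult) measurable
        finally show ?thesis by (simp add: divide_ennreal_def mult_ac)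
      qed
      then have "(\<integral>\<^sup>+ v. \<integral>\<^sup>+ u. ennreal (h (\<omega>, u)) * ennreal (k (\<omega>, v)) / m \<omega> * \<phi> (\<omega>, v) \<partial>\<alpha> \<omega> \<partial>\<beta> \<omega>) =
          (\<integral>\<^sup>+ v. ennreal (k (\<omega>, v)) * \<phi> (\<omega>, v) * (m \<omega> / m \<omega>) \<partial>\<beta> \<omega>)"
        by (intro nn_integral_cong) (simp add: b(3)[OF \<omega>])
      also have "\<dots> = (\<integral>\<^sup>+ v. ennreal (k (\<omega>, v)) * \<phi> (\<omega>, v) \<partial>\<beta> \<omega>)"
      proof (cases "m \<omega> = 0")
        case True
        then have "AE v in \<beta> \<omega>. ennreal (k (\<omega>, v)) = 0"
          unfolding elim(1) m'_def by (subst (asm) nn_integral_0_iff_AE) auto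
        then show ?thesis by (intro nn_integral_cong_AE) (auto elim!: eventually_mono)
      next
        case False
        then have "m \<omega> / m \<omega> = 1"
          using m_less_top[OF \<omega>] by (intro ennreal_divide_self)
        then show ?thesis by simp
      qed
      finally show ?case .
    qed
    also have "\<dots> = (\<integral>\<^sup>+ z. ennreal (k z) * \<phi> z \<partial>Q)" by (subst intQ) auto
    also have "(\<integral>\<^sup>+ z. ennreal (1 - k z) * \<phi> z \<partial>Q) + (\<integral>\<^sup>+ z. ennreal (k z) * \<phi> z \<partial>Q) =
        (\<integral>\<^sup>+ z. ennreal (1 - k z) * \<phi> z + ennreal (k z) * \<phi> z \<partial>Q)"
      by (subst nn_integral_add) auto
    also have "\<dots> = (\<integral>\<^sup>+ z. \<phi> z \<partial>Q)"
      using k by (intro nn_integral_cong) (simp add: distrib_right[symmetric] ennreal_plus[symmetric] del: ennreal_plus)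
    finally show ?thesis .
  qed
  \<comment> \<open>The \<open>True\<close> branch lies on the diagonal, where \<open>g\<close>
    vanishes; the rest costs at most the residual mass, and \<open>D\<close> expresses that mass as
    a difference.\<close>
  have g_cost: "(\<integral>\<^sup>+ z. g (snd z) \<partial>\<Gamma>) + emeasure Q D \<le> emeasure P D"
    if [measurable]: "g \<in> borel_measurable (E \<Otimes>\<^sub>M E)" and g0: "\<And>u. u \<in> space E \<Longrightarrow> g (u, u) = 0" and g1: "\<And>z. g z \<le> 1" for g
  proof -
    have "(\<integral>\<^sup>+ z. g (snd z) \<partial>\<Gamma>) = (\<integral>\<^sup>+ \<omega>. \<integral>\<^sup>+ u. \<integral>\<^sup>+ v. ennreal (1 - h (\<omega>, u)) * g (u, u) +
        ennreal (h (\<omega>, u)) * ennreal (k (\<omega>, v)) / m \<omega> * g (u, v) \<partial>\<beta> \<omega> \<partial>\<alpha> \<omega> \<partial>\<pi>)"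
      by (subst int\<Gamma>, measurable, subst int\<Lambda>) auto
    also have "\<dots> \<le> (\<integral>\<^sup>+ \<omega>. \<integral>\<^sup>+ u. ennreal (h (\<omega>, u)) \<partial>\<alpha> \<omega> \<partial>\<pi>)"
    proof (rule nn_integral_mono_AE, use m_eq AE_space in eventually_elim)
      case (elim \<omega>)
      note \<omega>[measurable] = elim(2)
      note [measurable_cong] = a(2)[OF \<omega>] b(2)[OF \<omega>]
      show ?case
      proof (rule nn_integral_mono)
        fix u assume "u \<in> space (\<alpha> \<omega>)"
        then have u[measurable]: "u \<in> space E" by (simp add: a(3)[OF \<omega>])
        have "(\<integral>\<^sup>+ v. ennreal (1 - h (\<omega>, u)) * g (u, u) + ennreal (h (\<omega>, u)) * ennreal (k (\<omega>, v)) / m \<omega> * g (u, v) \<partial>\<beta> \<omega>)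
            \<le> (\<integral>\<^sup>+ v. (ennreal (h (\<omega>, u)) / m \<omega>) * ennreal (k (\<omega>, v)) \<partial>\<beta> \<omega>)"
        proof (rule nn_integral_mono)
          fix v
          have "ennreal (h (\<omega>, u)) * ennreal (k (\<omega>, v)) / m \<omega> * g (u, v) \<le> ennreal (h (\<omega>, u)) * ennreal (k (\<omega>, v)) / m \<omega> * 1"
            by (intro mult_left_mono g1) simp
          then show "ennreal (1 - h (\<omega>, u)) * g (u, u) + ennreal (h (\<omega>, u)) * ennreal (k (\<omega>, v)) / m \<omega> * g (u, v)
              \<le> (ennreal (h (\<omega>, u)) / m \<omega>) * ennreal (k (\<omega>, v))"
            by (simp add: g0[OF u] divide_ennreal_def mult_ac)
        qed
        also have "\<dots> = (ennreal (h (\<omega>, u)) / m \<omega>) * m \<omega>"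
          unfolding elim(1) m'_def by (rule nn_integral_cmult) measurable
        also have "\<dots> = ennreal (h (\<omega>, u)) * (m \<omega> / m \<omega>)" by (simp add: divide_ennreal_def mult_ac)
        also have "\<dots> \<le> ennreal (h (\<omega>, u)) * 1"
        proof (rule mult_left_mono)
          show "m \<omega> / m \<omega> \<le> 1"
            using m_less_top[OF \<omega>] ennreal_divide_self[of "m \<omega>"] by (cases "m \<omega> = 0") auto
        qed simp
        finally show "(\<integral>\<^sup>+ v. ennreal (1 - h (\<omega>, u)) * g (u, u) + ennreal (h (\<omega>, u)) * ennreal (k (\<omega>, v)) / m \<omega> * g (u, v) \<partial>\<beta> \<omega>)
            \<le> ennreal (h (\<omega>, u))" by simp
      qed
    qed
    also have "\<dots> = (\<integral>\<^sup>+ z. ennreal (h z) \<partial>P)" by (rule intP[symmetric]) measurable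
    finally show ?thesis unfolding cost[symmetric] by (rule add_right_mono)
  qed
  show ?thesis
    by (rule that[of \<Gamma> D])
      (use u_marg v_marg g_cost D in \<open>simp_all add: \<Gamma>_def sP flip: P_def Q_def\<close>)
qed

text \<open>The bound \<open>w\<close> need not be measurable, so the kernels are compared over \<open>\<nu>\<close>, where \<open>w\<close> is
  integrated, and only their common part is lifted to \<open>\<pi>\<close>.\<close>

lemma semidirect_lift_le:
  assumes \<nu>: "prob_space \<nu>" and \<kappa>1[measurable]: "\<kappa>1 \<in> \<nu> \<rightarrow>\<^sub>M prob_algebra E" and \<kappa>2[measurable]: "\<kappa>2 \<in> \<nu> \<rightarrow>\<^sub>M prob_algebra E"
    and \<pi>: "prob_space \<pi>" and p[measurable]: "p \<in> \<pi> \<rightarrow>\<^sub>M \<nu>" and distr: "distr \<pi> \<nu> p = \<nu>"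
    and D[measurable]: "D \<in> sets (\<pi> \<Otimes>\<^sub>M E)"
    and w: "\<And>y A. y \<in> space \<nu> \<Longrightarrow> A \<in> sets E \<Longrightarrow> ennreal \<bar>measure (\<kappa>1 y) A - measure (\<kappa>2 y) A\<bar> \<le> w y"
  shows "emeasure (semidirect \<pi> E (\<lambda>\<omega>. \<kappa>1 (p \<omega>))) D \<le> emeasure (semidirect \<pi> E (\<lambda>\<omega>. \<kappa>2 (p \<omega>))) D + (\<integral>\<^sup>+ y. w y \<partial>\<nu>)"
proof -
  interpret \<nu>: prob_space \<nu> by fact
  define P0 where "P0 = semidirect \<nu> E \<kappa>1"
  define Q0 where "Q0 = semidirect \<nu> E \<kappa>2"
  have sP0[measurable_cong]: "sets P0 = sets (\<nu> \<Otimes>\<^sub>M E)" and sQ0[measurable_cong]: "sets Q0 = sets (\<nu> \<Otimes>\<^sub>M E)"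
    unfolding P0_def Q0_def by (fact sets_semidirect[OF \<nu> \<kappa>1] sets_semidirect[OF \<nu> \<kappa>2])+
  have pP0: "prob_space P0" and pQ0: "prob_space Q0"
    unfolding P0_def Q0_def by (fact prob_space_semidirect[OF \<nu> \<kappa>1] prob_space_semidirect[OF \<nu> \<kappa>2])+
  interpret P0: prob_space P0 by fact
  interpret Q0: prob_space Q0 by fact
  obtain h k D0 where hP: "h \<in> borel_measurable P0" and kP: "k \<in> borel_measurable P0"
    and h: "\<And>z. 0 \<le> h z" "\<And>z. h z \<le> (1::real)" and k: "\<And>z. 0 \<le> k z" "\<And>z. k z \<le> (1::real)"
    and eq: "density P0 (\<lambda>z. ennreal (1 - h z)) = density Q0 (\<lambda>z. ennreal (1 - k z))"
    and D0: "D0 \<in> sets P0" and cost: "(\<integral>\<^sup>+ z. ennreal (h z) \<partial>P0) + emeasure Q0 D0 = emeasure P0 D0"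
    using common_part[OF pP0 pQ0] sP0 sQ0 by metis
  have [measurable]: "h \<in> borel_measurable (\<nu> \<Otimes>\<^sub>M E)" "k \<in> borel_measurable (\<nu> \<Otimes>\<^sub>M E)" "D0 \<in> sets (\<nu> \<Otimes>\<^sub>M E)"
    using hP kP D0 by (simp_all only: measurable_cong_sets[OF sP0 refl] sP0)
  \<comment> \<open>The residual mass is the integral of a difference of section measures. This
    difference is measurable and lies below \<open>w\<close> pointwise, so monotonicity alone yields
    the bound.\<close>
  have h_le: "(\<integral>\<^sup>+ z. ennreal (h z) \<partial>P0) \<le> (\<integral>\<^sup>+ y. w y \<partial>\<nu>)"
  proof -
    have ind: "indicat_real D0 \<in> borel_measurable (\<nu> \<Otimes>\<^sub>M E)" by measurable
    have sec: "Pair y -` D0 \<in> sets E" for y by (rule sets_Pair1) fact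
    have K: "(\<integral>u. indicat_real D0 (y, u) \<partial>\<kappa> y) = measure (\<kappa> y) (Pair y -` D0)"
      if \<kappa>: "\<kappa> \<in> \<nu> \<rightarrow>\<^sub>M prob_algebra E" and y: "y \<in> space \<nu>" for \<kappa> y
    proof -
      have "sets (\<kappa> y) = sets E" using kernel_in_prob_algebra[OF \<nu> \<kappa> y] by (simp add: space_prob_algebra)
      then have "Pair y -` D0 \<in> sets (\<kappa> y)" using sec by simp
      moreover have "indicat_real D0 (y, u) = indicator (Pair y -` D0) u" for u by (simp add: indicator_def)
      ultimately show ?thesis by simp
    qed
    define F1 where "F1 = (\<lambda>y. \<integral>u. indicat_real D0 (y, u) \<partial>\<kappa>1 y)"
    define F2 where "F2 = (\<lambda>y. \<integral>u. indicat_real D0 (y, u) \<partial>\<kappa>2 y)"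
    have [measurable]: "F1 \<in> borel_measurable \<nu>" "F2 \<in> borel_measurable \<nu>"
      unfolding F1_def F2_def by (rule integral_kernel_measurable[OF \<nu> _ ind]; fact)+
    have F: "0 \<le> F1 y" "F1 y \<le> 1" "0 \<le> F2 y" "F2 y \<le> 1" if y: "y \<in> space \<nu>" for y
      using K[OF \<kappa>1 y] K[OF \<kappa>2 y] kernel_in_prob_algebra[OF \<nu> \<kappa>1 y] kernel_in_prob_algebra[OF \<nu> \<kappa>2 y]
      by (auto simp: F1_def F2_def space_prob_algebra prob_space.prob_le_1)
    have iF: "integrable \<nu> F1" "integrable \<nu> F2"
      by (rule \<nu>.integrable_const_bound[where B = 1]; use F in auto)+
    have "measure P0 D0 = (\<integral>z. indicat_real D0 z \<partial>P0)" using D0 by simp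
    also have "\<dots> = (\<integral>y. F1 y \<partial>\<nu>)"
      unfolding P0_def F1_def by (rule integral_semidirect[OF \<nu> \<kappa>1 ind, where B = 1]) simp
    finally have m1: "measure P0 D0 = (\<integral>y. F1 y \<partial>\<nu>)" .
    have "measure Q0 D0 = (\<integral>z. indicat_real D0 z \<partial>Q0)" using D0 by (simp add: sP0 sQ0)
    also have "\<dots> = (\<integral>y. F2 y \<partial>\<nu>)"
      unfolding Q0_def F2_def by (rule integral_semidirect[OF \<nu> \<kappa>2 ind, where B = 1]) simp
    finally have m2: "measure Q0 D0 = (\<integral>y. F2 y \<partial>\<nu>)" .
    have "(\<integral>\<^sup>+ z. ennreal (h z) \<partial>P0) = emeasure P0 D0 - emeasure Q0 D0"
      using cost by (simp add: Q0.emeasure_eq_measure flip: cost)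
    also have "\<dots> = ennreal (measure P0 D0 - measure Q0 D0)"
      by (simp add: P0.emeasure_eq_measure Q0.emeasure_eq_measure ennreal_minus)
    also have "\<dots> = ennreal (\<integral>y. F1 y - F2 y \<partial>\<nu>)" by (simp add: m1 m2 iF)
    also have "\<dots> \<le> ennreal (\<integral>y. \<bar>F1 y - F2 y\<bar> \<partial>\<nu>)"
      using iF by (intro ennreal_leI integral_mono) auto
    also have "\<dots> = (\<integral>\<^sup>+ y. ennreal \<bar>F1 y - F2 y\<bar> \<partial>\<nu>)"
      using iF by (intro nn_integral_eq_integral[symmetric]) auto
    also have "\<dots> \<le> (\<integral>\<^sup>+ y. w y \<partial>\<nu>)"
      by (rule nn_integral_mono) (simp add: F1_def F2_def K \<kappa>1 \<kappa>2 w sec)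
    finally show ?thesis .
  qed
  let ?P = "semidirect \<pi> E (\<lambda>\<omega>. \<kappa>1 (p \<omega>))" and ?Q = "semidirect \<pi> E (\<lambda>\<omega>. \<kappa>2 (p \<omega>))"
  let ?h = "\<lambda>z. h (p (fst z), snd z)" and ?k = "\<lambda>z. k (p (fst z), snd z)"
  have k1: "(\<lambda>\<omega>. \<kappa>1 (p \<omega>)) \<in> \<pi> \<rightarrow>\<^sub>M prob_algebra E" and k2: "(\<lambda>\<omega>. \<kappa>2 (p \<omega>)) \<in> \<pi> \<rightarrow>\<^sub>M prob_algebra E"
    by measurable
  have sP[measurable_cong]: "sets ?P = sets (\<pi> \<Otimes>\<^sub>M E)" and sQ[measurable_cong]: "sets ?Q = sets (\<pi> \<Otimes>\<^sub>M E)"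
    by (fact sets_semidirect[OF \<pi> k1] sets_semidirect[OF \<pi> k2])+
  have hm: "?h \<in> borel_measurable (\<pi> \<Otimes>\<^sub>M E)" and km: "?k \<in> borel_measurable (\<pi> \<Otimes>\<^sub>M E)" by measurable
  have hmP[measurable]: "?h \<in> borel_measurable ?P" and kmQ[measurable]: "?k \<in> borel_measurable ?Q"
    using hm km by (simp_all only: measurable_cong_sets[OF sP refl] measurable_cong_sets[OF sQ refl])
  have lift: "density ?P (\<lambda>z. ennreal (1 - ?h z)) = density ?Q (\<lambda>z. ennreal (1 - ?k z))"
    by (rule density_semidirect_lift[OF \<nu> \<kappa>1 \<kappa>2, where ?s1.0 = "\<lambda>z. ennreal (1 - h z)" and ?s2.0 = "\<lambda>z. ennreal (1 - k z)"])
      (use h eq \<pi> p distr in \<open>auto simp: P0_def Q0_def\<close>)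
  have hint: "(\<integral>\<^sup>+ z. ennreal (?h z) \<partial>?P) = (\<integral>\<^sup>+ z. ennreal (h z) \<partial>P0)"
  proof -
    have "(\<integral>\<^sup>+ z. ennreal (?h z) \<partial>?P) = (\<integral>\<^sup>+ \<omega>. (\<integral>\<^sup>+ u. ennreal (h (p \<omega>, u)) \<partial>\<kappa>1 (p \<omega>)) \<partial>\<pi>)"
      by (subst nn_integral_semidirect[OF \<pi> k1]) auto
    also have "\<dots> = (\<integral>\<^sup>+ y. (\<integral>\<^sup>+ u. ennreal (h (y, u)) \<partial>\<kappa>1 y) \<partial>distr \<pi> \<nu> p)"
    proof (rule nn_integral_distr[symmetric, OF p])
      have "(\<lambda>y. \<integral>\<^sup>+ u. ennreal (h (y, u)) \<partial>\<kappa>1 y) \<in> borel_measurable \<nu>"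
        by (rule nn_integral_measurable_subprob_algebra2[OF _ measurable_prob_algebraD[OF \<kappa>1]]) measurable
      then show "(\<lambda>y. \<integral>\<^sup>+ u. ennreal (h (y, u)) \<partial>\<kappa>1 y) \<in> borel_measurable (distr \<pi> \<nu> p)" by simp
    qed
    also have "\<dots> = (\<integral>\<^sup>+ z. ennreal (h z) \<partial>P0)"
      unfolding distr P0_def by (rule nn_integral_semidirect[OF \<nu> \<kappa>1, symmetric]) measurable
    finally show ?thesis .
  qed
  \<comment> \<open>The weight 1 is split into common and residual part. The common part moves to
    the second kernel through \<open>lift\<close>; the residual part is bounded by its whole mass,
    which is the same over \<open>\<pi>\<close> and over \<open>\<nu>\<close>.\<close>
  have "emeasure ?P D = (\<integral>\<^sup>+ z. indicator D z \<partial>?P)" by (simp add: sP)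
  also have "\<dots> \<le> (\<integral>\<^sup>+ z. ennreal (1 - ?h z) * indicator D z + ennreal (?h z) \<partial>?P)"
  proof (rule nn_integral_mono)
    fix z
    have "1 = ennreal (1 - ?h z) + ennreal (?h z)" using h by (simp add: ennreal_plus[symmetric] del: ennreal_plus)
    then show "indicator D z \<le> ennreal (1 - ?h z) * indicator D z + ennreal (?h z)" by (simp add: indicator_def)
  qed
  also have "\<dots> = (\<integral>\<^sup>+ z. ennreal (1 - ?h z) * indicator D z \<partial>?P) + (\<integral>\<^sup>+ z. ennreal (?h z) \<partial>?P)"
    by (rule nn_integral_add) measurable
  also have "(\<integral>\<^sup>+ z. ennreal (1 - ?h z) * indicator D z \<partial>?P) = emeasure (density ?P (\<lambda>z. ennreal (1 - ?h z))) D"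
    using D by (intro emeasure_density[symmetric] measurable_compose[OF _ measurable_ennreal] borel_measurable_diff hmP) (simp_all add: sP)
  also have "\<dots> = (\<integral>\<^sup>+ z. ennreal (1 - ?k z) * indicator D z \<partial>?Q)"
    unfolding lift using D
    by (intro emeasure_density measurable_compose[OF _ measurable_ennreal] borel_measurable_diff kmQ) (simp_all add: sQ)
  also have "\<dots> \<le> (\<integral>\<^sup>+ z. indicator D z \<partial>?Q)"
    using k by (intro nn_integral_mono) (auto simp: indicator_def)
  also have "\<dots> = emeasure ?Q D" by (simp add: sQ)
  finally show ?thesis using h_le unfolding hint by (meson add_left_mono add_right_mono order_trans)
qed

text \<open>The invariance of \<open>\<nu>\<close> pulled back to a larger base of which
  \<open>\<nu>\<close> is a marginal. With \<open>p\<close> a projection it shows that updating a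
  coupling preserves the corresponding marginal.\<close>

lemma resample_marginal:
  assumes "finite T" and i: "i \<in> T" and \<nu>: "prob_space \<nu>" and s[measurable_cong]: "sets \<nu> = sets (\<Pi>\<^sub>M j\<in>T. E)"
    and \<kappa>: "is_site_cond_distr T E \<nu> i \<kappa>"
    and \<pi>: "prob_space \<pi>" and p[measurable]: "p \<in> \<pi> \<rightarrow>\<^sub>M \<nu>" and distr: "distr \<pi> \<nu> p = \<nu>"
    and A[measurable]: "A \<in> sets \<nu>"
  shows "(\<integral>\<^sup>+ z. indicator A ((p (fst z))(i := snd z)) \<partial>semidirect \<pi> E (\<lambda>\<omega>. \<kappa> (p \<omega>))) = emeasure \<nu> A"
proof -
  have \<kappa>m[measurable]: "\<kappa> \<in> \<nu> \<rightarrow>\<^sub>M prob_algebra E"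
    using \<kappa> by (simp add: is_site_cond_distr_def measurable_cong_sets[OF s refl])
  have k: "(\<lambda>\<omega>. \<kappa> (p \<omega>)) \<in> \<pi> \<rightarrow>\<^sub>M prob_algebra E" by measurable
  have um[measurable]: "(\<lambda>z. (fst z)(i := snd z)) \<in> \<nu> \<Otimes>\<^sub>M E \<rightarrow>\<^sub>M (\<Pi>\<^sub>M j\<in>T. E)"
    using measurable_site_update[OF i] by (simp cong: measurable_cong_sets sets_pair_measure_cong add: s)
  have A': "A \<in> sets (\<Pi>\<^sub>M j\<in>T. E)" using A by (simp add: s)
  have Am[measurable]: "(\<lambda>z. indicator A ((fst z)(i := snd z)) :: ennreal) \<in> borel_measurable (\<nu> \<Otimes>\<^sub>M E)"
    by (rule measurable_compose[OF um borel_measurable_indicator[OF A']])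
  have pm: "(\<lambda>z. (p (fst z), snd z)) \<in> \<pi> \<Otimes>\<^sub>M E \<rightarrow>\<^sub>M \<nu> \<Otimes>\<^sub>M E" by measurable
  have "(\<integral>\<^sup>+ z. indicator A ((p (fst z))(i := snd z)) \<partial>semidirect \<pi> E (\<lambda>\<omega>. \<kappa> (p \<omega>))) =
      (\<integral>\<^sup>+ \<omega>. \<integral>\<^sup>+ u. indicator A ((p \<omega>)(i := u)) \<partial>\<kappa> (p \<omega>) \<partial>\<pi>)"
    using measurable_compose[OF pm Am] by (subst nn_integral_semidirect[OF \<pi> k]) auto
  also have "\<dots> = (\<integral>\<^sup>+ y. \<integral>\<^sup>+ u. indicator A (y(i := u)) \<partial>\<kappa> y \<partial>distr \<pi> \<nu> p)"
  proof (rule nn_integral_distr[symmetric, OF p])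
    have "(\<lambda>y. \<integral>\<^sup>+ u. indicator A ((fst (y, u))(i := snd (y, u))) \<partial>\<kappa> y) \<in> borel_measurable \<nu>"
      by (rule nn_integral_measurable_subprob_algebra2[OF _ measurable_prob_algebraD[OF \<kappa>m]])
        (use Am in \<open>simp add: case_prod_beta'\<close>)
    then show "(\<lambda>y. \<integral>\<^sup>+ u. indicator A (y(i := u)) \<partial>\<kappa> y) \<in> borel_measurable (distr \<pi> \<nu> p)" by simp
  qed
  also have "\<dots> = (\<integral>\<^sup>+ z. indicator A ((fst z)(i := snd z)) \<partial>semidirect \<nu> E \<kappa>)"
    unfolding distr using Am by (subst nn_integral_semidirect[OF \<nu> \<kappa>m]) auto
  also have "\<dots> = (\<integral>\<^sup>+ x. indicator A x \<partial>distr (semidirect \<nu> E \<kappa>) (\<Pi>\<^sub>M j\<in>T. E) (\<lambda>z. (fst z)(i := snd z)))"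
    using um A' by (subst nn_integral_distr) (simp_all add: measurable_cong_sets[OF sets_semidirect[OF \<nu> \<kappa>m] refl])
  also have "\<dots> = emeasure \<nu> A"
    unfolding resample_site[OF \<open>finite T\<close> i \<nu> s \<kappa>] using A by simp
  finally show ?thesis .
qed

section \<open>The trivial metric\<close>

context dobrushin_uniqueness
begin

context
  fixes \<nu> :: "('i \<Rightarrow> 'a) measure" and \<nu>c :: "'i \<Rightarrow> ('i \<Rightarrow> 'a) \<Rightarrow> 'a measure"
  assumes trivial: "\<And>x y. x \<in> space E \<Longrightarrow> y \<in> space E \<Longrightarrow> d x y = (if x = y then 0 else 1)"
    and d_meas: "(\<lambda>(x, y). d x y) \<in> borel_measurable (E \<Otimes>\<^sub>M E)"
    and \<nu>: "prob_space \<nu>" and sets_\<nu>: "sets \<nu> = sets S"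
    and cond_\<nu>: "\<And>i. i \<in> T \<Longrightarrow> is_site_cond_distr T E \<nu> i (\<nu>c i)"
begin

lemma \<nu>c_measurable: "i \<in> T \<Longrightarrow> \<nu>c i \<in> \<nu> \<rightarrow>\<^sub>M prob_algebra E"
  using cond_\<nu> by (simp add: is_site_cond_distr_def measurable_cong_sets[OF sets_\<nu> refl])

lemma \<mu>c_measurable_\<mu>: "i \<in> T \<Longrightarrow> \<mu>c i \<in> \<mu> \<rightarrow>\<^sub>M prob_algebra E"
  using \<mu>c_measurable by (simp add: measurable_cong_sets[OF sets_\<mu> refl])

lemma \<mu>c_measurable_\<nu>: "i \<in> T \<Longrightarrow> \<mu>c i \<in> \<nu> \<rightarrow>\<^sub>M prob_algebra E"
  using \<mu>c_measurable by (simp add: measurable_cong_sets[OF sets_\<nu> refl])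

lemma space_\<mu>_\<nu>: "space \<mu> = space S" "space \<nu> = space S"
  using sets_\<mu> sets_\<nu> by (auto dest: sets_eq_imp_space_eq)

text \<open>For the trivial metric and a coupling of \<open>\<mu>\<close> and \<open>\<nu>\<close>,
  this is the probability that the two configurations disagree at site \<open>j\<close>.\<close>

definition site_cost :: "(('i \<Rightarrow> 'a) \<times> ('i \<Rightarrow> 'a)) measure \<Rightarrow> 'i \<Rightarrow> ennreal" where
  "site_cost \<pi> j = (\<integral>\<^sup>+ z. ennreal (d (fst z j) (snd z j)) \<partial>\<pi>)"

lemma d_le_1: "x \<in> space E \<Longrightarrow> y \<in> space E \<Longrightarrow> d x y \<le> 1"
  by (simp add: trivial)

lemma d_measurable[measurable (raw)]:
  assumes [measurable]: "f \<in> M \<rightarrow>\<^sub>M E" "g \<in> M \<rightarrow>\<^sub>M E"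
  shows "(\<lambda>x. d (f x) (g x)) \<in> borel_measurable M"
  using measurable_compose[OF measurable_Pair[OF assms] d_meas] by simp

context
  fixes \<pi> assumes \<pi>: "\<pi> \<in> couplings \<mu> \<nu>"
begin

lemmas \<pi>D = couplingsD[OF \<pi>]

lemma prob_\<pi>: "prob_space \<pi>"
  by (rule \<pi>D(7)[OF prob_\<mu>])

lemma sets_\<pi>: "sets \<pi> = sets (S \<Otimes>\<^sub>M S)"
  using \<pi>D(1) by (simp cong: sets_pair_measure_cong add: sets_\<mu> sets_\<nu>)

lemma space_\<pi>: "z \<in> space \<pi> \<Longrightarrow> fst z \<in> space S \<and> snd z \<in> space S"
  using \<pi>D(2) space_\<mu>_\<nu> by auto

lemma site_distance_measurable: "j \<in> T \<Longrightarrow> (\<lambda>z. d (fst z j) (snd z j)) \<in> borel_measurable \<pi>"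
proof -
  assume j[measurable]: "j \<in> T"
  have "(\<lambda>z. d (fst z j) (snd z j)) \<in> borel_measurable (S \<Otimes>\<^sub>M S)"
    by (rule d_measurable) measurable
  then show ?thesis by (simp only: measurable_cong_sets[OF sets_\<pi> refl])
qed

lemma l1_cost_eq: "(\<integral>\<^sup>+ z. ennreal (l1_metric T d (fst z) (snd z)) \<partial>\<pi>) = (\<Sum>j\<in>T. site_cost \<pi> j)"
proof -
  have "(\<integral>\<^sup>+ z. ennreal (l1_metric T d (fst z) (snd z)) \<partial>\<pi>) = (\<integral>\<^sup>+ z. (\<Sum>j\<in>T. ennreal (d (fst z j) (snd z j))) \<partial>\<pi>)"
    using space_\<pi> by (intro nn_integral_cong) (auto simp: l1_metric_def sum_ennreal S_d_nonneg)
  also have "\<dots> = (\<Sum>j\<in>T. site_cost \<pi> j)"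
    unfolding site_cost_def using site_distance_measurable by (intro nn_integral_sum) auto
  finally show ?thesis .
qed

lemma site_cost_le_1: "j \<in> T \<Longrightarrow> site_cost \<pi> j \<le> 1"
proof -
  assume j: "j \<in> T"
  interpret prob_space \<pi> by (rule prob_\<pi>)
  have "site_cost \<pi> j \<le> (\<integral>\<^sup>+ z. 1 \<partial>\<pi>)"
    unfolding site_cost_def using space_\<pi> j
    by (intro nn_integral_mono) (auto intro!: d_le_1 simp: space_PiM)
  then show ?thesis by (simp add: emeasure_space_1)
qed

text \<open>Indicators are 1-Lipschitz for the trivial metric, so the coefficients bound the
  difference of the two kernels on any section of \<open>D\<close>, changing the configuration one
  site at a time. Integration over the coupling turns distances into disagreement
  probabilities.\<close>

lemma semidirect_\<mu>c_le:
  assumes i: "i \<in> T" and D: "D \<in> sets (\<pi> \<Otimes>\<^sub>M E)"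
  shows "emeasure (semidirect \<pi> E (\<lambda>\<omega>. \<mu>c i (fst \<omega>))) D \<le>
    emeasure (semidirect \<pi> E (\<lambda>\<omega>. \<mu>c i (snd \<omega>))) D + (\<Sum>j\<in>T. ennreal (c i j) * site_cost \<pi> j)"
proof -
  have k1: "(\<lambda>\<omega>. \<mu>c i (fst \<omega>)) \<in> \<pi> \<rightarrow>\<^sub>M prob_algebra E"
    by (rule measurable_compose[OF \<pi>D(3) \<mu>c_measurable_\<mu>[OF i]])
  have k2: "(\<lambda>\<omega>. \<mu>c i (snd \<omega>)) \<in> \<pi> \<rightarrow>\<^sub>M prob_algebra E"
    by (rule measurable_compose[OF \<pi>D(4) \<mu>c_measurable_\<nu>[OF i]])
  have sec: "Pair \<omega> -` D \<in> sets E" for \<omega> by (rule sets_Pair1[OF D])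
  have K: "emeasure (semidirect \<pi> E \<kappa>) D = (\<integral>\<^sup>+ \<omega>. emeasure (\<kappa> \<omega>) (Pair \<omega> -` D) \<partial>\<pi>)"
    if \<kappa>: "\<kappa> \<in> \<pi> \<rightarrow>\<^sub>M prob_algebra E" for \<kappa>
  proof -
    have "emeasure (semidirect \<pi> E \<kappa>) D = (\<integral>\<^sup>+ z. indicator D z \<partial>semidirect \<pi> E \<kappa>)"
      using D by (simp add: sets_semidirect[OF prob_\<pi> \<kappa>])
    also have "\<dots> = (\<integral>\<^sup>+ \<omega>. \<integral>\<^sup>+ u. indicator D (\<omega>, u) \<partial>\<kappa> \<omega> \<partial>\<pi>)"
      using D by (intro nn_integral_semidirect[OF prob_\<pi> \<kappa>]) simp
    also have "\<dots> = (\<integral>\<^sup>+ \<omega>. emeasure (\<kappa> \<omega>) (Pair \<omega> -` D) \<partial>\<pi>)"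
    proof (rule nn_integral_cong)
      fix \<omega> assume "\<omega> \<in> space \<pi>"
      then have "sets (\<kappa> \<omega>) = sets E" using kernel_in_prob_algebra[OF prob_\<pi> \<kappa>] by (simp add: space_prob_algebra)
      moreover have "(indicator D (\<omega>, u) :: ennreal) = indicator (Pair \<omega> -` D) u" for u by (simp add: indicator_def)
      ultimately show "(\<integral>\<^sup>+ u. indicator D (\<omega>, u) \<partial>\<kappa> \<omega>) = emeasure (\<kappa> \<omega>) (Pair \<omega> -` D)"
        using sec by simp
    qed
    finally show ?thesis .
  qed
  have "emeasure (semidirect \<pi> E (\<lambda>\<omega>. \<mu>c i (fst \<omega>))) D \<le>
      (\<integral>\<^sup>+ \<omega>. emeasure (\<mu>c i (snd \<omega>)) (Pair \<omega> -` D) + (\<Sum>j\<in>T. ennreal (c i j) * ennreal (d (fst \<omega> j) (snd \<omega> j))) \<partial>\<pi>)"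
    unfolding K[OF k1]
  proof (rule nn_integral_mono)
    fix \<omega> assume "\<omega> \<in> space \<pi>"
    then have x: "fst \<omega> \<in> space S" and y: "snd \<omega> \<in> space S" using space_\<pi> by auto
    let ?A = "Pair \<omega> -` D"
    interpret X: prob_space "\<mu>c i (fst \<omega>)" by (rule \<mu>c_space[OF i x])
    interpret Y: prob_space "\<mu>c i (snd \<omega>)" by (rule \<mu>c_space[OF i y])
    have "\<bar>measure (\<mu>c i (fst \<omega>)) ?A - measure (\<mu>c i (snd \<omega>)) ?A\<bar> \<le> (\<Sum>j\<in>T. c i j * d (fst \<omega> j) (snd \<omega> j))"
    proof (rule abs_diff_le_sum_of_coordinate_bounds[OF finite_T, where X = "\<lambda>_. space E" and F = "\<lambda>z. measure (\<mu>c i z) ?A" and b = "\<lambda>j s t. c i j * d s t"])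
      fix x y j assume xy: "x \<in> PiE T (\<lambda>_. space E)" "y \<in> PiE T (\<lambda>_. space E)" and j: "j \<in> T" and off: "\<forall>k\<in>T - {j}. x k = y k"
      then have x: "x \<in> space S" and y: "y \<in> space S" by (simp_all add: space_PiM)
      have "\<bar>(\<integral>u. indicat_real ?A u \<partial>\<mu>c i x) - (\<integral>u. indicat_real ?A u \<partial>\<mu>c i y)\<bar> \<le> 1 * c i j * d (x j) (y j)"
      proof (rule integral_\<mu>c_diff_le[OF i j x y off, where B = 1])
        show "indicat_real ?A \<in> borel_measurable E" using sec by (rule borel_measurable_indicator)
      qed (simp_all add: indicator_def trivial)
      then show "\<bar>measure (\<mu>c i x) ?A - measure (\<mu>c i y) ?A\<bar> \<le> c i j * d (x j) (y j)"
        using sec by (simp add: \<mu>c_space[OF i x] \<mu>c_space[OF i y])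
    qed (use x y in \<open>simp_all add: space_PiM\<close>)
    then have "measure (\<mu>c i (fst \<omega>)) ?A \<le> measure (\<mu>c i (snd \<omega>)) ?A + (\<Sum>j\<in>T. c i j * d (fst \<omega> j) (snd \<omega> j))"
      by linarith
    then have "ennreal (measure (\<mu>c i (fst \<omega>)) ?A) \<le> ennreal (measure (\<mu>c i (snd \<omega>)) ?A + (\<Sum>j\<in>T. c i j * d (fst \<omega> j) (snd \<omega> j)))"
      by (rule ennreal_leI)
    also have "\<dots> = ennreal (measure (\<mu>c i (snd \<omega>)) ?A) + (\<Sum>j\<in>T. ennreal (c i j) * ennreal (d (fst \<omega> j) (snd \<omega> j)))"
      using S_d_nonneg[OF x y] c_nonneg
      by (subst ennreal_plus) (auto intro!: sum_nonneg simp: ennreal_mult[symmetric] sum_ennreal)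
    finally show "emeasure (\<mu>c i (fst \<omega>)) ?A \<le> emeasure (\<mu>c i (snd \<omega>)) ?A + (\<Sum>j\<in>T. ennreal (c i j) * ennreal (d (fst \<omega> j) (snd \<omega> j)))"
      by (simp add: X.emeasure_eq_measure Y.emeasure_eq_measure)
  qed
  also have "\<dots> = (\<integral>\<^sup>+ \<omega>. emeasure (\<mu>c i (snd \<omega>)) (Pair \<omega> -` D) \<partial>\<pi>) +
      (\<integral>\<^sup>+ \<omega>. (\<Sum>j\<in>T. ennreal (c i j) * ennreal (d (fst \<omega> j) (snd \<omega> j))) \<partial>\<pi>)"
  proof (rule nn_integral_add)
    have eq: "(SIGMA x:space \<pi>. Pair x -` D) = D"
      using sets.sets_into_space[OF D] by (auto simp: space_pair_measure)
    show "(\<lambda>\<omega>. emeasure (\<mu>c i (snd \<omega>)) (Pair \<omega> -` D)) \<in> borel_measurable \<pi>"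
      by (rule emeasure_measurable_subprob_algebra2[OF _ measurable_prob_algebraD[OF k2]]) (simp add: eq D)
    show "(\<lambda>\<omega>. \<Sum>j\<in>T. ennreal (c i j) * ennreal (d (fst \<omega> j) (snd \<omega> j))) \<in> borel_measurable \<pi>"
      using site_distance_measurable by (intro borel_measurable_sum borel_measurable_times_ennreal) auto
  qed
  also have "(\<integral>\<^sup>+ \<omega>. (\<Sum>j\<in>T. ennreal (c i j) * ennreal (d (fst \<omega> j) (snd \<omega> j))) \<partial>\<pi>) =
      (\<Sum>j\<in>T. ennreal (c i j) * site_cost \<pi> j)"
    unfolding site_cost_def using site_distance_measurable
    by (subst nn_integral_sum) (auto intro!: sum.cong nn_integral_cmult)
  finally show ?thesis by (simp add: K[OF k2])
qed

text \<open>Costs at the other sites do not change. At site \<open>i\<close> the two kernels differ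
  in configuration and in measure; the kernel of \<open>\<mu>\<close> at the second configuration
  serves as an intermediate, so that the coefficients pay for the first change and the integrated
  distance under \<open>\<nu>\<close> for the second.\<close>

lemma site_update_coupling:
  assumes i: "i \<in> T"
  obtains \<pi>' where "\<pi>' \<in> couplings \<mu> \<nu>"
    "(\<integral>\<^sup>+ z. ennreal (l1_metric T d (fst z) (snd z)) \<partial>\<pi>') \<le>
      (\<Sum>j\<in>T - {i}. site_cost \<pi> j) + ((\<Sum>j\<in>T. ennreal (c i j) * site_cost \<pi> j) +
        (\<integral>\<^sup>+ x. wasserstein1 d (\<mu>c i x) (\<nu>c i x) \<partial>\<nu>))"
proof -
  define \<alpha> where "\<alpha> = (\<lambda>\<omega> :: ('i \<Rightarrow> 'a) \<times> ('i \<Rightarrow> 'a). \<mu>c i (fst \<omega>))"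
  define \<beta> where "\<beta> = (\<lambda>\<omega> :: ('i \<Rightarrow> 'a) \<times> ('i \<Rightarrow> 'a). \<nu>c i (snd \<omega>))"
  have \<alpha>: "\<alpha> \<in> \<pi> \<rightarrow>\<^sub>M prob_algebra E"
    unfolding \<alpha>_def by (rule measurable_compose[OF \<pi>D(3) \<mu>c_measurable_\<mu>[OF i]])
  have \<beta>: "\<beta> \<in> \<pi> \<rightarrow>\<^sub>M prob_algebra E"
    unfolding \<beta>_def by (rule measurable_compose[OF \<pi>D(4) \<nu>c_measurable[OF i]])
  show ?thesis
  proof (rule kernel_coupling[OF prob_\<pi> \<alpha> \<beta>])
    fix \<Gamma> D
    assume s\<Gamma>: "sets \<Gamma> = sets (\<pi> \<Otimes>\<^sub>M (E \<Otimes>\<^sub>M E))"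
      and u_marg: "\<And>\<phi>. \<phi> \<in> borel_measurable (\<pi> \<Otimes>\<^sub>M E) \<Longrightarrow>
         (\<integral>\<^sup>+ z. \<phi> (fst z, fst (snd z)) \<partial>\<Gamma>) = (\<integral>\<^sup>+ z. \<phi> z \<partial>semidirect \<pi> E \<alpha>)"
      and v_marg: "\<And>\<phi>. \<phi> \<in> borel_measurable (\<pi> \<Otimes>\<^sub>M E) \<Longrightarrow>
         (\<integral>\<^sup>+ z. \<phi> (fst z, snd (snd z)) \<partial>\<Gamma>) = (\<integral>\<^sup>+ z. \<phi> z \<partial>semidirect \<pi> E \<beta>)"
      and D: "D \<in> sets (\<pi> \<Otimes>\<^sub>M E)"
      and g: "\<And>g. g \<in> borel_measurable (E \<Otimes>\<^sub>M E) \<Longrightarrow> (\<And>u. u \<in> space E \<Longrightarrow> g (u, u) = 0) \<Longrightarrow> (\<And>z. g z \<le> 1) \<Longrightarrow>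
         (\<integral>\<^sup>+ z. g (snd z) \<partial>\<Gamma>) + emeasure (semidirect \<pi> E \<beta>) D \<le> emeasure (semidirect \<pi> E \<alpha>) D"
    have s\<pi>E: "sets (\<pi> \<Otimes>\<^sub>M E) = sets ((S \<Otimes>\<^sub>M S) \<Otimes>\<^sub>M E)"
      by (intro sets_pair_measure_cong sets_\<pi> refl)
    have s\<Gamma>': "sets \<Gamma> = sets ((S \<Otimes>\<^sub>M S) \<Otimes>\<^sub>M (E \<Otimes>\<^sub>M E))"
      unfolding s\<Gamma> by (intro sets_pair_measure_cong sets_\<pi> refl)
    have sp\<Gamma>: "space \<Gamma> = (space S \<times> space S) \<times> (space E \<times> space E)"
      using sets_eq_imp_space_eq[OF s\<Gamma>'] by (simp add: space_pair_measure)
    define \<Phi> where "\<Phi> = (\<lambda>z :: (('i \<Rightarrow> 'a) \<times> ('i \<Rightarrow> 'a)) \<times> 'a \<times> 'a. ((fst (fst z))(i := fst (snd z)), (snd (fst z))(i := snd (snd z))))"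
    have up1: "(\<lambda>z. (fst (fst z))(i := fst (snd z))) \<in> (S \<Otimes>\<^sub>M S) \<Otimes>\<^sub>M (E \<Otimes>\<^sub>M E) \<rightarrow>\<^sub>M S"
    proof -
      have "(\<lambda>z. (fst (fst z), fst (snd z))) \<in> (S \<Otimes>\<^sub>M S) \<Otimes>\<^sub>M (E \<Otimes>\<^sub>M E) \<rightarrow>\<^sub>M S \<Otimes>\<^sub>M E" by measurable
      from measurable_compose[OF this measurable_site_update[OF i]] show ?thesis by simp
    qed
    have up2: "(\<lambda>z. (snd (fst z))(i := snd (snd z))) \<in> (S \<Otimes>\<^sub>M S) \<Otimes>\<^sub>M (E \<Otimes>\<^sub>M E) \<rightarrow>\<^sub>M S"
    proof -
      have "(\<lambda>z. (snd (fst z), snd (snd z))) \<in> (S \<Otimes>\<^sub>M S) \<Otimes>\<^sub>M (E \<Otimes>\<^sub>M E) \<rightarrow>\<^sub>M S \<Otimes>\<^sub>M E" by measurable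
      from measurable_compose[OF this measurable_site_update[OF i]] show ?thesis by simp
    qed
    have s\<mu>\<nu>: "sets (\<mu> \<Otimes>\<^sub>M \<nu>) = sets (S \<Otimes>\<^sub>M S)"
      by (intro sets_pair_measure_cong sets_\<mu> sets_\<nu>)
    have \<Phi>: "\<Phi> \<in> \<Gamma> \<rightarrow>\<^sub>M \<mu> \<Otimes>\<^sub>M \<nu>"
      unfolding \<Phi>_def measurable_cong_sets[OF s\<Gamma>' s\<mu>\<nu>] by (rule measurable_Pair[OF up1 up2])
    define \<pi>' where "\<pi>' = distr \<Gamma> (\<mu> \<Otimes>\<^sub>M \<nu>) \<Phi>"
    have ind: "(\<lambda>z. indicator A ((f (fst z))(i := snd z)) :: ennreal) \<in> borel_measurable (\<pi> \<Otimes>\<^sub>M E)"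
      if A: "A \<in> sets S" and f: "f \<in> S \<Otimes>\<^sub>M S \<rightarrow>\<^sub>M S" for A and f :: "_ \<Rightarrow> 'i \<Rightarrow> 'a"
    proof -
      have "(\<lambda>z. (f (fst z), snd z)) \<in> (S \<Otimes>\<^sub>M S) \<Otimes>\<^sub>M E \<rightarrow>\<^sub>M S \<Otimes>\<^sub>M E" using f by measurable
      from measurable_compose[OF measurable_compose[OF this measurable_site_update[OF i]] borel_measurable_indicator[OF A]]
      show ?thesis by (simp add: measurable_cong_sets[OF s\<pi>E refl])
    qed
    have "distr \<pi>' \<mu> fst = \<mu>"
    proof (rule measure_eqI)
      fix A assume "A \<in> sets (distr \<pi>' \<mu> fst)"
      then have A: "A \<in> sets \<mu>" and AS: "A \<in> sets S" by (simp_all add: sets_\<mu>)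
      have "emeasure (distr \<pi>' \<mu> fst) A = (\<integral>\<^sup>+ x. indicator A x \<partial>distr \<pi>' \<mu> fst)" using A by simp
      also have "\<dots> = (\<integral>\<^sup>+ z. indicator A (fst z) \<partial>\<pi>')"
        using A by (intro nn_integral_distr) (simp_all add: \<pi>'_def)
      also have "\<dots> = (\<integral>\<^sup>+ z. indicator A ((fst (fst z))(i := fst (snd z))) \<partial>\<Gamma>)"
        unfolding \<pi>'_def using A \<Phi> by (subst nn_integral_distr) (simp_all add: \<Phi>_def)
      also have "\<dots> = (\<integral>\<^sup>+ z. indicator A ((fst (fst z))(i := snd z)) \<partial>semidirect \<pi> E \<alpha>)"
        using u_marg[OF ind[OF AS measurable_fst]] by simp
      also have "\<dots> = emeasure \<mu> A"
        unfolding \<alpha>_def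
        by (rule resample_marginal[OF finite_T i prob_\<mu> sets_\<mu> cond_\<mu>[OF i] prob_\<pi> \<pi>D(3) \<pi>D(5) A])
      finally show "emeasure (distr \<pi>' \<mu> fst) A = emeasure \<mu> A" .
    qed simp
    moreover have "distr \<pi>' \<nu> snd = \<nu>"
    proof (rule measure_eqI)
      fix A assume "A \<in> sets (distr \<pi>' \<nu> snd)"
      then have A: "A \<in> sets \<nu>" and AS: "A \<in> sets S" by (simp_all add: sets_\<nu>)
      have "emeasure (distr \<pi>' \<nu> snd) A = (\<integral>\<^sup>+ x. indicator A x \<partial>distr \<pi>' \<nu> snd)" using A by simp
      also have "\<dots> = (\<integral>\<^sup>+ z. indicator A (snd z) \<partial>\<pi>')"
        using A by (intro nn_integral_distr) (simp_all add: \<pi>'_def)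
      also have "\<dots> = (\<integral>\<^sup>+ z. indicator A ((snd (fst z))(i := snd (snd z))) \<partial>\<Gamma>)"
        unfolding \<pi>'_def using A \<Phi> by (subst nn_integral_distr) (simp_all add: \<Phi>_def)
      also have "\<dots> = (\<integral>\<^sup>+ z. indicator A ((snd (fst z))(i := snd z)) \<partial>semidirect \<pi> E \<beta>)"
        using v_marg[OF ind[OF AS measurable_snd]] by simp
      also have "\<dots> = emeasure \<nu> A"
        unfolding \<beta>_def
        by (rule resample_marginal[OF finite_T i \<nu> sets_\<nu> cond_\<nu>[OF i] prob_\<pi> \<pi>D(4) \<pi>D(6) A])
      finally show "emeasure (distr \<pi>' \<nu> snd) A = emeasure \<nu> A" .
    qed simp
    ultimately have \<pi>': "\<pi>' \<in> couplings \<mu> \<nu>" by (simp add: couplings_def \<pi>'_def)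

    \<comment> \<open>The minimum changes nothing for points of \<open>E\<close>; it makes the bound
      by 1 valid for all arguments, as the coupling estimate demands.\<close>
    define g0 where "g0 = (\<lambda>z. ennreal (min 1 (d (fst z) (snd z))))"
    have g0m: "g0 \<in> borel_measurable (E \<Otimes>\<^sub>M E)"
      unfolding g0_def by measurable
    have g0_cost: "(\<integral>\<^sup>+ z. g0 (snd z) \<partial>\<Gamma>) \<le> (\<Sum>j\<in>T. ennreal (c i j) * site_cost \<pi> j) +
        (\<integral>\<^sup>+ x. wasserstein1 d (\<mu>c i x) (\<nu>c i x) \<partial>\<nu>)"
    proof -
      let ?Q = "emeasure (semidirect \<pi> E \<beta>) D"
      interpret Q: prob_space "semidirect \<pi> E \<beta>" by (rule prob_space_semidirect[OF prob_\<pi> \<beta>])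
      have "(\<integral>\<^sup>+ z. g0 (snd z) \<partial>\<Gamma>) + ?Q \<le> emeasure (semidirect \<pi> E \<alpha>) D"
        by (rule g[OF g0m]) (auto simp: g0_def d_refl)
      also have "\<dots> \<le> emeasure (semidirect \<pi> E (\<lambda>\<omega>. \<mu>c i (snd \<omega>))) D + (\<Sum>j\<in>T. ennreal (c i j) * site_cost \<pi> j)"
        unfolding \<alpha>_def by (rule semidirect_\<mu>c_le[OF i D])
      also have "emeasure (semidirect \<pi> E (\<lambda>\<omega>. \<mu>c i (snd \<omega>))) D \<le> ?Q + (\<integral>\<^sup>+ x. wasserstein1 d (\<mu>c i x) (\<nu>c i x) \<partial>\<nu>)"
        unfolding \<beta>_def
      proof (rule semidirect_lift_le[OF \<nu> \<mu>c_measurable_\<nu>[OF i] \<nu>c_measurable[OF i] prob_\<pi> \<pi>D(4) \<pi>D(6) D])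
        fix y A assume y: "y \<in> space \<nu>" and A: "A \<in> sets E"
        then have yS: "y \<in> space S" by (simp add: space_\<mu>_\<nu>)
        have \<nu>cy: "prob_space (\<nu>c i y)" "sets (\<nu>c i y) = sets E"
          using kernel_in_prob_algebra[OF \<nu> \<nu>c_measurable[OF i] y] by (auto simp: space_prob_algebra)
        have "ennreal \<bar>(\<integral>u. indicat_real A u \<partial>\<mu>c i y) - (\<integral>u. indicat_real A u \<partial>\<nu>c i y)\<bar> \<le> ennreal 1 * wasserstein1 d (\<mu>c i y) (\<nu>c i y)"
        proof (rule abs_integral_diff_le_wasserstein1[OF \<mu>c_space(1,2)[OF i yS] \<nu>cy, where B = 1])
          show "indicat_real A \<in> borel_measurable E" using A by (rule borel_measurable_indicator)
        qed (simp_all add: indicator_def trivial)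
        then show "ennreal \<bar>measure (\<mu>c i y) A - measure (\<nu>c i y) A\<bar> \<le> wasserstein1 d (\<mu>c i y) (\<nu>c i y)"
          using A by (simp add: \<mu>c_space[OF i yS] \<nu>cy)
      qed
      \<comment> \<open>Both comparisons used the same set \<open>D\<close>, so its finite measure
        under the second kernel appears on both sides and cancels.\<close>
      finally have "?Q + (\<integral>\<^sup>+ z. g0 (snd z) \<partial>\<Gamma>) \<le> ?Q + ((\<Sum>j\<in>T. ennreal (c i j) * site_cost \<pi> j) +
          (\<integral>\<^sup>+ x. wasserstein1 d (\<mu>c i x) (\<nu>c i x) \<partial>\<nu>))"
        by (simp add: ac_simps add_right_mono)
      then show ?thesis by (simp add: ennreal_add_left_cancel_le Q.emeasure_finite)
    qed
    have "(\<integral>\<^sup>+ z. ennreal (l1_metric T d (fst z) (snd z)) \<partial>\<pi>') =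
        (\<integral>\<^sup>+ z. ennreal (l1_metric T d (fst (\<Phi> z)) (snd (\<Phi> z))) \<partial>\<Gamma>)"
      unfolding \<pi>'_def
    proof (rule nn_integral_distr[OF \<Phi>])
      have "(\<lambda>z. ennreal (l1_metric T d (fst z) (snd z))) \<in> borel_measurable (S \<Otimes>\<^sub>M S)"
        unfolding l1_metric_def by (intro measurable_compose[OF _ measurable_ennreal] borel_measurable_sum d_measurable) measurable
      then show "(\<lambda>z. ennreal (l1_metric T d (fst z) (snd z))) \<in> borel_measurable (distr \<Gamma> (\<mu> \<Otimes>\<^sub>M \<nu>) \<Phi>)"
        by (simp add: measurable_cong_sets[OF s\<mu>\<nu> refl])
    qed
    also have "\<dots> = (\<integral>\<^sup>+ z. (\<Sum>j\<in>T - {i}. ennreal (d (fst (fst z) j) (snd (fst z) j))) + g0 (snd z) \<partial>\<Gamma>)"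
    proof (rule nn_integral_cong)
      fix z assume "z \<in> space \<Gamma>"
      then have z: "fst (fst z) \<in> space S" "snd (fst z) \<in> space S" "fst (snd z) \<in> space E" "snd (snd z) \<in> space E"
        by (auto simp: sp\<Gamma>)
      have "l1_metric T d (fst (\<Phi> z)) (snd (\<Phi> z)) = d (fst (snd z)) (snd (snd z)) + (\<Sum>j\<in>T - {i}. d (fst (fst z) j) (snd (fst z) j))"
        unfolding l1_metric_def using finite_T i by (subst sum.remove[of _ i]) (auto simp: \<Phi>_def)
      moreover have "g0 (snd z) = ennreal (d (fst (snd z)) (snd (snd z)))"
        using d_le_1[OF z(3,4)] by (simp add: g0_def)
      moreover have "(\<Sum>j\<in>T - {i}. ennreal (d (fst (fst z) j) (snd (fst z) j))) =
          ennreal (\<Sum>j\<in>T - {i}. d (fst (fst z) j) (snd (fst z) j))"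
        using S_d_nonneg[OF z(1,2)] by (intro sum_ennreal) auto
      ultimately show "ennreal (l1_metric T d (fst (\<Phi> z)) (snd (\<Phi> z))) =
          (\<Sum>j\<in>T - {i}. ennreal (d (fst (fst z) j) (snd (fst z) j))) + g0 (snd z)"
        using S_d_nonneg[OF z(1,2)] d_nonneg[OF z(3,4)]
        by (simp only: add.commute, subst ennreal_plus) (auto intro!: sum_nonneg)
    qed
    also have "\<dots> = (\<Sum>j\<in>T - {i}. \<integral>\<^sup>+ z. ennreal (d (fst (fst z) j) (snd (fst z) j)) \<partial>\<Gamma>) + (\<integral>\<^sup>+ z. g0 (snd z) \<partial>\<Gamma>)"
    proof -
      have dm: "(\<lambda>z. ennreal (d (fst (fst z) j) (snd (fst z) j))) \<in> borel_measurable \<Gamma>" if [measurable]: "j \<in> T" for j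
        unfolding measurable_cong_sets[OF s\<Gamma>' refl] by (intro measurable_compose[OF _ measurable_ennreal] d_measurable) measurable
      have gm: "(\<lambda>z. g0 (snd z)) \<in> borel_measurable \<Gamma>"
        unfolding measurable_cong_sets[OF s\<Gamma>' refl] by (rule measurable_compose[OF measurable_snd g0m])
      have "(\<integral>\<^sup>+ z. (\<Sum>j\<in>T - {i}. ennreal (d (fst (fst z) j) (snd (fst z) j))) \<partial>\<Gamma>) =
          (\<Sum>j\<in>T - {i}. \<integral>\<^sup>+ z. ennreal (d (fst (fst z) j) (snd (fst z) j)) \<partial>\<Gamma>)"
        by (rule nn_integral_sum) (simp add: dm)
      then show ?thesis using dm gm by (subst nn_integral_add) auto
    qed
    also have "(\<Sum>j\<in>T - {i}. \<integral>\<^sup>+ z. ennreal (d (fst (fst z) j) (snd (fst z) j)) \<partial>\<Gamma>) = (\<Sum>j\<in>T - {i}. site_cost \<pi> j)"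
    proof (rule sum.cong[OF refl])
      fix j assume "j \<in> T - {i}"
      then have j: "j \<in> T" by simp
      have m: "(\<lambda>z. ennreal (d (fst (fst z) j) (snd (fst z) j))) \<in> borel_measurable (\<pi> \<Otimes>\<^sub>M E)"
        by (rule measurable_compose[OF measurable_compose[OF measurable_fst site_distance_measurable[OF j]] measurable_ennreal])
      have "(\<integral>\<^sup>+ z. ennreal (d (fst (fst z) j) (snd (fst z) j)) \<partial>\<Gamma>) = (\<integral>\<^sup>+ z. ennreal (d (fst (fst z) j) (snd (fst z) j)) \<partial>semidirect \<pi> E \<alpha>)"
        using u_marg[OF m] by simp
      also have "\<dots> = (\<integral>\<^sup>+ \<omega>. \<integral>\<^sup>+ u. ennreal (d (fst \<omega> j) (snd \<omega> j)) \<partial>\<alpha> \<omega> \<partial>\<pi>)"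
        by (subst nn_integral_semidirect[OF prob_\<pi> \<alpha> m]) simp
      also have "\<dots> = site_cost \<pi> j"
        unfolding site_cost_def
      proof (rule nn_integral_cong)
        fix \<omega> assume "\<omega> \<in> space \<pi>"
        then interpret A: prob_space "\<alpha> \<omega>" using kernel_in_prob_algebra[OF prob_\<pi> \<alpha>] by (simp add: space_prob_algebra)
        show "(\<integral>\<^sup>+ u. ennreal (d (fst \<omega> j) (snd \<omega> j)) \<partial>\<alpha> \<omega>) = ennreal (d (fst \<omega> j) (snd \<omega> j))"
          by (simp add: A.emeasure_space_1)
      qed
      finally show "(\<integral>\<^sup>+ z. ennreal (d (fst (fst z) j) (snd (fst z) j)) \<partial>\<Gamma>) = site_cost \<pi> j" .
    qed
    finally have "(\<integral>\<^sup>+ z. ennreal (l1_metric T d (fst z) (snd z)) \<partial>\<pi>') =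
        (\<Sum>j\<in>T - {i}. site_cost \<pi> j) + (\<integral>\<^sup>+ z. g0 (snd z) \<partial>\<Gamma>)" .
    then show ?thesis using that[OF \<pi>'] add_left_mono[OF g0_cost] by simp
  qed
qed

end

lemma wasserstein1_le_of_trivial:
  assumes a: "0 \<le> a" "(\<Sum>j\<in>T. \<integral>\<^sup>+ x. wasserstein1 d (\<mu>c j x) (\<nu>c j x) \<partial>\<nu>) = ennreal a"
  shows "wasserstein1 (l1_metric T d) \<mu> \<nu> \<le> ennreal (a / (1 - r))"
proof (rule ennreal_le_epsilon)
  fix e :: real assume e: "0 < e"
  \<comment> \<open>The slack is incurred once per site and divided by \<open>1 - r\<close> at the
    end; this choice makes the total exactly \<open>e\<close>.\<close>
  define \<epsilon> where "\<epsilon> = e * (1 - r) / card T"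
  have \<epsilon>: "0 < \<epsilon>" using e r_less_1 finite_T T_nonempty by (simp add: \<epsilon>_def card_gt_0_iff)
  define w where "w = wasserstein1 (l1_metric T d) \<mu> \<nu>"
  have w_le: "w \<le> (\<Sum>j\<in>T. site_cost \<pi> j)" if "\<pi> \<in> couplings \<mu> \<nu>" for \<pi>
    unfolding w_def wasserstein1_def l1_cost_eq[OF that, symmetric] using that by (rule INF_lower)
  \<comment> \<open>Finiteness of the optimal cost guarantees a coupling strictly below
    \<open>w + ennreal \<epsilon>\<close>.\<close>
  have "w \<le> (\<Sum>j\<in>T. 1)"
    using w_le[OF pair_measure_in_couplings[OF prob_\<mu> \<nu>]]
    by (rule order_trans) (intro sum_mono site_cost_le_1 pair_measure_in_couplings prob_\<mu> \<nu>)
  then have "w < top" by (rule le_less_trans) (simp add: of_nat_less_top)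
  then have "w < w + ennreal \<epsilon>" using \<epsilon> by (simp add: ennreal_add_left_cancel_less)
  then obtain \<pi> where \<pi>: "\<pi> \<in> couplings \<mu> \<nu>"
    and near: "(\<integral>\<^sup>+ z. ennreal (l1_metric T d (fst z) (snd z)) \<partial>\<pi>) < w + ennreal \<epsilon>"
    by (subst (asm) (1) w_def) (auto simp: wasserstein1_def INF_less_iff)
  define s where "s = (\<lambda>j. enn2real (site_cost \<pi> j))"
  have s: "site_cost \<pi> j = ennreal (s j)" "0 \<le> s j" if "j \<in> T" for j
    using site_cost_le_1[OF \<pi> that] by (auto simp: s_def le_less_trans)
  have sum_s: "(\<Sum>j\<in>J. site_cost \<pi> j) = ennreal (\<Sum>j\<in>J. s j)" if "J \<subseteq> T" for J
  proof -
    have "(\<Sum>j\<in>J. site_cost \<pi> j) = (\<Sum>j\<in>J. ennreal (s j))" using that s by (intro sum.cong) auto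
    also have "\<dots> = ennreal (\<Sum>j\<in>J. s j)" using that s by (intro sum_ennreal) auto
    finally show ?thesis .
  qed
  define A where "A = (\<lambda>j. enn2real (\<integral>\<^sup>+ x. wasserstein1 d (\<mu>c j x) (\<nu>c j x) \<partial>\<nu>))"
  have A: "(\<integral>\<^sup>+ x. wasserstein1 d (\<mu>c j x) (\<nu>c j x) \<partial>\<nu>) = ennreal (A j)" "0 \<le> A j" if "j \<in> T" for j
  proof -
    have "(\<integral>\<^sup>+ x. wasserstein1 d (\<mu>c j x) (\<nu>c j x) \<partial>\<nu>) \<le> ennreal a"
      unfolding a(2)[symmetric] using finite_T that by (intro member_le_sum) auto
    then show "(\<integral>\<^sup>+ x. wasserstein1 d (\<mu>c j x) (\<nu>c j x) \<partial>\<nu>) = ennreal (A j)" "0 \<le> A j"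
      by (auto simp: A_def le_less_trans)
  qed
  have "ennreal (\<Sum>j\<in>T. A j) = (\<Sum>j\<in>T. ennreal (A j))"
    using A by (intro sum_ennreal[symmetric]) auto
  also have "\<dots> = ennreal a"
    unfolding a(2)[symmetric] using A by (intro sum.cong) auto
  finally have "ennreal (\<Sum>j\<in>T. A j) = ennreal a" .
  then have sumA: "(\<Sum>j\<in>T. A j) = a" using a A by (simp add: sum_nonneg)
  \<comment> \<open>The updated coupling cannot be cheaper than the optimum, so the update gains at
    most \<open>\<epsilon>\<close>. Its costs at all sites other than \<open>i\<close> are those of
    \<open>\<pi>\<close> and, being finite, cancel.\<close>
  have step: "s i \<le> (\<Sum>j\<in>T. c i j * s j) + A i + \<epsilon>" if i: "i \<in> T" for i
  proof -
    obtain \<pi>' where \<pi>': "\<pi>' \<in> couplings \<mu> \<nu>"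
      and cost: "(\<integral>\<^sup>+ z. ennreal (l1_metric T d (fst z) (snd z)) \<partial>\<pi>') \<le>
        (\<Sum>j\<in>T - {i}. site_cost \<pi> j) + ((\<Sum>j\<in>T. ennreal (c i j) * site_cost \<pi> j) +
        (\<integral>\<^sup>+ x. wasserstein1 d (\<mu>c i x) (\<nu>c i x) \<partial>\<nu>))"
      using site_update_coupling[OF \<pi> i] by blast
    let ?R = "(\<Sum>j\<in>T - {i}. s j) + ((\<Sum>j\<in>T. c i j * s j) + A i)"
    have R: "0 \<le> (\<Sum>j\<in>T - {i}. s j)" "0 \<le> (\<Sum>j\<in>T. c i j * s j)"
      using s c_nonneg by (auto intro!: sum_nonneg)
    have "(\<Sum>j\<in>T. ennreal (c i j) * site_cost \<pi> j) = (\<Sum>j\<in>T. ennreal (c i j * s j))"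
      using s c_nonneg by (intro sum.cong) (auto simp: ennreal_mult)
    also have "\<dots> = ennreal (\<Sum>j\<in>T. c i j * s j)"
      using s c_nonneg by (intro sum_ennreal) auto
    finally have eqs: "(\<Sum>j\<in>T. ennreal (c i j) * site_cost \<pi> j) = ennreal (\<Sum>j\<in>T. c i j * s j)"
      "(\<Sum>j\<in>T - {i}. site_cost \<pi> j) = ennreal (\<Sum>j\<in>T - {i}. s j)"
      "(\<Sum>j\<in>T. site_cost \<pi> j) = ennreal (\<Sum>j\<in>T. s j)"
      by (auto simp: sum_s)
    have "ennreal (\<Sum>j\<in>T. s j) \<le> w + ennreal \<epsilon>"
      using near unfolding l1_cost_eq[OF \<pi>] eqs by simp
    moreover have "w \<le> ennreal ?R"
      using order_trans[OF w_le[OF \<pi>', folded l1_cost_eq[OF \<pi>']] cost] R A[OF i]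
      by (simp add: eqs ennreal_plus)
    ultimately have "ennreal (\<Sum>j\<in>T. s j) \<le> ennreal ?R + ennreal \<epsilon>"
      using add_right_mono order_trans by blast
    also have "\<dots> = ennreal (?R + \<epsilon>)"
      using R A[OF i] \<epsilon> by (intro ennreal_plus[symmetric]) auto
    finally have "(\<Sum>j\<in>T. s j) \<le> ?R + \<epsilon>"
      using R A[OF i] \<epsilon> by (subst (asm) ennreal_le_iff) auto
    moreover have "(\<Sum>j\<in>T. s j) = s i + (\<Sum>j\<in>T - {i}. s j)"
      using finite_T i by (rule sum.remove)
    ultimately show ?thesis by linarith
  qed
  have "(\<Sum>i\<in>T. s i) \<le> (\<Sum>i\<in>T. (\<Sum>j\<in>T. c i j * s j) + A i + \<epsilon>)"
    by (rule sum_mono[OF step])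
  \<comment> \<open>Exchanging the sums collects the coefficients of each \<open>s j\<close> into
    the column sum at \<open>j\<close>, where the norm applies.\<close>
  also have "\<dots> = (\<Sum>j\<in>T. (\<Sum>i\<in>T. c i j) * s j) + a + card T * \<epsilon>"
    by (simp add: sum.distrib sumA sum_distrib_right) (rule sum.swap)
  also have "(\<Sum>j\<in>T. (\<Sum>i\<in>T. c i j) * s j) \<le> (\<Sum>j\<in>T. r * s j)"
    using sum_c_le s by (intro sum_mono mult_right_mono) auto
  also have "\<dots> = r * (\<Sum>j\<in>T. s j)" by (simp add: sum_distrib_left)
  finally have "(\<Sum>i\<in>T. s i) \<le> r * (\<Sum>i\<in>T. s i) + a + card T * \<epsilon>" by simp
  moreover have "card T * \<epsilon> = (1 - r) * e"
    using finite_T T_nonempty by (simp add: \<epsilon>_def)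
  ultimately have "(1 - r) * (\<Sum>i\<in>T. s i) \<le> a + (1 - r) * e" by (simp add: algebra_simps)
  then have "(\<Sum>i\<in>T. s i) \<le> a / (1 - r) + e"
    using r_less_1 by (simp add: field_simps)
  moreover have "w \<le> ennreal (\<Sum>i\<in>T. s i)"
    using w_le[OF \<pi>] by (simp add: sum_s)
  ultimately have "w \<le> ennreal (a / (1 - r) + e)"
    using order_trans ennreal_leI by blast
  also have "\<dots> = ennreal (a / (1 - r)) + ennreal e"
    using a e r_less_1 by (intro ennreal_plus) auto
  finally show "wasserstein1 (l1_metric T d) \<mu> \<nu> \<le> ennreal (a / (1 - r)) + ennreal e"
    unfolding w_def .
qed

end

end

section \<open>Separable Borel metrics and assembly of the two cases\<close>

lemma borel_polish_metricD:
  assumes "borel_polish_metric E d"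
  shows "Metric_space (space E) d"
    and "\<And>b. b \<in> space E \<Longrightarrow> d b \<in> borel_measurable E"
    and "\<exists>C. countable C \<and> C \<subseteq> space E \<and> (\<forall>x\<in>space E. \<forall>e>0. \<exists>b\<in>C. d b x < e)"
proof -
  show ms: "Metric_space (space E) d" using assms unfolding borel_polish_metric_def by blast
  interpret Metric_space "space E" d by fact
  have sets: "sets E = sigma_sets (space E) {U. openin mtopology U}" and sep: "separable_space mtopology"
    using assms unfolding borel_polish_metric_def by blast+
  show "d b \<in> borel_measurable E" if b: "b \<in> space E" for b
    unfolding borel_measurable_iff_less
  proof
    fix a
    have "{x \<in> space E. d b x < a} = mball b a" using b by (simp add: mball_def)
    also have "\<dots> \<in> sets E" unfolding sets by (intro sigma_sets.Basic) simp
    finally show "{x \<in> space E. d b x < a} \<in> sets E" .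
  qed
  from sep obtain C where C: "countable C" "C \<subseteq> space E" "mtopology closure_of C = space E"
    unfolding separable_space_def topspace_mtopology by blast
  have dense: "\<exists>b\<in>C. d b x < e" if x: "x \<in> space E" and e: "0 < e" for x e
  proof -
    have "x \<in> mtopology closure_of C" using C x by simp
    moreover have "x \<in> mball x e" using x e by (simp only: centre_in_mball_iff)
    ultimately obtain b where "b \<in> C" "b \<in> mball x e"
      using openin_mball unfolding in_closure_of by blast
    then have "d b x < e" by (simp only: in_mball commute[of b x])
    with \<open>b \<in> C\<close> show ?thesis by (rule bexI[rotated])
  qed
  show "\<exists>C. countable C \<and> C \<subseteq> space E \<and> (\<forall>x\<in>space E. \<forall>e>0. \<exists>b\<in>C. d b x < e)"
    by (intro exI[of _ C] conjI ballI allI impI C(1,2) dense)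
qed

theorem proposition4p2:
  fixes T :: "'i set"
    and E :: "'a measure"
    and d :: "'a \<Rightarrow> 'a \<Rightarrow> real"
    and \<mu> \<nu> :: "('i \<Rightarrow> 'a) measure"
    and \<mu>c \<nu>c :: "'i \<Rightarrow> ('i \<Rightarrow> 'a) \<Rightarrow> 'a measure"
  assumes "finite T"
    and "borel_polish_metric E d \<or> measurable_trivial_metric E d"
    and "prob_space \<mu>" and "sets \<mu> = sets (\<Pi>\<^sub>M i\<in>T. E)"
    and "\<And>i. i \<in> T \<Longrightarrow> is_site_cond_distr T E \<mu> i (\<mu>c i)"
    and "dobrushin_norm1 T E d \<mu>c < 1"
    and "prob_space \<nu>" and "sets \<nu> = sets (\<Pi>\<^sub>M i\<in>T. E)"
    and "\<And>i. i \<in> T \<Longrightarrow> is_site_cond_distr T E \<nu> i (\<nu>c i)"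
  shows "wasserstein1 (l1_metric T d) \<mu> \<nu>
         \<le> 1 / (1 - dobrushin_norm1 T E d \<mu>c) *
            (\<Sum>j\<in>T. \<integral>\<^sup>+ x. wasserstein1 d (\<mu>c j x) (\<nu>c j x) \<partial>\<nu>)"
proof (cases "T = {}")
  case True
  \<comment> \<open>Without sites \<open>l1_metric\<close> is an empty sum, so every coupling has
    cost 0; this case lies outside the locale.\<close>
  then show ?thesis using assms(3,7) by (simp add: wasserstein1_eq_0 l1_metric_def)
next
  case False
  have metric: "(\<forall>x\<in>space E. \<forall>y\<in>space E. 0 \<le> d x y \<and> (d x y = 0 \<longleftrightarrow> x = y) \<and> d x y = d y x \<and>
      (\<forall>z\<in>space E. d x z \<le> d x y + d y z))"
    using assms(2)
  proof
    assume "borel_polish_metric E d"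
    then interpret Metric_space "space E" d by (rule borel_polish_metricD)
    show ?thesis
    proof (intro ballI conjI)
      fix x y z assume E: "x \<in> space E" "y \<in> space E" "z \<in> space E"
      show "d x z \<le> d x y + d y z" using E by (rule triangle)
      show "d x y = d y x" by (rule commute)
    qed (simp_all only: nonneg zero)
  next
    assume "measurable_trivial_metric E d"
    then have "d x y = (if x = y then 0 else 1)" if "x \<in> space E" "y \<in> space E" for x y
      using that unfolding measurable_trivial_metric_def by blast
    then show ?thesis by simp
  qed
  interpret dobrushin_uniqueness T E d \<mu> \<mu>c
  proof (rule dobrushin_uniqueness.intro)
    show "0 < d x y" if "x \<in> space E" "y \<in> space E" "x \<noteq> y" for x y
      using metric that by (metis less_le)
    show "d x z \<le> d x y + d y z" if "x \<in> space E" "y \<in> space E" "z \<in> space E" for x y z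
      using metric that by blast
  qed (use metric False assms(1,3-6) in simp_all)
  let ?R = "\<Sum>j\<in>T. \<integral>\<^sup>+ x. wasserstein1 d (\<mu>c j x) (\<nu>c j x) \<partial>\<nu>"
  have factor: "1 / (1 - dobrushin_norm1 T E d \<mu>c) = ennreal (1 / (1 - r))"
  proof -
    have "1 - dobrushin_norm1 T E d \<mu>c = ennreal (1 - r)"
      unfolding ennreal_r[symmetric] ennreal_1[symmetric] using r_nonneg by (rule ennreal_minus)
    then show ?thesis using r_less_1 divide_ennreal[of 1 "1 - r"] by simp
  qed
  show ?thesis
  \<comment> \<open>An infinite sum makes the bound trivial because its factor is positive.
    Otherwise the sum is a real number \<open>a\<close>, as both special cases require.\<close>
  proof (cases "?R = \<infinity>")
    case True
    then show ?thesis unfolding factor using r_less_1 by (simp add: ennreal_mult_top)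
  next
    case False
    define a where "a = enn2real ?R"
    have a: "0 \<le> a" "?R = ennreal a"
      using False by (simp_all only: a_def enn2real_nonneg ennreal_enn2real_if infinity_ennreal_def if_False)
    have "wasserstein1 (l1_metric T d) \<mu> \<nu> \<le> ennreal (a / (1 - r))"
      using assms(2)
    proof
      assume "borel_polish_metric E d"
      note E = borel_polish_metricD[OF this]
      from E(3) obtain C where C: "countable C" "C \<subseteq> space E"
        "\<And>x e. x \<in> space E \<Longrightarrow> 0 < e \<Longrightarrow> \<exists>b\<in>C. d b x < e" by metis
      show ?thesis by (rule wasserstein1_le_of_separable[OF assms(7-9) a C E(2)])
    next
      assume "measurable_trivial_metric E d"
      then have trivial: "\<And>x y. x \<in> space E \<Longrightarrow> y \<in> space E \<Longrightarrow> d x y = (if x = y then 0 else 1)"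
        and meas: "(\<lambda>(x, y). d x y) \<in> borel_measurable (E \<Otimes>\<^sub>M E)"
        unfolding measurable_trivial_metric_def by blast+
      show ?thesis by (rule wasserstein1_le_of_trivial[OF trivial meas assms(7-9) a])
    qed
    also have "\<dots> = ennreal (1 / (1 - r)) * ?R"
      unfolding a(2) using a(1) r_less_1 by (subst ennreal_mult[symmetric]) auto
    finally show ?thesis unfolding factor .
  qed
qed

end
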